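(* Let $B$ be any ball in $\mathbb{R}^d$. For $0<q<1$, $$\sup\{F_{1,q}(\Omega) : \Omega\subset\mathbb{R}^d\text{ open and convex},\ 0<|\Omega|<\infty\}=+\infty,$$ $$\min\{F_{1,q}(\Omega) : \Omega\subset\mathbb{R}^d\text{ open},\ 0<|\Omega|<\infty\}=F_{1,q}(B).$$ For $q>1$, $$\inf\{F_{1,q}(\Omega) : \Omega\subset\mathbb{R}^d\text{ open and convex},\ 0<|\Omega|<\infty\}=0,$$ $$\max\{F_{1,q}(\Omega) : \Omega\subset\mathbb{R}^d\text{ open},\ 0<|\Omega|<\infty\}=F_{1,q}(B).$$
   Context: $|\cdot|$ is Lebesgue measure on $\mathbb{R}^d$ and $P(E)$ is the De Giorgi perimeter, $P(E)=\sup\{\int_E\operatorname{div}\phi\,dx : \phi\in C^1_c(\mathbb{R}^d;\mathbb{R}^d),\ \|\phi\|_{L^\infty(\mathbb{R}^d)}\le1\}$. For an open set $\Omega\subset\mathbb{R}^d$ with finite measure the Cheeger constant is $$h(\Omega)=\inf\Big\{\frac{P(E)}{|E|} : |E|>0,\ E\Subset\Omega\Big\},$$ where $E\Subset\Omega$ means $\overline{E}\subset\Omega$. For $q>0$, $$F_{1,q}(\Omega)=\big(h(\Omega)\,|\Omega|^{1/d}\big)^{1-q}.$$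
   Formalization: The claims sup = +∞ and inf = 0 over open convex sets are stated only for d ≥ 2, since for d = 1 such sets are bounded intervals, on which F_{1,q} is constantly 2^{1-q}; the min and max claims are stated for every d ≥ 1. *)

theory Defs
  imports "HOL-Analysis.Analysis"
begin

definition C1_vector_field :: "('a::euclidean_space \<Rightarrow> 'a) \<Rightarrow> bool" where
  "C1_vector_field \<phi> \<longleftrightarrow>
     (\<exists>\<phi>'. (\<forall>x. (\<phi> has_derivative blinfun_apply (\<phi>' x)) (at x)) \<and> continuous_on UNIV \<phi>')"

definition C1c_vector_field :: "('a::euclidean_space \<Rightarrow> 'a) \<Rightarrow> bool" where
  "C1c_vector_field \<phi> \<longleftrightarrow> C1_vector_field \<phi> \<and> compact (closure {x. \<phi> x \<noteq> 0})"

definition divergence :: "('a::euclidean_space \<Rightarrow> 'a) \<Rightarrow> 'a \<Rightarrow> real" where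
  "divergence \<phi> x = (\<Sum>b\<in>Basis. frechet_derivative \<phi> (at x) b \<bullet> b)"

text \<open>The almost-everywhere bound is the inequality between the sup norm of the (Euclidean) length
  of the field, as an element of the space of essentially bounded functions, and 1.
  The perimeter is only meaningful for Lebesgue measurable sets.\<close>

definition perimeter :: "'a::euclidean_space set \<Rightarrow> ereal" where
  "perimeter E =
     (SUP \<phi>\<in>{\<phi>. C1c_vector_field \<phi> \<and> (AE x in lebesgue. norm (\<phi> x) \<le> 1)}.
        ereal (LINT x:E|lebesgue. divergence \<phi> x))"

definition cheeger :: "'a::euclidean_space set \<Rightarrow> ereal" where
  "cheeger \<Omega> =
     (INF E\<in>{E. E \<in> sets lebesgue \<and> emeasure lebesgue E > 0 \<and> closure E \<subseteq> \<Omega>}.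
        perimeter E / enn2ereal (emeasure lebesgue E))"

text \<open>Power of an extended nonnegative real with a real exponent, with the usual limiting values
  at \<open>0\<close> and \<open>\<infinity>\<close>. (For \<^const>\<open>powr\<close> on the reals, \<open>0 powr p = 0\<close> even for \<open>p < 0\<close>.)\<close>

definition ereal_powr :: "ereal \<Rightarrow> real \<Rightarrow> ereal" where
  "ereal_powr x p =
     (if p = 0 then 1
      else if x = 0 then (if p < 0 then \<infinity> else 0)
      else if x = \<infinity> then (if p < 0 then 0 else \<infinity>)
      else ereal (real_of_ereal x powr p))"

text \<open>The functional \<open>F\<^sub>1\<^sub>,\<^sub>q\<close>, for sets of finite measure.\<close>

definition F1 :: "real \<Rightarrow> 'a::euclidean_space set \<Rightarrow> ereal" where
  "F1 q \<Omega> =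
     ereal_powr (cheeger \<Omega> * ereal (measure lebesgue \<Omega> powr (1 / real DIM('a)))) (1 - q)"

definition admissible :: "'a::euclidean_space set set" where
  "admissible = {\<Omega>. open \<Omega> \<and> 0 < emeasure lebesgue \<Omega> \<and> emeasure lebesgue \<Omega> < \<infinity>}"

definition convex_admissible :: "'a::euclidean_space set set" where
  "convex_admissible = {\<Omega> \<in> admissible. convex \<Omega>}"

definition is_minimum_of :: "ereal \<Rightarrow> ereal set \<Rightarrow> bool" where
  "is_minimum_of m S \<longleftrightarrow> m \<in> S \<and> (\<forall>y\<in>S. m \<le> y)"

definition is_maximum_of :: "ereal \<Rightarrow> ereal set \<Rightarrow> bool" where
  "is_maximum_of m S \<longleftrightarrow> m \<in> S \<and> (\<forall>y\<in>S. y \<le> m)"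

end

(* The isoperimetric inequality P(E) >= d |B_1|^(1/d) |E|^(1 - 1/d), applied to the competitors E in
   the Cheeger quotient, gives h(Omega) |Omega|^(1/d) >= d |B_1|^(1/d), with equality for balls, whose
   concentric balls show h(B_r) <= d / r. Flat boxes make h(Omega) |Omega|^(1/d) arbitrarily large,
   because P(E) >= |E| / (4 w) for every E in a slab of width 2 w.

   For the isoperimetric inequality let u be a mollification of the indicator function of E. Testing
   the perimeter with the mollification of -grad u / |grad u| shows that the integral of |grad u| is
   at most P(E). On the other hand {u > s} + t B_1 is contained, up to o(t), in {u + t |grad u| > s};
   integrating the Brunn-Minkowski lower bound for |{u > s} + t B_1| over s and comparing the terms
   of first order in t bounds the integral of |grad u| from below. *)
theory Submission imports Defs begin

text \<open>A set \<open>E\<close> that is only measurable cannot be enlarged by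
  \<open>t B_1\<close> directly: the first-order growth of its measure is a Minkowski content, which
  the perimeter does not control, since null sets can change it. The superlevel sets of the C^1
  function \<open>u\<close> avoid this. They are bounded and open, so Brunn-Minkowski is required
  for such sets only, and the linearization error of \<open>u\<close> is uniform in the base point,
  which turns the inclusion of enlarged level sets into an inequality between integrals. Only levels
  between \<open>\<delta>\<close> and \<open>1 - \<delta>\<close> are used: there the superlevel
  sets are bounded, even if \<open>E\<close> is not, and have almost the measure of
  \<open>E\<close>; the loss disappears with \<open>\<delta>\<close>. The field -grad u / |grad u|
  is merely bounded and measurable. Convolving it with the even kernel that produced
  \<open>u\<close> makes it an admissible C^1 field, and Fubini moves this convolution back onto the
  indicator of \<open>E\<close>, where it reproduces grad u.\<close>

section \<open>The Brunn--Minkowski inequality\<close>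

text \<open>Superadditivity of the geometric mean. Divide by the right-hand side and apply the
  inequality of arithmetic and geometric means to the ratios \<open>x i / (x i + y i)\<close> and to
  \<open>y i / (x i + y i)\<close>: the two arithmetic means add up to 1.\<close>

lemma prod_powr_add_le:
  fixes x y :: "'i \<Rightarrow> real"
  assumes fin: "finite S" "S \<noteq> {}"
    and x: "\<And>i. i \<in> S \<Longrightarrow> x i > 0" and y: "\<And>i. i \<in> S \<Longrightarrow> y i > 0"
  shows "prod x S powr (1 / card S) + prod y S powr (1 / card S)
    \<le> (\<Prod>i\<in>S. x i + y i) powr (1 / card S)"
proof -
  define p where "p = 1 / real (card S)"
  define Z where "Z = (\<Prod>i\<in>S. x i + y i)"
  have Z: "Z > 0" unfolding Z_def by (intro prod_pos) (use x y add_pos_pos in blast)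
  have xy: "x i + y i > 0" if "i \<in> S" for i using x[OF that] y[OF that] by simp
  have *: "prod w S powr p \<le> (\<Sum>i\<in>S. w i / (x i + y i) / card S) * Z powr p"
    if w: "\<And>i. i \<in> S \<Longrightarrow> w i > 0" for w :: "'i \<Rightarrow> real"
  proof -
    have "prod w S = (\<Prod>i\<in>S. w i / (x i + y i)) * Z"
      using Z by (simp add: prod_dividef Z_def)
    moreover have "(\<Prod>i\<in>S. w i / (x i + y i)) \<ge> 0"
      using w xy by (intro prod_nonneg) (simp add: less_imp_le)
    ultimately have "prod w S powr p = (\<Prod>i\<in>S. w i / (x i + y i)) powr p * Z powr p"
      using Z by (simp add: powr_mult)
    moreover have "(\<Prod>i\<in>S. w i / (x i + y i)) powr p \<le> (\<Sum>i\<in>S. w i / (x i + y i) / card S)"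
      unfolding p_def using w xy by (intro arith_geom_mean fin) (simp add: less_imp_le)
    ultimately show ?thesis by (simp add: mult_right_mono)
  qed
  have "(\<Sum>i\<in>S. x i / (x i + y i) / card S) + (\<Sum>i\<in>S. y i / (x i + y i) / card S)
      = (\<Sum>i\<in>S. (x i / (x i + y i) + y i / (x i + y i)) / card S)"
    by (simp add: sum.distrib add_divide_distrib)
  also have "\<dots> = (\<Sum>i\<in>S. 1 / card S)"
    by (intro sum.cong refl) (use xy in \<open>simp flip: add_divide_distrib add: less_imp_neq[THEN not_sym]\<close>)
  also have "\<dots> = 1" using fin by simp
  finally have sum1: "(\<Sum>i\<in>S. x i / (x i + y i) / card S) + (\<Sum>i\<in>S. y i / (x i + y i) / card S) = 1" .
  have "prod x S powr p + prod y S powr p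
     \<le> ((\<Sum>i\<in>S. x i / (x i + y i) / card S) + (\<Sum>i\<in>S. y i / (x i + y i) / card S)) * Z powr p"
    unfolding distrib_right by (intro add_mono * x y)
  then show ?thesis unfolding sum1 p_def Z_def by simp
qed

text \<open>Written as a union of singletons so that \<open>open_sums\<close> and
  \<open>bounded_sums\<close> apply verbatim.\<close>

definition minkowski_sum :: "'a::euclidean_space set \<Rightarrow> 'a set \<Rightarrow> 'a set" where
  "minkowski_sum A B = (\<Union>x\<in>A. \<Union>y\<in>B. {x + y})"

lemma minkowski_sum_commute: "minkowski_sum A B = minkowski_sum B A"
  unfolding minkowski_sum_def by (auto simp: add.commute)

lemma minkowski_sum_mono: "A \<subseteq> A' \<Longrightarrow> B \<subseteq> B' \<Longrightarrow> minkowski_sum A B \<subseteq> minkowski_sum A' B'"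
  unfolding minkowski_sum_def by blast

lemma open_minkowski_sum: "open A \<or> open B \<Longrightarrow> open (minkowski_sum A B)"
  unfolding minkowski_sum_def by (rule open_sums)

lemma bounded_minkowski_sum: "bounded A \<Longrightarrow> bounded B \<Longrightarrow> bounded (minkowski_sum A B)"
  unfolding minkowski_sum_def by (rule bounded_sums)

lemma open_bounded_fmeasurable:
  fixes A :: "'a::euclidean_space set"
  assumes "open A" "bounded A"
  shows "A \<in> fmeasurable lborel"
  using assms emeasure_bounded_finite by (intro fmeasurableI) auto

lemma measure_lborel_mono_open:
  fixes A B :: "'a::euclidean_space set"
  assumes "A \<subseteq> B" "open A" "open B" "bounded B"
  shows "measure lborel A \<le> measure lborel B"
proof (rule measure_mono_fmeasurable[OF assms(1)])
  show "A \<in> sets lborel" using assms by simp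
  show "B \<in> fmeasurable lborel"
    using assms by (simp add: open_bounded_fmeasurable)
qed

text \<open>The number \<open>n\<close> drives the induction in Brunn-Minkowski. It is only an upper
  bound, because cutting can turn several boxes into the empty box. Open boxes stay open boxes when
  they are cut by open half-spaces.\<close>

definition box_union :: "nat \<Rightarrow> 'a::euclidean_space set \<Rightarrow> bool" where
  "box_union n A \<longleftrightarrow> (\<exists>F. finite F \<and> card F \<le> n \<and> (\<forall>X\<in>F. \<exists>a b. X = box a b) \<and> disjoint F \<and> A = \<Union>F)"

lemma box_union_open: "box_union n A \<Longrightarrow> open A"
  unfolding box_union_def by (force intro!: open_Union simp: open_box)

lemma box_union_bounded: "box_union n A \<Longrightarrow> bounded A"
  unfolding box_union_def by (force intro!: bounded_Union simp: bounded_box)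

section \<open>Cutting unions of boxes by coordinate hyperplanes\<close>

lemma box_Int_lower_halfspace:
  fixes a :: "'a::euclidean_space"
  assumes "i \<in> Basis"
  shows "\<exists>a' b'. box a b \<inter> {x. x \<bullet> i < c} = box a' b'"
proof (intro exI)
  show "box a b \<inter> {x. x \<bullet> i < c} = box a (\<Sum>j\<in>Basis. (if j = i then min (b \<bullet> i) c else b \<bullet> j) *\<^sub>R j)"
    using assms by (auto simp: mem_box split: if_splits)
qed

lemma box_Int_upper_halfspace:
  fixes a :: "'a::euclidean_space"
  assumes "i \<in> Basis"
  shows "\<exists>a' b'. box a b \<inter> {x. x \<bullet> i > c} = box a' b'"
proof (intro exI)
  show "box a b \<inter> {x. x \<bullet> i > c} = box (\<Sum>j\<in>Basis. (if j = i then max (a \<bullet> i) c else a \<bullet> j) *\<^sub>R j) b"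
    using assms by (auto simp: mem_box split: if_splits)
qed

lemma box_union_Int:
  assumes F: "finite F" "card F \<le> n" "\<forall>X\<in>F. \<exists>a b. X = box a b" "disjoint F"
    and H: "\<And>a b. \<exists>a' b'. box a b \<inter> H = box a' (b'::'a::euclidean_space)"
  shows "box_union n (\<Union>F \<inter> H)"
  unfolding box_union_def
proof (intro exI conjI)
  show "finite ((\<lambda>X. X \<inter> H) ` F)" using F by simp
  show "card ((\<lambda>X. X \<inter> H) ` F) \<le> n" using order_trans[OF card_image_le[OF F(1)] F(2)] .
  show "\<forall>X\<in>(\<lambda>X. X \<inter> H) ` F. \<exists>a b. X = box a b" using F(3) H by force
  show "disjoint ((\<lambda>X. X \<inter> H) ` F)"
    using F(4) by (fastforce simp: pairwise_def disjnt_def)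
  show "\<Union> F \<inter> H = \<Union> ((\<lambda>X. X \<inter> H) ` F)" by auto
qed

lemma box_union_Int':
  assumes "box_union n A" and H: "\<And>a b. \<exists>a' b'. box a b \<inter> H = box a' (b'::'a::euclidean_space)"
  shows "box_union n (A \<inter> H)"
proof -
  obtain F where F: "finite F" "card F \<le> n" "\<forall>X\<in>F. \<exists>a b. X = box a b" "disjoint F" "A = \<Union>F"
    using assms(1) unfolding box_union_def by blast
  show ?thesis unfolding F(5) by (rule box_union_Int[OF F(1-4) H])
qed

lemma measure_lborel_open_pos:
  fixes A :: "'a::euclidean_space set"
  assumes "open A" "bounded A" "A \<noteq> {}"
  shows "measure lborel A > 0"
proof -
  obtain x where "x \<in> A" using assms(3) by blast
  then obtain e where "e > 0" "ball x e \<subseteq> A" using openE[OF assms(1)] by metis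
  then have "measure lborel (ball x e) \<le> measure lborel A"
    using assms by (intro measure_lborel_mono_open) auto
  moreover have "measure lborel (ball x e) > 0" using \<open>e > 0\<close> by simp
  ultimately show ?thesis by linarith
qed

text \<open>Two disjoint nonempty boxes are separated by a coordinate hyperplane through a face of
  one of them. Each open side of it misses one of the two boxes completely, so both halves need one
  box fewer, and both are nonempty because each contains the other box. Empty boxes are discarded
  beforehand, since they admit no such separation.\<close>

lemma box_union_split:
  fixes A :: "'a::euclidean_space set"
  assumes "box_union n A" "A \<noteq> {}"
  shows "(\<exists>a b. A = box a b) \<or> (\<exists>i\<in>Basis. \<exists>c. n > 0 \<and>
     box_union (n-1) (A \<inter> {x. x \<bullet> i < c}) \<and> box_union (n-1) (A \<inter> {x. x \<bullet> i > c}) \<and>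
     A \<inter> {x. x \<bullet> i < c} \<noteq> {} \<and> A \<inter> {x. x \<bullet> i > c} \<noteq> {})"
proof -
  obtain F0 where F0: "finite F0" "card F0 \<le> n" "\<forall>X\<in>F0. \<exists>a b. X = box a b" "disjoint F0" "A = \<Union>F0"
    using assms(1) unfolding box_union_def by blast
  define F where "F = F0 - {{}}"
  have "card F \<le> card F0" using F0 by (simp add: F_def card_mono)
  then have F: "finite F" "card F \<le> n" "\<forall>X\<in>F. \<exists>a b. X = box a b" "disjoint F" "A = \<Union>F" "{} \<notin> F"
    using F0 by (auto simp: F_def pairwise_def)
  have "F \<noteq> {}" using F assms by auto
  then obtain p where p: "p \<in> F" by auto
  show ?thesis
  proof (cases "F = {p}")
    case True then show ?thesis using F by auto
  next
    case False
    then obtain q where q: "q \<in> F" "q \<noteq> p" using p by auto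
    obtain a b where ab: "p = box a b" using F(3) p by blast
    obtain a' b' where ab': "q = box a' b'" using F(3) q(1) by blast
    have ne: "p \<noteq> {}" "q \<noteq> {}" using F p q by auto
    have lt: "a \<bullet> i < b \<bullet> i" "a' \<bullet> i < b' \<bullet> i" if "i \<in> Basis" for i
      using ne that unfolding ab ab' box_ne_empty by auto
    have "p \<inter> q = {}" using F(4) p q by (auto simp: pairwise_def disjnt_def)
    then obtain i where i: "i \<in> Basis" and "b \<bullet> i \<le> a' \<bullet> i \<or> b' \<bullet> i \<le> a \<bullet> i"
      unfolding ab ab' disjoint_interval using lt by (metis not_le)
    then obtain c P Q where c: "P \<subseteq> {x. x \<bullet> i < c}" "Q \<subseteq> {x. x \<bullet> i > c}" "P \<in> F" "Q \<in> F"
    proof (elim disjE)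
      assume *: "b \<bullet> i \<le> a' \<bullet> i"
      show ?thesis
      proof (rule that[of p "b \<bullet> i" q])
        show "p \<subseteq> {x. x \<bullet> i < b \<bullet> i}" "q \<subseteq> {x. x \<bullet> i > b \<bullet> i}"
          using i * by (auto simp: ab ab' mem_box intro: le_less_trans)
      qed (use p q in auto)
    next
      assume *: "b' \<bullet> i \<le> a \<bullet> i"
      show ?thesis
      proof (rule that[of q "b' \<bullet> i" p])
        show "q \<subseteq> {x. x \<bullet> i < b' \<bullet> i}" "p \<subseteq> {x. x \<bullet> i > b' \<bullet> i}"
          using i * by (auto simp: ab ab' mem_box intro: le_less_trans)
      qed (use p q in auto)
    qed
    have n: "n > 0" using F p by (metis card_gt_0_iff empty_iff less_le_trans)
    have sub: "finite (F - {X})" "card (F - {X}) \<le> n - 1" "\<forall>X\<in>F-{X}. \<exists>a b. X = box a b" "disjoint (F - {X})"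
      if "X \<in> F" for X
      using F that by (auto simp: pairwise_def)
    have "A \<inter> {x. x \<bullet> i < c} = \<Union>(F - {Q}) \<inter> {x. x \<bullet> i < c}"
      unfolding F(5) using c(2) by fastforce
    then have 1: "box_union (n-1) (A \<inter> {x. x \<bullet> i < c})"
      using box_union_Int[OF sub[OF c(4)] box_Int_lower_halfspace[OF i]] by simp
    have "A \<inter> {x. x \<bullet> i > c} = \<Union>(F - {P}) \<inter> {x. x \<bullet> i > c}"
      unfolding F(5) using c(1) by fastforce
    then have 2: "box_union (n-1) (A \<inter> {x. x \<bullet> i > c})"
      using box_union_Int[OF sub[OF c(3)] box_Int_upper_halfspace[OF i]] by simp
    have "P \<noteq> {}" "Q \<noteq> {}" using c F by auto
    then have "A \<inter> {x. x \<bullet> i < c} \<noteq> {}" "A \<inter> {x. x \<bullet> i > c} \<noteq> {}"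
      using c F(5) by blast+
    with 1 2 n show ?thesis by (intro disjI2 bexI[OF _ i] exI[of _ c] conjI)
  qed
qed

lemma measure_halfspace_split:
  fixes A :: "'a::euclidean_space set"
  assumes "open A" "bounded A" "i \<in> Basis"
  shows "measure lborel A = measure lborel (A \<inter> {x. x \<bullet> i < c}) + measure lborel (A \<inter> {x. x \<bullet> i > c})"
proof -
  have op: "open {x. x \<bullet> i < c}" "open {x. x \<bullet> i > c}"
    using open_halfspace_component_lt open_halfspace_component_gt by auto
  have fm: "A \<inter> {x. x \<bullet> i < c} \<in> fmeasurable lborel" "A \<inter> {x. x \<bullet> i > c} \<in> fmeasurable lborel"
    using assms op by (simp_all add: open_bounded_fmeasurable bounded_Int open_Int)
  have "negligible (A \<inter> {x. x \<bullet> i = c})"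
    by (rule negligible_subset[OF negligible_standard_hyperplane[OF assms(3), of c]]) auto
  moreover have "A \<inter> {x. x \<bullet> i = c} \<in> sets lborel"
  proof -
    have "closed {x. x \<bullet> i = c}" using closed_hyperplane[of i c] by (simp add: inner_commute)
    then show ?thesis using assms by (simp add: borel_open borel_closed sets.Int)
  qed
  ultimately have null: "A \<inter> {x. x \<bullet> i = c} \<in> null_sets lborel"
    by (simp add: negligible_iff_null_sets null_sets_completion_iff)
  have "A = (A \<inter> {x. x \<bullet> i < c} \<union> A \<inter> {x. x \<bullet> i > c}) \<union> (A \<inter> {x. x \<bullet> i = c})"
    by auto
  then have "measure lborel A = measure lborel (A \<inter> {x. x \<bullet> i < c} \<union> A \<inter> {x. x \<bullet> i > c})"
    using measure_Un_null_set[OF _ null] fm by (metis fmeasurableD sets.Un)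
  also have "\<dots> = measure lborel (A \<inter> {x. x \<bullet> i < c}) + measure lborel (A \<inter> {x. x \<bullet> i > c})"
    using fm by (intro measure_Union) (auto simp: fmeasurableD2)
  finally show ?thesis .
qed

text \<open>The measure of the part of \<open>B\<close> below height \<open>c\<close> is continuous
  in \<open>c\<close>, because hyperplanes are null sets, and it runs from 0 to the measure of
  \<open>B\<close>; the intermediate value theorem gives the cut.\<close>

lemma exists_proportional_cut:
  fixes B :: "'a::euclidean_space set"
  assumes "open B" "bounded B" "i \<in> Basis" "0 < \<theta>" "\<theta> < 1"
  shows "\<exists>c. measure lborel (B \<inter> {x. x \<bullet> i < c}) = \<theta> * measure lborel B"
proof -
  define f where "f c = measure lborel (B \<inter> {x. x \<bullet> i < c})" for c
  obtain M where M: "\<And>x. x \<in> B \<Longrightarrow> norm x \<le> M" using assms bounded_iff by blast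
  have bd: "\<bar>x \<bullet> i\<bar> \<le> M" if "x \<in> B" for x
    using Basis_le_norm[OF assms(3)] M[OF that] order_trans by blast
  have lm: "B \<in> fmeasurable lborel"
    using assms by (simp add: open_bounded_fmeasurable)
  have op: "open {x. x \<bullet> i < c}" for c using open_halfspace_component_lt by auto
  have f_int: "f c = (LINT x|lborel. indicator (B \<inter> {x. x \<bullet> i < c}) x)" for c
    by (simp add: f_def)
  have hyp: "AE x in lborel. x \<bullet> i \<noteq> c" for c
  proof (rule AE_I')
    have "{x. x \<bullet> i = c} \<in> sets lborel"
      using closed_hyperplane[of i c] by (simp add: inner_commute borel_closed)
    then show "{x. x \<bullet> i = c} \<in> null_sets lborel"
      using negligible_standard_hyperplane[OF assms(3), of c]
      by (simp add: negligible_iff_null_sets null_sets_completion_iff)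
  qed auto
  have "isCont f c" for c
    unfolding continuous_at_sequentially
  proof (intro allI impI)
    fix X :: "nat \<Rightarrow> real" assume X: "X \<longlonglongrightarrow> c"
    show "(f \<circ> X) \<longlonglongrightarrow> f c"
      unfolding f_int comp_def
    proof (rule integral_dominated_convergence[where w="indicator B"])
      show "integrable lborel (indicator B :: 'a \<Rightarrow> real)"
        using lm by (simp add: fmeasurable_def)
      show "AE x in lborel. (\<lambda>n. indicator (B \<inter> {x. x \<bullet> i < X n}) x) \<longlonglongrightarrow> (indicator (B \<inter> {x. x \<bullet> i < c}) x :: real)"
        using hyp[of c]
      proof eventually_elim
        fix x :: 'a assume "x \<bullet> i \<noteq> c"
        then have "\<forall>\<^sub>F n in sequentially. (x \<bullet> i < X n) = (x \<bullet> i < c)"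
        proof (cases "x \<bullet> i < c")
          case True then show ?thesis using order_tendstoD(1)[OF X True] by simp
        next
          case False
          then have "c < x \<bullet> i" using \<open>x \<bullet> i \<noteq> c\<close> by simp
          from order_tendstoD(2)[OF X this] show ?thesis using False
            by (auto elim: eventually_mono)
        qed
        then show "(\<lambda>n. indicator (B \<inter> {x. x \<bullet> i < X n}) x) \<longlonglongrightarrow> (indicator (B \<inter> {x. x \<bullet> i < c}) x :: real)"
          by (intro tendsto_eventually) (auto elim!: eventually_mono simp: indicator_def)
      qed
    qed (use assms op in \<open>auto simp: borel_open open_Int intro!: borel_measurable_indicator split: split_indicator\<close>)
  qed
  then have cont: "continuous_on {-M-1..M+1} f" by (simp add: continuous_at_imp_continuous_on)
  have "B \<inter> {x. x \<bullet> i < -M-1} = {}" using bd by fastforce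
  then have "f (-M-1) = 0" by (simp add: f_def)
  moreover have "B \<inter> {x. x \<bullet> i < M+1} = B" using bd by fastforce
  then have "f (M+1) = measure lborel B" by (simp add: f_def)
  moreover have "0 \<le> \<theta> * measure lborel B" "\<theta> * measure lborel B \<le> measure lborel B"
    using assms mult_right_mono[of \<theta> 1 "measure lborel B"] by auto
  \<comment> \<open>\<open>M\<close> bounds the norm on \<open>B\<close> only, so it may be negative
    when \<open>B\<close> is empty; in that case every cut works.\<close>
  moreover have "-M-1 \<le> M+1 \<or> B = {}" using bd by fastforce
  ultimately show ?thesis
  proof (elim disjE)
    assume "-M-1 \<le> M+1" "f (-M-1) = 0" "f (M+1) = measure lborel B"
     "0 \<le> \<theta> * measure lborel B" "\<theta> * measure lborel B \<le> measure lborel B"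
    then show ?thesis using IVT'[of f "-M-1" "\<theta> * measure lborel B" "M+1"] cont f_def by auto
  qed auto
qed

text \<open>Hadwiger--Ohmann: cut \<open>A\<close> along a hyperplane separating two of its boxes and \<open>B\<close> along a
  parallel one in the same proportion. The sums of corresponding parts are disjoint and fewer boxes
  are involved in each.\<close>

lemma Brunn_Minkowski_box_union:
  fixes A B :: "'a::euclidean_space set"
  assumes "box_union m A" "box_union k B" "A \<noteq> {}" "B \<noteq> {}"
  shows "(measure lborel A powr (1 / DIM('a)) + measure lborel B powr (1 / DIM('a))) powr DIM('a)
    \<le> measure lborel (minkowski_sum A B)"
  using assms
proof (induction "m + k" arbitrary: m k A B rule: less_induct)
  case less
  define p where "p = 1 / real DIM('a)"
  have pd: "p * real DIM('a) = 1" by (simp add: p_def)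
  \<comment> \<open>The claim quantifies over its own sets and numbers because it is used twice, the
    second time with the roles of the two sets exchanged. Cutting the second set does not raise its
    number of boxes, so the total drops on both sides.\<close>
  have cut: "(measure lborel A powr p + measure lborel B powr p) powr DIM('a) \<le> measure lborel (minkowski_sum A B)"
    if mk: "m + k = m' + k'" and A: "box_union m' A" "A \<noteq> {}" and B: "box_union k' B" "B \<noteq> {}" and i: "i \<in> Basis" and m: "m' > 0"
     and s: "box_union (m'-1) (A \<inter> {x. x \<bullet> i < c})" "box_union (m'-1) (A \<inter> {x. x \<bullet> i > c})"
       "A \<inter> {x. x \<bullet> i < c} \<noteq> {}" "A \<inter> {x. x \<bullet> i > c} \<noteq> {}"
   for A B :: "'a set" and i c m' k'
  proof -
    define \<alpha> where "\<alpha> = measure lborel A"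
    define \<beta> where "\<beta> = measure lborel B"
    define \<theta> where "\<theta> = measure lborel (A \<inter> {x. x \<bullet> i < c}) / \<alpha>"
    have \<alpha>: "\<alpha> > 0" and \<beta>: "\<beta> > 0" unfolding \<alpha>_def \<beta>_def
      using A B by (auto intro!: measure_lborel_open_pos dest: box_union_open box_union_bounded)
    have Apos: "measure lborel (A \<inter> {x. x \<bullet> i < c}) > 0" "measure lborel (A \<inter> {x. x \<bullet> i > c}) > 0"
      by (rule measure_lborel_open_pos[OF box_union_open[OF s(1)] box_union_bounded[OF s(1)] s(3)],
          rule measure_lborel_open_pos[OF box_union_open[OF s(2)] box_union_bounded[OF s(2)] s(4)])
    have Asum: "\<alpha> = measure lborel (A \<inter> {x. x \<bullet> i < c}) + measure lborel (A \<inter> {x. x \<bullet> i > c})"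
      unfolding \<alpha>_def by (rule measure_halfspace_split[OF box_union_open[OF A(1)] box_union_bounded[OF A(1)] i])
    have \<theta>: "0 < \<theta>" "\<theta> < 1" using Apos Asum \<alpha> by (auto simp: \<theta>_def)
    have A1: "measure lborel (A \<inter> {x. x \<bullet> i < c}) = \<theta> * \<alpha>" using \<alpha> by (simp add: \<theta>_def)
    then have A2: "measure lborel (A \<inter> {x. x \<bullet> i > c}) = (1-\<theta>) * \<alpha>" using Asum by (simp add: algebra_simps)
    obtain c' where B1: "measure lborel (B \<inter> {x. x \<bullet> i < c'}) = \<theta> * \<beta>"
      unfolding \<beta>_def using exists_proportional_cut[OF box_union_open[OF B(1)] box_union_bounded[OF B(1)] i \<theta>] by blast
    have Bsum: "\<beta> = measure lborel (B \<inter> {x. x \<bullet> i < c'}) + measure lborel (B \<inter> {x. x \<bullet> i > c'})"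
      unfolding \<beta>_def by (rule measure_halfspace_split[OF box_union_open[OF B(1)] box_union_bounded[OF B(1)] i])
    then have B2: "measure lborel (B \<inter> {x. x \<bullet> i > c'}) = (1-\<theta>) * \<beta>" using B1 by (simp add: algebra_simps)
    have Bne: "B \<inter> {x. x \<bullet> i < c'} \<noteq> {}" "B \<inter> {x. x \<bullet> i > c'} \<noteq> {}"
      using B1 B2 \<beta> \<theta> by auto
    have Bb: "box_union k' (B \<inter> {x. x \<bullet> i < c'})" "box_union k' (B \<inter> {x. x \<bullet> i > c'})"
      by (intro box_union_Int'[OF B(1)] box_Int_lower_halfspace[OF i] box_Int_upper_halfspace[OF i])+
    define S1 where "S1 = minkowski_sum (A \<inter> {x. x \<bullet> i < c}) (B \<inter> {x. x \<bullet> i < c'})"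
    define S2 where "S2 = minkowski_sum (A \<inter> {x. x \<bullet> i > c}) (B \<inter> {x. x \<bullet> i > c'})"
    define S where "S = minkowski_sum A B"
    have opS: "open S1" "open S2" "open S" "bounded S1" "bounded S2" "bounded S"
      unfolding S1_def S2_def S_def
      using s(1,2) Bb A(1) B(1)
      by (auto intro!: open_minkowski_sum bounded_minkowski_sum dest: box_union_open box_union_bounded)
    \<comment> \<open>The Brunn-Minkowski bound is homogeneous of degree one in the pair of volumes.
      Since both sets are cut in the same proportion, the bounds for the two halves add up to
      exactly the bound for the whole.\<close>
    have powr_scale: "((t * \<alpha>) powr p + (t * \<beta>) powr p) powr DIM('a) = t * (\<alpha> powr p + \<beta> powr p) powr DIM('a)"
      if "t > 0" for t
    proof -
      have "(t * \<alpha>) powr p + (t * \<beta>) powr p = t powr p * (\<alpha> powr p + \<beta> powr p)"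
        using that \<alpha> \<beta> by (simp add: powr_mult distrib_left)
      then show ?thesis using that pd by (simp add: powr_mult powr_powr)
    qed
    have 1: "\<theta> * (\<alpha> powr p + \<beta> powr p) powr DIM('a) \<le> measure lborel S1"
      using less.hyps[OF _ s(1) Bb(1) s(3) Bne(1)] m mk powr_scale[OF \<theta>(1)]
      unfolding A1 B1 S1_def[symmetric] p_def[symmetric] by simp
    have 2: "(1-\<theta>) * (\<alpha> powr p + \<beta> powr p) powr DIM('a) \<le> measure lborel S2"
      using less.hyps[OF _ s(2) Bb(2) s(4) Bne(2)] m mk powr_scale[of "1-\<theta>"] \<theta>
      unfolding A2 B2 S2_def[symmetric] p_def[symmetric] by simp
    have fm: "S1 \<in> fmeasurable lborel" "S2 \<in> fmeasurable lborel"
      using opS by (simp_all add: open_bounded_fmeasurable)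
    \<comment> \<open>The hyperplane at height \<open>c + c'\<close> separates the two partial sums,
      so their measures add up inside \<open>S\<close>.\<close>
    have "z \<bullet> i < c + c'" if "z \<in> S1" for z
      using that unfolding S1_def minkowski_sum_def by (auto simp: inner_add_left intro: add_strict_mono)
    moreover have "c + c' < z \<bullet> i" if "z \<in> S2" for z
      using that unfolding S2_def minkowski_sum_def by (auto simp: inner_add_left intro: add_strict_mono)
    ultimately have dis: "S1 \<inter> S2 = {}" by fastforce
    have "measure lborel S1 + measure lborel S2 = measure lborel (S1 \<union> S2)"
      using fm dis by (intro measure_Union[symmetric]) (auto simp: fmeasurableD2)
    also have "\<dots> \<le> measure lborel S"
    proof (rule measure_lborel_mono_open)
      show "S1 \<union> S2 \<subseteq> S" unfolding S1_def S2_def S_def by (intro Un_least minkowski_sum_mono) auto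
    qed (use opS in auto)
    finally have "\<theta> * (\<alpha> powr p + \<beta> powr p) powr DIM('a) + (1-\<theta>) * (\<alpha> powr p + \<beta> powr p) powr DIM('a)
        \<le> measure lborel S" using 1 2 by linarith
    then show ?thesis unfolding \<alpha>_def \<beta>_def S_def by (simp add: algebra_simps)
  qed
  show ?case
  proof (cases "(\<exists>a b. A = box a b) \<and> (\<exists>a b. B = box a b)")
    case True
    \<comment> \<open>Base case: the sum of two boxes contains the box whose side lengths are the
      sums of theirs, so the claim is the superadditivity of the geometric mean of the side
      lengths.\<close>
    then obtain a b a' b' where ab: "A = box a b" "B = box a' b'" by auto
    have lt: "a \<bullet> i < b \<bullet> i" "a' \<bullet> i < b' \<bullet> i" if "i \<in> Basis" for i
      using less.prems that unfolding ab box_ne_empty by auto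
    have mA: "measure lborel A = (\<Prod>i\<in>Basis. (b - a) \<bullet> i)" and mB: "measure lborel B = (\<Prod>i\<in>Basis. (b' - a') \<bullet> i)"
      unfolding ab using lt by (auto intro!: measure_lborel_box less_imp_le)
    have "measure lborel (box (a + a') (b + b')) = (\<Prod>i\<in>Basis. (b + b' - (a + a')) \<bullet> i)"
      using lt by (intro measure_lborel_box) (simp add: inner_add_left add_mono less_imp_le)
    also have "\<dots> = (\<Prod>i\<in>Basis. (b - a) \<bullet> i + (b' - a') \<bullet> i)"
      by (intro prod.cong) (auto simp: algebra_simps)
    finally have mAB: "measure lborel (box (a + a') (b + b')) = (\<Prod>i\<in>Basis. (b - a) \<bullet> i + (b' - a') \<bullet> i)" .
    have pos: "(\<Prod>i\<in>Basis. (b - a) \<bullet> i + (b' - a') \<bullet> i) > 0"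
      by (intro prod_pos) (use lt in \<open>auto simp: inner_diff_left intro!: add_pos_pos\<close>)
    have "(measure lborel A powr p + measure lborel B powr p) powr DIM('a)
        \<le> ((\<Prod>i\<in>Basis. (b - a) \<bullet> i + (b' - a') \<bullet> i) powr p) powr DIM('a)"
      unfolding mA mB p_def using lt by (intro powr_mono2 prod_powr_add_le) (auto simp: inner_diff_left)
    also have "\<dots> = measure lborel (box (a + a') (b + b'))"
      using pos pd by (simp add: powr_powr mAB)
    also have "\<dots> \<le> measure lborel (minkowski_sum A B)"
    proof (rule measure_lborel_mono_open)
      show "box (a + a') (b + b') \<subseteq> minkowski_sum A B"
      proof
        fix z assume z: "z \<in> box (a + a') (b + b')"
        \<comment> \<open>In each coordinate the offset of \<open>z\<close> from the lower corner
          \<open>a + a'\<close> is shared between the two boxes in proportion to their side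
          lengths.\<close>
        define x where "x = (\<Sum>i\<in>Basis. (a \<bullet> i + (z - (a + a')) \<bullet> i * ((b - a) \<bullet> i) / ((b + b' - (a + a')) \<bullet> i)) *\<^sub>R i)"
        have x: "x \<bullet> i = a \<bullet> i + (z - (a + a')) \<bullet> i * ((b - a) \<bullet> i) / ((b + b' - (a + a')) \<bullet> i)" if "i \<in> Basis" for i
          unfolding x_def using that by simp
        have "x \<in> box a b \<and> z - x \<in> box a' b'"
          unfolding mem_box ball_conj_distrib[symmetric]
        proof
          fix i :: 'a assume i: "i \<in> Basis"
          define u v w where "u = (b - a) \<bullet> i" and "v = (b' - a') \<bullet> i" and "w = (z - (a + a')) \<bullet> i"
          have uv: "u > 0" "v > 0" "0 < w" "w < u + v"
            using lt[OF i] z i unfolding u_def v_def w_def mem_box by (auto simp: algebra_simps)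
          have xi: "x \<bullet> i = a \<bullet> i + w * u / (u + v)"
            unfolding x[OF i] u_def v_def w_def by (simp add: algebra_simps)
          have zi: "(z - x) \<bullet> i = a' \<bullet> i + w * v / (u + v)"
          proof -
            have "w * u / (u + v) + w * v / (u + v) = w"
              using uv by (simp flip: add_divide_distrib distrib_left)
            moreover have "(z - x) \<bullet> i = w + a \<bullet> i + a' \<bullet> i - x \<bullet> i"
              by (simp add: w_def inner_diff_left inner_add_left)
            ultimately show ?thesis using xi by linarith
          qed
          have "0 < w * u / (u + v)" "w * u / (u + v) < u" "0 < w * v / (u + v)" "w * v / (u + v) < v"
            using uv mult_strict_left_mono[of w "u + v" u] mult_strict_left_mono[of w "u + v" v]
            by (auto simp: field_simps)
          then show "(a \<bullet> i < x \<bullet> i \<and> x \<bullet> i < b \<bullet> i) \<and> (a' \<bullet> i < (z - x) \<bullet> i \<and> (z - x) \<bullet> i < b' \<bullet> i)"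
            unfolding xi zi by (auto simp: u_def v_def inner_diff_left)
        qed
        then show "z \<in> minkowski_sum A B" unfolding minkowski_sum_def ab by force
      qed
    qed (auto simp: ab intro!: open_minkowski_sum bounded_minkowski_sum)
    finally show ?thesis unfolding p_def .
  next
    case False
    then consider "\<nexists>a b. A = box a b" | "\<nexists>a b. B = box a b" by blast
    then show ?thesis
    proof cases
      case 1
      with box_union_split[OF less.prems(1,3)] obtain i c where "i \<in> Basis" "0 < m"
        "box_union (m-1) (A \<inter> {x. x \<bullet> i < c})" "box_union (m-1) (A \<inter> {x. x \<bullet> i > c})"
        "A \<inter> {x. x \<bullet> i < c} \<noteq> {}" "A \<inter> {x. x \<bullet> i > c} \<noteq> {}"
        by auto
      from cut[OF refl less.prems(1,3,2,4) this] show ?thesis unfolding p_def .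
    next
      case 2
      with box_union_split[OF less.prems(2,4)] obtain i c where "i \<in> Basis" "0 < k"
        "box_union (k-1) (B \<inter> {x. x \<bullet> i < c})" "box_union (k-1) (B \<inter> {x. x \<bullet> i > c})"
        "B \<inter> {x. x \<bullet> i < c} \<noteq> {}" "B \<inter> {x. x \<bullet> i > c} \<noteq> {}"
        by auto
      from cut[OF add.commute less.prems(2,4,1,3) this] show ?thesis
        unfolding p_def minkowski_sum_commute[of B] by (simp only: add.commute)
    qed
  qed
qed

text \<open>The covering lemma yields countably many nonoverlapping closed boxes. With the gauge
  that assigns \<open>A\<close> to the points of \<open>A\<close>, each of them lies in
  \<open>A\<close>, so they fill \<open>A\<close> exactly. Finitely many carry all but
  \<open>e\<close> of the measure, and passing to interiors loses only null faces.\<close>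

lemma open_inner_box_union:
  fixes A :: "'a::euclidean_space set"
  assumes A: "open A" "bounded A" "A \<noteq> {}" and e: "e > 0"
  shows "\<exists>n A'. box_union n A' \<and> A' \<subseteq> A \<and> measure lborel A - e < measure lborel A'"
proof -
  obtain a where a: "A \<subseteq> box (-a) a" using bounded_subset_box_symmetric A by blast
  define g where "g x = (if x \<in> A then A else UNIV)" for x
  have "gauge g" using A by (auto simp: gauge_def g_def)
  moreover have "A \<subseteq> cbox (-a) a" "box (-a) a \<noteq> {}" using a A box_subset_cbox by blast+
  ultimately obtain D where D: "countable D"
    "\<And>K. K \<in> D \<Longrightarrow> interior K \<noteq> {} \<and> (\<exists>c d. K = cbox c d)"
    "pairwise (\<lambda>A B. interior A \<inter> interior B = {}) D"
    "\<And>K. K \<in> D \<Longrightarrow> \<exists>x \<in> A \<inter> K. K \<subseteq> g x" "A \<subseteq> \<Union>D"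
    using covering_lemma[of A "-a" a g] by metis
  have UD: "\<Union>D = A"
  proof
    show "\<Union>D \<subseteq> A" using D(4) by (fastforce simp: g_def)
  qed (rule D)
  have Dne: "D \<noteq> {}" using UD A by auto
  define E where "E n = (\<Union>K\<in>from_nat_into D ` {..n}. K)" for n
  have mem: "from_nat_into D n \<in> D" for n using from_nat_into[OF Dne] .
  have cl: "closed K" if "K \<in> D" for K using D(2)[OF that] closed_cbox by blast
  have "(\<Union>n. E n) = A"
  proof -
    have "(\<Union>n. E n) = (\<Union>n. from_nat_into D n)" unfolding E_def by auto
    also have "\<dots> = \<Union>D" using range_from_nat_into[OF Dne D(1)] by (simp add: image_def)
    finally show ?thesis using UD by simp
  qed
  moreover have "(\<lambda>n. measure lborel (E n)) \<longlonglongrightarrow> measure lborel (\<Union>n. E n)"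
  proof (rule Lim_measure_incseq)
    show "range E \<subseteq> sets lborel" unfolding E_def using cl mem by (auto intro!: borel_closed closed_UN)
    show "incseq E" unfolding E_def incseq_def by (auto intro: order_trans)
    show "emeasure lborel (\<Union>n. E n) \<noteq> \<infinity>"
      using calculation A emeasure_bounded_finite by (simp add: less_top)
  qed
  ultimately obtain n where n: "measure lborel A - e < measure lborel (E n)"
    using order_tendstoD(1)[of _ "measure lborel A" sequentially "measure lborel A - e"] e
    by (fastforce simp: eventually_sequentially)
  define F0 where "F0 = from_nat_into D ` {..n}"
  have F0: "finite F0" "F0 \<subseteq> D" "E n = \<Union>F0" using mem by (auto simp: F0_def E_def)
  define A' where "A' = \<Union>(interior ` F0)"
  have "box_union (card (interior ` F0)) A'"
    unfolding box_union_def
  proof (intro exI conjI)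
    show "\<forall>X\<in>interior ` F0. \<exists>a b. X = box a b"
      using D(2) F0(2) by fastforce
    show "disjoint (interior ` F0)"
    proof (rule pairwiseI)
      fix X Y assume "X \<in> interior ` F0" "Y \<in> interior ` F0" "X \<noteq> Y"
      then obtain K L where KL: "X = interior K" "Y = interior L" "K \<in> D" "L \<in> D" "K \<noteq> L"
        using F0(2) by auto
      then show "disjnt X Y" using pairwiseD[OF D(3) KL(3,4,5)] by (simp add: disjnt_def)
    qed
  qed (use F0 A'_def in auto)
  moreover have "A' \<subseteq> A"
    using F0(2) UD interior_subset unfolding A'_def by fastforce
  moreover have "measure lborel (E n) = measure lborel A'"
  proof -
    have "negligible (E n - A')"
    proof (rule negligible_subset)
      show "negligible (\<Union>K\<in>F0. K - interior K)"
      proof (rule negligible_Union)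
        fix T assume "T \<in> (\<lambda>K. K - interior K) ` F0"
        then obtain K where "K \<in> F0" and T: "T = K - interior K" by auto
        then obtain c d where "K = cbox c d" using F0(2) D(2) by blast
        then show "negligible T"
          using negligible_frontier_interval[of c d] T by simp
      qed (use F0 in auto)
    qed (use F0 A'_def in auto)
    moreover have sets: "E n \<in> sets lborel" "A' \<in> sets lborel"
    proof -
      have "closed (E n)" unfolding F0(3) using F0(1,2) cl by (intro closed_Union) auto
      then show "E n \<in> sets lborel" by simp
      have "open A'" unfolding A'_def by auto
      then show "A' \<in> sets lborel" by simp
    qed
    ultimately have null: "E n - A' \<in> null_sets lborel"
      by (simp add: negligible_iff_null_sets null_sets_completion_iff)
    have "A' \<union> (E n - A') = E n" using F0(3) interior_subset unfolding A'_def by fastforce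
    then show ?thesis using measure_Un_null_set[OF sets(2) null] by simp
  qed
  ultimately show ?thesis using n by auto
qed

text \<open>Approximation from inside suffices: shrinking the summands shrinks the sum, and the
  bound depends continuously on the two volumes, so the loss \<open>e\<close> can tend to 0.\<close>

theorem Brunn_Minkowski_open:
  fixes A B :: "'a::euclidean_space set"
  assumes A: "open A" "bounded A" "A \<noteq> {}" and B: "open B" "bounded B" "B \<noteq> {}"
  shows "(measure lborel A powr (1 / DIM('a)) + measure lborel B powr (1 / DIM('a))) powr DIM('a)
    \<le> measure lborel (minkowski_sum A B)"
proof -
  define p where "p = 1 / real DIM('a)"
  define \<alpha> where "\<alpha> = measure lborel A"
  define \<beta> where "\<beta> = measure lborel B"
  have pos: "\<alpha> > 0" "\<beta> > 0" unfolding \<alpha>_def \<beta>_def using measure_lborel_open_pos A B by auto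
  have lower: "((\<alpha> - e) powr p + (\<beta> - e) powr p) powr DIM('a) \<le> measure lborel (minkowski_sum A B)"
    if e: "0 < e" "e < \<alpha>" "e < \<beta>" for e
  proof -
    obtain m A' where A': "box_union m A'" "A' \<subseteq> A" "\<alpha> - e < measure lborel A'"
      using open_inner_box_union[OF A e(1)] unfolding \<alpha>_def by blast
    obtain k B' where B': "box_union k B'" "B' \<subseteq> B" "\<beta> - e < measure lborel B'"
      using open_inner_box_union[OF B e(1)] unfolding \<beta>_def by blast
    have ne: "A' \<noteq> {}" "B' \<noteq> {}" using A' B' e by auto
    have "((\<alpha> - e) powr p + (\<beta> - e) powr p) powr DIM('a)
      \<le> (measure lborel A' powr p + measure lborel B' powr p) powr DIM('a)"
      using A' B' e by (intro powr_mono2 add_mono) (auto simp: p_def)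
    also have "\<dots> \<le> measure lborel (minkowski_sum A' B')"
      unfolding p_def by (rule Brunn_Minkowski_box_union[OF A'(1) B'(1) ne])
    also have "\<dots> \<le> measure lborel (minkowski_sum A B)"
      using A A' B B' by (intro measure_lborel_mono_open minkowski_sum_mono open_minkowski_sum bounded_minkowski_sum)
         (auto dest: box_union_open)
    finally show ?thesis .
  qed
  have "((\<lambda>e. ((\<alpha> - e) powr p + (\<beta> - e) powr p) powr DIM('a)) \<longlongrightarrow>
     ((\<alpha> - 0) powr p + (\<beta> - 0) powr p) powr DIM('a)) (at_right 0)"
    using pos by (intro tendsto_intros) (auto simp: add_nonneg_eq_0_iff)
  moreover have "\<forall>\<^sub>F e in at_right 0. ((\<alpha> - e) powr p + (\<beta> - e) powr p) powr DIM('a)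
      \<le> measure lborel (minkowski_sum A B)"
    using pos lower by (auto simp: eventually_at_right_field intro!: exI[of _ "min \<alpha> \<beta>"])
  ultimately show ?thesis unfolding p_def \<alpha>_def \<beta>_def
    using tendsto_upperbound[OF _ _ trivial_limit_at_right_real] by fastforce
qed

section \<open>Gradients and integration by parts\<close>

definition has_gradient :: "('a::euclidean_space \<Rightarrow> real) \<Rightarrow> ('a \<Rightarrow> 'a) \<Rightarrow> bool" where
  "has_gradient f G \<longleftrightarrow> (\<forall>x. (f has_derivative (\<lambda>h. G x \<bullet> h)) (at x)) \<and> continuous_on UNIV G"

lemma has_gradient_continuous: "has_gradient f G \<Longrightarrow> continuous_on UNIV f"
  unfolding has_gradient_def by (meson continuous_at_imp_continuous_on has_derivative_continuous)

text \<open>Test fields need only be C^1, so a quotient of squared positive parts can serve as the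
  smooth step from 0 (for \<open>t \<le> 0\<close>) to 1 (for \<open>t \<ge> 1\<close>). The square
  of the positive part is C^1, and the denominator is positive because \<open>t\<close> and
  \<open>1 - t\<close> are never both nonpositive.\<close>

definition smoothstep :: "real \<Rightarrow> real" where
  "smoothstep t = (max 0 t)\<^sup>2 / ((max 0 t)\<^sup>2 + (max 0 (1 - t))\<^sup>2)"

text \<open>The quotient rule, after the cubic terms in the numerator have cancelled.\<close>

definition smoothstep' :: "real \<Rightarrow> real" where
  "smoothstep' t = (2 * max 0 t * (max 0 (1 - t))\<^sup>2 + (max 0 t)\<^sup>2 * (2 * max 0 (1 - t)))
     / ((max 0 t)\<^sup>2 + (max 0 (1 - t))\<^sup>2)\<^sup>2"

lemma DERIV_max_0_squared: "((\<lambda>t::real. (max 0 t)\<^sup>2) has_real_derivative 2 * max 0 t) (at t)"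
proof -
  consider "t > 0" | "t < 0" | "t = 0" by linarith
  then show ?thesis
  proof cases
    case 1
    show ?thesis
      by (rule has_field_derivative_transform_within_open[of "\<lambda>t. t\<^sup>2" _ _ "{0<..}"])
         (use 1 in \<open>auto intro!: derivative_eq_intros\<close>)
  next
    case 2
    show ?thesis
      by (rule has_field_derivative_transform_within_open[of "\<lambda>t. 0" _ _ "{..<0}"])
         (use 2 in \<open>auto intro!: derivative_eq_intros\<close>)
  next
    case 3
    have "((\<lambda>h. ((max 0 (0 + h))\<^sup>2 - (max 0 0)\<^sup>2) / h) \<longlongrightarrow> (0::real)) (at 0)"
    proof (rule Lim_null_comparison[OF always_eventually])
      show "\<forall>h::real. norm (((max 0 (0 + h))\<^sup>2 - (max 0 0)\<^sup>2) / h) \<le> \<bar>h\<bar>"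
        by (auto simp: max_def power2_eq_square)
      show "((\<lambda>h::real. \<bar>h\<bar>) \<longlongrightarrow> 0) (at 0)" by (auto intro!: tendsto_eq_intros)
    qed
    then show ?thesis by (simp add: 3 DERIV_def)
  qed
qed

lemma smoothstep_denominator_pos: "(max 0 t)\<^sup>2 + (max 0 (1 - t))\<^sup>2 > (0::real)"
  by (cases "t > 0") (auto intro: add_pos_nonneg add_nonneg_pos)

lemma DERIV_smoothstep: "(smoothstep has_real_derivative smoothstep' t) (at t)"
proof -
  have d: "((\<lambda>t::real. (max 0 (1 - t))\<^sup>2) has_real_derivative (2 * max 0 (1 - t)) * (- 1)) (at t)"
    by (rule DERIV_chain2[OF DERIV_max_0_squared]) (auto intro!: derivative_eq_intros)
  define A B where "A = max 0 t" and "B = max 0 (1 - t)"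
  have "(smoothstep has_real_derivative
      (2 * A * (A\<^sup>2 + B\<^sup>2) - A\<^sup>2 * (2 * A + (2 * B) * (- 1))) / ((A\<^sup>2 + B\<^sup>2) * (A\<^sup>2 + B\<^sup>2))) (at t)"
    unfolding smoothstep_def[abs_def] A_def B_def
    by (intro DERIV_divide DERIV_add DERIV_max_0_squared d)
       (use smoothstep_denominator_pos[of t] in linarith)
  also have "2 * A * (A\<^sup>2 + B\<^sup>2) - A\<^sup>2 * (2 * A + (2 * B) * (- 1)) = 2 * A * B\<^sup>2 + A\<^sup>2 * (2 * B)"
    by algebra
  finally show ?thesis
    by (simp only: smoothstep'_def A_def B_def power2_eq_square[of "(max 0 t)\<^sup>2 + (max 0 (1 - t))\<^sup>2"])
qed

lemma continuous_on_smoothstep': "continuous_on UNIV smoothstep'"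
  unfolding smoothstep'_def[abs_def]
  by (intro continuous_intros) (use smoothstep_denominator_pos in \<open>auto simp: less_imp_neq[THEN not_sym]\<close>)

lemma smoothstep_nonneg: "0 \<le> smoothstep t"
  by (simp add: smoothstep_def)

lemma smoothstep_le_1: "smoothstep t \<le> 1"
  using smoothstep_denominator_pos[of t] by (simp add: smoothstep_def)

lemma smoothstep_eq_1: "t \<ge> 1 \<Longrightarrow> smoothstep t = 1"
  by (simp add: smoothstep_def)

lemma smoothstep_eq_0: "t \<le> 0 \<Longrightarrow> smoothstep t = 0"
  by (simp add: smoothstep_def)

lemma smoothstep'_nonneg: "0 \<le> smoothstep' t"
  by (simp add: smoothstep'_def)

lemma smoothstep'_eq_0: "t \<le> 0 \<or> t \<ge> 1 \<Longrightarrow> smoothstep' t = 0"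
  by (auto simp: smoothstep'_def)

text \<open>A radial cutoff that is 1 up to radius \<open>a\<close> and 0 from radius
  \<open>b\<close> on. It interpolates in the squared norm, so it is differentiable at the origin as
  well.\<close>

definition bump :: "real \<Rightarrow> real \<Rightarrow> 'a::euclidean_space \<Rightarrow> real" where
  "bump a b x = smoothstep ((b\<^sup>2 - x \<bullet> x) / (b\<^sup>2 - a\<^sup>2))"

definition bump_grad :: "real \<Rightarrow> real \<Rightarrow> 'a::euclidean_space \<Rightarrow> 'a" where
  "bump_grad a b x = - (smoothstep' ((b\<^sup>2 - x \<bullet> x) / (b\<^sup>2 - a\<^sup>2)) * (2 / (b\<^sup>2 - a\<^sup>2))) *\<^sub>R x"

lemma bump_denominator_pos:
  assumes ab: "0 \<le> a" "a < (b::real)"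
  shows "b\<^sup>2 - a\<^sup>2 > 0"
  using ab by (simp add: power_strict_mono)

lemma has_gradient_bump:
  assumes ab: "0 \<le> a" "a < b"
  shows "has_gradient (bump a b) (bump_grad a b :: 'a::euclidean_space \<Rightarrow> 'a)"
  unfolding has_gradient_def
proof
  show "continuous_on UNIV (bump_grad a b :: 'a \<Rightarrow> 'a)"
    unfolding bump_grad_def[abs_def]
    by (intro continuous_intros continuous_on_compose2[OF continuous_on_smoothstep'])
       (use bump_denominator_pos[OF ab] in auto)
  show "\<forall>x::'a. (bump a b has_derivative (\<lambda>h. bump_grad a b x \<bullet> h)) (at x)"
  proof
    fix x :: 'a
    define D where "D = b\<^sup>2 - a\<^sup>2"
    have i: "((\<lambda>x. (b\<^sup>2 - x \<bullet> x) / D) has_derivative (\<lambda>h. - (2 / D) * (x \<bullet> h))) (at x)"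
    proof -
      have "((\<lambda>x. b\<^sup>2 - x \<bullet> x) has_derivative (\<lambda>h. - 2 * (x \<bullet> h))) (at x)"
        by (auto intro!: derivative_eq_intros simp: inner_commute)
      from has_derivative_mult_right[OF this, of "inverse D"] show ?thesis
        by (simp add: divide_inverse mult.commute mult.left_commute)
    qed
    have "((\<lambda>x. smoothstep ((b\<^sup>2 - x \<bullet> x) / D)) has_derivative
       (\<lambda>h. smoothstep' ((b\<^sup>2 - x \<bullet> x) / D) * (- (2 / D) * (x \<bullet> h)))) (at x)"
      using has_derivative_compose[OF i] DERIV_smoothstep unfolding has_field_derivative_def by blast
    then show "(bump a b has_derivative (\<lambda>h. bump_grad a b x \<bullet> h)) (at x)"
      unfolding bump_def[abs_def] bump_grad_def D_def[symmetric] by (simp add: mult.assoc)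
  qed
qed

lemma bump_nonneg: "0 \<le> bump a b x"
  by (simp add: bump_def smoothstep_nonneg)

lemma bump_le_1: "bump a b x \<le> 1"
  by (simp add: bump_def smoothstep_le_1)

lemma bump_eq_1:
  assumes ab: "0 \<le> a" "a < b"
  shows "norm x \<le> a \<Longrightarrow> bump a b x = 1"
  unfolding bump_def using bump_denominator_pos[OF ab] power_mono[of "norm x" a 2]
  by (intro smoothstep_eq_1) (simp add: dot_square_norm)

lemma bump_eq_0:
  assumes ab: "0 \<le> a" "a < b"
  shows "norm x \<ge> b \<Longrightarrow> bump a b x = 0"
  unfolding bump_def using bump_denominator_pos[OF ab] power_mono[of b "norm x" 2] ab
  by (intro smoothstep_eq_0) (simp add: dot_square_norm divide_nonpos_pos)

lemma bump_grad_eq_0: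
  assumes ab: "0 \<le> a" "a < b"
  shows "norm x \<le> a \<or> norm x \<ge> b \<Longrightarrow> bump_grad a b x = 0"
  unfolding bump_grad_def using bump_denominator_pos[OF ab] power_mono[of b "norm x" 2] ab power_mono[of "norm x" a 2]
  by (subst smoothstep'_eq_0) (auto simp: dot_square_norm divide_nonpos_pos)

lemma bump_minus:
  "bump a b (- x) = bump a b x"
  by (simp add: bump_def)

lemma bump_grad_minus:
  "bump_grad a b (- x) = - bump_grad a b x"
  by (simp add: bump_grad_def)

text \<open>As \<open>smoothstep\<close> is increasing, the gradient is a nonpositive multiple of
  \<open>x\<close>, so the right-hand side is the product of the two norms. The gradient vanishes up
  to radius \<open>a\<close>, hence \<open>norm x\<close> may be replaced by
  \<open>a\<close>.\<close>

lemma norm_bump_grad_le: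
  assumes ab: "0 \<le> a" "a < b"
  shows "a * norm (bump_grad a b x) \<le> - (bump_grad a b x \<bullet> x)"
proof (cases "norm x \<le> a")
  case True
  then show ?thesis by (simp add: bump_grad_eq_0[OF ab])
next
  case False
  define k where "k = smoothstep' ((b\<^sup>2 - x \<bullet> x) / (b\<^sup>2 - a\<^sup>2)) * (2 / (b\<^sup>2 - a\<^sup>2))"
  have k: "k \<ge> 0" "bump_grad a b x = - k *\<^sub>R x"
    using bump_denominator_pos[OF ab] smoothstep'_nonneg by (auto simp: k_def bump_grad_def)
  have "a * (k * norm x) \<le> norm x * (k * norm x)"
    using False k by (intro mult_right_mono) auto
  then show ?thesis using k by (simp add: dot_square_norm power2_eq_square mult.commute mult.left_commute)
qed

section \<open>Uniform estimates and integrals of compactly supported functions\<close>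

lemma compact_support_uniformly_continuous:
  fixes G :: "'a::euclidean_space \<Rightarrow> 'b::metric_space"
  assumes G: "continuous_on UNIV G" and G0: "\<And>x. norm x \<ge> R \<Longrightarrow> G x = z"
  shows "uniformly_continuous_on UNIV G"
  unfolding uniformly_continuous_on_def
proof (intro allI impI)
  fix e :: real assume "e > 0"
  \<comment> \<open>With this margin, two points at distance less than 1 lie either both in this
    ball or both outside radius \<open>R\<close>, where \<open>G\<close> is constant.\<close>
  have "uniformly_continuous_on (cball 0 (R + 2)) G"
    using continuous_on_subset[OF G] by (intro compact_uniformly_continuous) auto
  then obtain d where d: "d > 0" "\<And>x y. x \<in> cball 0 (R+2) \<Longrightarrow> y \<in> cball 0 (R+2) \<Longrightarrow> dist y x < d \<Longrightarrow> dist (G y) (G x) < e"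
    unfolding uniformly_continuous_on_def using \<open>e > 0\<close> by metis
  have "dist (G y) (G x) < e" if "dist y x < min d 1" for x y
  proof (cases "norm x \<le> R + 1")
    case True
    have "norm y \<le> norm x + dist y x" by (metis dist_norm norm_triangle_sub)
    with True that d(2)[of x y] show ?thesis by simp
  next
    case False
    have "norm x \<le> norm y + dist y x" by (metis dist_norm norm_triangle_sub dist_commute)
    with False that have "G x = z" "G y = z" by (auto intro!: G0)
    then show ?thesis using \<open>e > 0\<close> by simp
  qed
  then show "\<exists>d>0. \<forall>x\<in>UNIV. \<forall>x'\<in>UNIV. dist x' x < d \<longrightarrow> dist (G x') (G x) < e"
    using d(1) by (intro exI[of _ "min d 1"]) auto
qed

text \<open>The mean value inequality bounds the error by the oscillation of \<open>G\<close> on the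
  ball of radius \<open>d\<close> around \<open>x\<close>, and compact support makes this
  oscillation small uniformly in \<open>x\<close>. The uniformity is what allows the estimate to be
  integrated over \<open>x\<close>.\<close>

lemma gradient_uniform_linearization:
  fixes f :: "'a::euclidean_space \<Rightarrow> real"
  assumes f: "has_gradient f G" and G0: "\<And>x. norm x \<ge> R \<Longrightarrow> G x = 0" and e: "e > 0"
  shows "\<exists>\<delta>>0. \<forall>x h. norm h < \<delta> \<longrightarrow> \<bar>f (x + h) - f x - G x \<bullet> h\<bar> \<le> e * norm h"
proof -
  have "uniformly_continuous_on UNIV G"
    using compact_support_uniformly_continuous G0 f unfolding has_gradient_def by blast
  then obtain d where d: "d > 0" "\<And>x y. dist y x < d \<Longrightarrow> dist (G y) (G x) < e"
    unfolding uniformly_continuous_on_def using e by (metis UNIV_I)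
  have "\<bar>f (x + h) - f x - G x \<bullet> h\<bar> \<le> e * norm h" if h: "norm h < d" for x h
  proof -
    have "norm (f (x + h) - f x - G x \<bullet> (x + h - x)) \<le> norm (x + h - x) * e"
    proof (rule differentiable_bound_linearization[where S="ball x d" and f'="\<lambda>x h. G x \<bullet> h"])
      show "\<And>t. t \<in> {0..1} \<Longrightarrow> x + t *\<^sub>R (x + h - x) \<in> ball x d"
        using h by (auto simp: dist_norm intro: le_less_trans[OF mult_left_le_one_le])
      show "\<And>y. y \<in> ball x d \<Longrightarrow> (f has_derivative (\<bullet>) (G y)) (at y within ball x d)"
        using f has_derivative_at_withinI unfolding has_gradient_def by blast
      show "onorm ((\<bullet>) (G y) - (\<bullet>) (G x)) \<le> e" if "y \<in> ball x d" for y
      proof (rule onorm_bound)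
        fix h :: 'a
        have "dist y x < d" using that by (simp add: dist_commute)
        then have "norm (G y - G x) \<le> e" using d(2)[of y x] by (simp add: dist_norm)
        then have "norm (G y - G x) * norm h \<le> e * norm h" by (simp add: mult_right_mono)
        then show "norm (((\<bullet>) (G y) - (\<bullet>) (G x)) h) \<le> e * norm h"
          using Cauchy_Schwarz_ineq2[of "G y - G x" h] by (simp add: inner_diff_left)
      qed (use e in simp)
    qed (use d in auto)
    then show ?thesis by (simp add: mult.commute)
  qed
  then show ?thesis using d(1) by blast
qed

lemma integrable_compact_support:
  fixes f :: "'a::euclidean_space \<Rightarrow> 'b::{banach, second_countable_topology}"
  assumes f: "continuous_on UNIV f" and f0: "\<And>x. norm x \<ge> R \<Longrightarrow> f x = 0"
  shows "integrable lborel f"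
proof -
  have "integrable lborel (\<lambda>x. indicator (cball 0 R) x *\<^sub>R f x)"
    using continuous_on_subset[OF f] by (intro borel_integrable_compact) auto
  moreover have "(\<lambda>x. indicator (cball 0 R) x *\<^sub>R f x) = f"
    using f0 by (auto simp: indicator_def fun_eq_iff)
  ultimately show ?thesis by simp
qed

lemma lborel_integral_translation:
  fixes f :: "'a::euclidean_space \<Rightarrow> 'b::{banach, second_countable_topology}"
  assumes "f \<in> borel_measurable borel"
  shows "(LINT x|lborel. f (c + x)) = (LINT x|lborel. f x)"
proof -
  have "(LINT x|lborel. f x) = (LINT x|distr lborel borel ((+) c). f x)"
    by (simp add: lborel_distr_plus)
  also have "\<dots> = (LINT x|lborel. f (c + x))"
    using assms by (intro integral_distr) auto
  finally show ?thesis by simp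
qed

text \<open>The integral of a difference quotient vanishes by translation invariance.\<close>

lemma integral_gradient_eq_0:
  fixes f :: "'a::euclidean_space \<Rightarrow> real"
  assumes f: "has_gradient f G" and f0: "\<And>x. norm x \<ge> R \<Longrightarrow> f x = 0" and G0: "\<And>x. norm x \<ge> R \<Longrightarrow> G x = 0"
  shows "(LINT x|lborel. G x \<bullet> b) = 0"
proof -
  have Gc: "continuous_on UNIV G" using f by (simp add: has_gradient_def)
  have fc: "continuous_on UNIV f" using has_gradient_continuous[OF f] .
  define M where "M = measure lborel (ball (0::'a) (R + norm b))"
  have intG: "integrable lborel (\<lambda>x. G x \<bullet> b)"
    by (rule integrable_compact_support[of _ R]) (use Gc G0 in \<open>auto intro!: continuous_intros\<close>)
  have intf: "integrable lborel f"
    by (rule integrable_compact_support[of _ R]) (use fc f0 in auto)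
  have bound: "\<bar>LINT x|lborel. G x \<bullet> b\<bar> \<le> e * norm b * M" if e: "e > 0" for e
  proof -
    obtain d where d: "d > 0" "\<And>x h. norm h < d \<Longrightarrow> \<bar>f (x + h) - f x - G x \<bullet> h\<bar> \<le> e * norm h"
      using gradient_uniform_linearization[OF f G0 e] by blast
    \<comment> \<open>This makes \<open>t *\<^sub>R b\<close> short enough for the linearization,
      also when \<open>b\<close> is 0; \<open>t \<le> 1\<close> makes the translated function vanish
      outside radius \<open>R + norm b\<close>.\<close>
    define t where "t = min 1 (d / (2 * (norm b + 1)))"
    have t: "t > 0" "t \<le> 1" using d by (auto simp: t_def add_nonneg_pos intro!: divide_pos_pos)
    have "t * norm b \<le> d / (2 * (norm b + 1)) * norm b"
      by (intro mult_right_mono) (auto simp: t_def)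
    also have "\<dots> < d"
    proof -
      have "d * norm b < d * (2 * (norm b + 1))" using d(1) by (intro mult_strict_left_mono) (auto simp: add_nonneg_pos)
      then show ?thesis by (simp add: pos_divide_less_eq add_nonneg_pos)
    qed
    finally have tb: "norm (t *\<^sub>R b) < d" using t by simp
    have tb': "norm (t *\<^sub>R b) \<le> norm b" using t by (simp add: mult_left_le_one_le)
    \<comment> \<open>Translation invariance cancels the two values of \<open>f\<close> in the
      integral of \<open>q\<close> and leaves \<open>- t\<close> times the wanted integral.
      Pointwise \<open>q\<close> is at most \<open>e * norm (t *\<^sub>R b)\<close>, so dividing by
      \<open>t\<close> leaves a multiple of \<open>e\<close>.\<close>
    define q where "q x = f (t *\<^sub>R b + x) - f x - t * (G x \<bullet> b)" for x
    have intf': "integrable lborel (\<lambda>x. f (t *\<^sub>R b + x))"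
    proof (rule integrable_compact_support[of _ "R + norm b"])
      show "continuous_on UNIV (\<lambda>x. f (t *\<^sub>R b + x))"
        by (intro continuous_on_compose2[OF fc] continuous_intros) auto
      show "f (t *\<^sub>R b + x) = 0" if "norm x \<ge> R + norm b" for x
      proof (rule f0)
        have "norm x \<le> norm (t *\<^sub>R b + x) + norm (t *\<^sub>R b)" by (metis add.commute add_diff_cancel_right' norm_triangle_sub add_diff_cancel norm_triangle_ineq4)
        then show "norm (t *\<^sub>R b + x) \<ge> R" using that tb' by linarith
      qed
    qed
    have "(LINT x|lborel. f (t *\<^sub>R b + x)) = (LINT x|lborel. f x)"
      by (rule lborel_integral_translation) (use fc in \<open>simp add: borel_measurable_continuous_onI\<close>)
    then have "(LINT x|lborel. q x) = - t * (LINT x|lborel. G x \<bullet> b)"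
      unfolding q_def using intf intf' intG by simp
    moreover have "norm (LINT x|lborel. q x) \<le> (LINT x|lborel. e * (t * norm b) * indicator (ball (0::'a) (R + norm b)) x)"
    proof (rule Bochner_Integration.integral_norm_bound_integral)
      show "integrable lborel q" unfolding q_def using intf intf' intG by simp
      show "integrable lborel (\<lambda>x. e * (t * norm b) * indicator (ball (0::'a) (R + norm b)) x)"
        using emeasure_lborel_ball_finite[of "0::'a" "R + norm b"] by (intro integrable_mult_right) (simp add: integrable_indicator_iff)
      fix x :: 'a
      show "norm (q x) \<le> e * (t * norm b) * indicator (ball (0::'a) (R + norm b)) x"
      proof (cases "norm x < R + norm b")
        case True
        then show ?thesis using d(2)[OF tb, of x] t by (simp add: q_def add.commute)
      next
        case False
        have "norm x \<le> norm (t *\<^sub>R b + x) + norm (t *\<^sub>R b)"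
          by (metis add.commute add_diff_cancel_right' norm_triangle_ineq4)
        then have "R \<le> norm (t *\<^sub>R b + x)" "R \<le> norm x" using False tb' norm_ge_zero[of b] by linarith+
        then show ?thesis using False by (simp add: q_def f0 G0)
      qed
    qed
    ultimately have "t * \<bar>LINT x|lborel. G x \<bullet> b\<bar> \<le> t * (e * norm b * M)"
      using t by (simp add: abs_mult M_def mult_ac)
    then show ?thesis using t by simp
  qed
  have "\<bar>LINT x|lborel. G x \<bullet> b\<bar> \<le> 0"
  proof (rule field_le_epsilon)
    fix e :: real assume "e > 0"
    have *: "norm b * M \<ge> 0" by (simp add: M_def)
    have "\<bar>LINT x|lborel. G x \<bullet> b\<bar> \<le> e / (norm b * M + 1) * norm b * M"
      using \<open>e > 0\<close> * by (intro bound) auto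
    also have "\<dots> \<le> e" using \<open>e > 0\<close> * by (simp add: field_simps)
    finally show "\<bar>LINT x|lborel. G x \<bullet> b\<bar> \<le> 0 + e" by simp
  qed
  then show ?thesis by simp
qed

section \<open>Divergence and integration by parts\<close>

lemma divergence_eq:
  assumes "(\<phi> has_derivative \<phi>') (at x)"
  shows "divergence \<phi> x = (\<Sum>b\<in>Basis. \<phi>' b \<bullet> b)"
  using frechet_derivative_at[OF assms] by (simp add: divergence_def)

lemma C1_vector_field_continuous:
  assumes "C1_vector_field (\<phi> :: 'a::euclidean_space \<Rightarrow> 'a)"
  shows "continuous_on UNIV \<phi>"
  using assms unfolding C1_vector_field_def
  by (meson continuous_at_imp_continuous_on has_derivative_continuous)

lemma continuous_on_divergence:
  assumes "C1_vector_field (\<phi> :: 'a::euclidean_space \<Rightarrow> 'a)"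
  shows "continuous_on UNIV (divergence \<phi>)"
proof -
  obtain \<phi>' where \<phi>': "\<And>x. (\<phi> has_derivative blinfun_apply (\<phi>' x)) (at x)" "continuous_on UNIV \<phi>'"
    using assms unfolding C1_vector_field_def by blast
  have "divergence \<phi> = (\<lambda>x. \<Sum>b\<in>Basis. \<phi>' x b \<bullet> b)" using divergence_eq[OF \<phi>'(1)] by auto
  then show ?thesis using \<phi>'(2) by (auto intro!: continuous_intros)
qed

text \<open>For each basis vector \<open>b\<close> the product
  \<open>g x * (\<phi> x \<bullet> b)\<close> has compact support, so its derivative in direction
  \<open>b\<close> integrates to 0; the sum over the basis is the claim. The support condition sits
  on \<open>g\<close> alone, so that the unbounded field \<open>x - c\<close> can be inserted for
  \<open>\<phi>\<close>.\<close>

lemma integral_divergence_by_parts: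
  fixes g :: "'a::euclidean_space \<Rightarrow> real"
  assumes g: "has_gradient g \<Gamma>" and g0: "\<And>x. norm x \<ge> R \<Longrightarrow> g x = 0" and \<Gamma>0: "\<And>x. norm x \<ge> R \<Longrightarrow> \<Gamma> x = 0"
    and \<phi>: "C1_vector_field \<phi>"
  shows "(LINT x|lborel. g x * divergence \<phi> x) = - (LINT x|lborel. \<Gamma> x \<bullet> \<phi> x)"
proof -
  obtain \<phi>' where \<phi>': "\<And>x. (\<phi> has_derivative blinfun_apply (\<phi>' x)) (at x)" "continuous_on UNIV \<phi>'"
    using \<phi> unfolding C1_vector_field_def by blast
  have cont: "continuous_on UNIV g" "continuous_on UNIV \<Gamma>" "continuous_on UNIV \<phi>" "continuous_on UNIV (divergence \<phi>)"
    using g has_gradient_continuous[OF g] continuous_on_divergence[OF \<phi>] C1_vector_field_continuous[OF \<phi>] by (auto simp: has_gradient_def)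
  have part: "(LINT x|lborel. g x * (\<phi>' x b \<bullet> b) + (\<phi> x \<bullet> b) * (\<Gamma> x \<bullet> b)) = 0"
    if b: "b \<in> Basis" for b
  proof -
    define G where "G x = g x *\<^sub>R (\<Sum>c\<in>Basis. (\<phi>' x c \<bullet> b) *\<^sub>R c) + (\<phi> x \<bullet> b) *\<^sub>R \<Gamma> x" for x
    \<comment> \<open>The vector on the left is the gradient of the component
      \<open>\<phi> \<bullet> b\<close>, written out in the basis.\<close>
    have lin: "(\<Sum>c\<in>Basis. (\<phi>' x c \<bullet> b) *\<^sub>R c) \<bullet> h = \<phi>' x h \<bullet> b" for x h
    proof -
      have "\<phi>' x h = \<phi>' x (\<Sum>c\<in>Basis. (h \<bullet> c) *\<^sub>R c)" by (simp add: euclidean_representation)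
      also have "\<dots> = (\<Sum>c\<in>Basis. (h \<bullet> c) *\<^sub>R \<phi>' x c)" by (simp add: blinfun.bilinear_simps)
      finally show ?thesis by (simp add: inner_sum_left inner_commute[of h] mult.commute)
    qed
    have "has_gradient (\<lambda>x. g x * (\<phi> x \<bullet> b)) G"
      unfolding has_gradient_def
    proof
      show "continuous_on UNIV G" unfolding G_def[abs_def] using cont \<phi>'(2) by (intro continuous_intros) auto
      show "\<forall>x. ((\<lambda>x. g x * (\<phi> x \<bullet> b)) has_derivative (\<bullet>) (G x)) (at x)"
      proof
        fix x
        have "(g has_derivative (\<lambda>h. \<Gamma> x \<bullet> h)) (at x)" using g by (simp add: has_gradient_def)
        then have "((\<lambda>x. g x * (\<phi> x \<bullet> b)) has_derivative (\<lambda>h. g x * (\<phi>' x h \<bullet> b) + (\<Gamma> x \<bullet> h) * (\<phi> x \<bullet> b))) (at x)"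
          by (intro has_derivative_mult has_derivative_inner_left \<phi>'(1))
        moreover have "(\<lambda>h. g x * (\<phi>' x h \<bullet> b) + (\<Gamma> x \<bullet> h) * (\<phi> x \<bullet> b)) = (\<bullet>) (G x)"
          by (rule ext) (simp add: G_def inner_add_left lin mult.commute)
        ultimately show "((\<lambda>x. g x * (\<phi> x \<bullet> b)) has_derivative (\<bullet>) (G x)) (at x)"
          by simp
      qed
    qed
    then have "(LINT x|lborel. G x \<bullet> b) = 0"
      by (rule integral_gradient_eq_0[where R=R]) (use g0 \<Gamma>0 in \<open>auto simp: G_def\<close>)
    then show ?thesis unfolding G_def by (simp add: inner_add_left lin)
  qed
  have int1: "integrable lborel (\<lambda>x. g x * (\<phi>' x b \<bullet> b) + (\<phi> x \<bullet> b) * (\<Gamma> x \<bullet> b))" for b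
    by (rule integrable_compact_support[of _ R]) (use cont \<phi>'(2) g0 \<Gamma>0 in \<open>auto intro!: continuous_intros\<close>)
  have int2: "integrable lborel (\<lambda>x. g x * divergence \<phi> x)" "integrable lborel (\<lambda>x. \<Gamma> x \<bullet> \<phi> x)"
    by (rule integrable_compact_support[of _ R]; use cont g0 \<Gamma>0 in \<open>auto intro!: continuous_intros\<close>)+
  have sum_parts: "g x * divergence \<phi> x + \<Gamma> x \<bullet> \<phi> x = (\<Sum>b\<in>Basis. g x * (\<phi>' x b \<bullet> b) + (\<phi> x \<bullet> b) * (\<Gamma> x \<bullet> b))" for x
  proof -
    have "\<Gamma> x \<bullet> \<phi> x = (\<Sum>b\<in>Basis. (\<phi> x \<bullet> b) * (\<Gamma> x \<bullet> b))" for x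
      by (subst euclidean_inner) (simp add: mult.commute)
    then show ?thesis unfolding divergence_eq[OF \<phi>'(1)] sum.distrib sum_distrib_left by simp
  qed
  have "(LINT x|lborel. g x * divergence \<phi> x + \<Gamma> x \<bullet> \<phi> x) = 0"
    unfolding sum_parts using int1 part by (subst Bochner_Integration.integral_sum) auto
  then show ?thesis using int2 by simp
qed

section \<open>The perimeter of a ball\<close>

lemma set_lebesgue_integral_borel:
  fixes f :: "'a::euclidean_space \<Rightarrow> real"
  assumes "E \<in> sets borel" "f \<in> borel_measurable borel"
  shows "(LINT x:E|lebesgue. f x) = (LINT x|lborel. indicator E x * f x)"
  unfolding set_lebesgue_integral_def
  by (subst integral_completion) (use assms in auto)

lemma has_gradient_shift:
  assumes "has_gradient f G"
  shows "has_gradient (\<lambda>x. f (x - c)) (\<lambda>x. G (x - c))"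
  unfolding has_gradient_def
proof
  show "continuous_on UNIV (\<lambda>x. G (x - c))"
    using assms unfolding has_gradient_def
    by (auto intro!: continuous_on_compose2[of UNIV G] continuous_intros)
  show "\<forall>x. ((\<lambda>x. f (x - c)) has_derivative (\<bullet>) (G (x - c))) (at x)"
  proof
    fix x
    have "((\<lambda>x. x - c) has_derivative (\<lambda>h. h)) (at x)" by (auto intro!: derivative_eq_intros)
    from has_derivative_compose[OF this, of f "(\<bullet>) (G (x - c))"] assms
    show "((\<lambda>x. f (x - c)) has_derivative (\<bullet>) (G (x - c))) (at x)"
      by (simp add: has_gradient_def)
  qed
qed

lemma C1_vector_field_diff_const: "C1_vector_field (\<lambda>x::'a::euclidean_space. x - c)"
  unfolding C1_vector_field_def
proof (intro exI conjI allI)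
  show "((\<lambda>x. x - c) has_derivative blinfun_apply id_blinfun) (at x)" for x
    by (auto intro!: derivative_eq_intros)
qed simp

lemma divergence_diff_const: "divergence (\<lambda>x::'a::euclidean_space. x - c) x = DIM('a)"
proof -
  have "((\<lambda>x. x - c) has_derivative (\<lambda>h. h)) (at x)" by (auto intro!: derivative_eq_intros)
  from divergence_eq[OF this] show ?thesis by simp
qed

text \<open>For a radial cutoff \<open>g\<close> equal to \<open>1\<close> on the ball of radius \<open>a\<close>, the gradient \<open>\<Gamma>\<close> vanishes on that
  ball and points towards \<open>c\<close>, so the integral of its norm is at most \<open>1 / a\<close> times that of
  \<open>- (\<Gamma> x \<bullet> (x - c))\<close>; integrating by parts once more gives \<open>DIM / a\<close> times the integral of \<open>g\<close>.\<close>

lemma integral_divergence_ball_le: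
  fixes c :: "'a::euclidean_space"
  assumes \<rho>: "\<rho> > 0" and \<phi>: "C1_vector_field \<phi>" and \<phi>1: "AE x in lborel. norm (\<phi> x) \<le> 1"
  shows "(LINT x|lborel. indicator (ball c \<rho>) x * divergence \<phi> x) \<le> DIM('a) / \<rho> * measure lborel (ball c \<rho>)"
proof -
  have cont: "continuous_on UNIV \<phi>" "continuous_on UNIV (divergence \<phi>)"
    using continuous_on_divergence[OF \<phi>] C1_vector_field_continuous[OF \<phi>] by auto
  define V where "V = measure lborel (ball c \<rho>)"
  have intB: "integrable lborel (indicator (ball c \<rho>) :: 'a \<Rightarrow> real)"
    using emeasure_lborel_ball_finite[of c \<rho>] by (simp add: integrable_indicator_iff)
  have step: "(LINT x|lborel. bump a \<rho> (x - c) * divergence \<phi> x) \<le> DIM('a) / a * V"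
    if a: "0 < a" "a < \<rho>" for a
  proof -
    have a0: "0 \<le> a" using a by simp
    define \<Gamma> where "\<Gamma> x = bump_grad a \<rho> (x - c)" for x :: 'a
    define g where "g x = bump a \<rho> (x - c)" for x :: 'a
    have g: "has_gradient g \<Gamma>" unfolding g_def[abs_def] \<Gamma>_def[abs_def]
      by (rule has_gradient_shift[OF has_gradient_bump[OF a0 a(2)]])
    have far: "norm (x - c) \<ge> \<rho>" if "norm x \<ge> \<rho> + norm c" for x
      using that norm_triangle_ineq2[of x c] by linarith
    have g0: "\<And>x. norm x \<ge> \<rho> + norm c \<Longrightarrow> g x = 0" and \<Gamma>0: "\<And>x. norm x \<ge> \<rho> + norm c \<Longrightarrow> \<Gamma> x = 0"
      unfolding g_def \<Gamma>_def by (auto intro!: bump_eq_0[OF a0 a(2)] bump_grad_eq_0[OF a0 a(2)] far)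
    have cg: "continuous_on UNIV \<Gamma>" "continuous_on UNIV g"
      using g has_gradient_continuous[OF g] by (auto simp: has_gradient_def)
    have int: "integrable lborel (\<lambda>x. \<Gamma> x \<bullet> \<phi> x)" "integrable lborel (\<lambda>x. norm (\<Gamma> x))"
      "integrable lborel (\<lambda>x. \<Gamma> x \<bullet> (x - c))" "integrable lborel g"
      by (rule integrable_compact_support[of _ "\<rho> + norm c"]; use cont cg g0 \<Gamma>0 in \<open>auto intro!: continuous_intros\<close>)+
    have "(LINT x|lborel. g x * divergence \<phi> x) = - (LINT x|lborel. \<Gamma> x \<bullet> \<phi> x)"
      by (rule integral_divergence_by_parts[OF g g0 \<Gamma>0 \<phi>])
    also have "\<dots> = (LINT x|lborel. - (\<Gamma> x \<bullet> \<phi> x))" by simp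
    also have "\<dots> \<le> (LINT x|lborel. norm (\<Gamma> x))"
    proof (rule integral_mono_AE)
      show "AE x in lborel. - (\<Gamma> x \<bullet> \<phi> x) \<le> norm (\<Gamma> x)"
        using \<phi>1
      proof eventually_elim
        fix x assume "norm (\<phi> x) \<le> 1"
        then have "norm (\<Gamma> x) * norm (\<phi> x) \<le> norm (\<Gamma> x)" by (simp add: mult_left_le)
        then show "- (\<Gamma> x \<bullet> \<phi> x) \<le> norm (\<Gamma> x)"
          using Cauchy_Schwarz_ineq2[of "\<Gamma> x" "\<phi> x"] by linarith
      qed
    qed (use int in auto)
    also have "\<dots> \<le> (LINT x|lborel. - (1 / a) * (\<Gamma> x \<bullet> (x - c)))"
    proof (rule integral_mono)
      fix x :: 'a
      have "a * norm (\<Gamma> x) \<le> - (\<Gamma> x \<bullet> (x - c))"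
        unfolding \<Gamma>_def by (rule norm_bump_grad_le[OF a0 a(2)])
      then show "norm (\<Gamma> x) \<le> - (1 / a) * (\<Gamma> x \<bullet> (x - c))"
        using a by (simp add: field_simps)
    qed (use int in auto)
    also have "\<dots> = (1 / a) * (LINT x|lborel. g x * divergence (\<lambda>x. x - c) x)"
      using integral_divergence_by_parts[OF g g0 \<Gamma>0 C1_vector_field_diff_const[of c]] by simp
    also have "\<dots> = DIM('a) / a * (LINT x|lborel. g x)"
      by (simp add: divergence_diff_const mult.commute)
    also have "\<dots> \<le> DIM('a) / a * V"
    proof (rule mult_left_mono)
      have "(LINT x|lborel. g x) \<le> (LINT x|lborel. indicator (ball c \<rho>) x)"
      proof (rule integral_mono)
        fix x :: 'a
        show "g x \<le> indicator (ball c \<rho>) x"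
          using bump_nonneg[of _ _ "x - c"] bump_le_1[of _ _ "x - c"] bump_eq_0[OF a0 a(2), of "x - c"]
          by (auto simp: g_def indicator_def dist_norm norm_minus_commute not_less)
      qed (use int intB in auto)
      then show "(LINT x|lborel. g x) \<le> V" by (simp add: V_def)
    qed (use a in auto)
    finally show ?thesis unfolding g_def .
  qed
  \<comment> \<open>Radii increasing to \<open>\<rho>\<close>. The double \<open>Suc\<close> keeps
    \<open>a 0\<close> positive; with a single one it would be 0.\<close>
  define a where "a n = \<rho> - \<rho> * inverse (real (Suc (Suc n)))" for n :: nat
  have a: "0 < a n" "a n < \<rho>" for n
  proof -
    have "inverse (real (Suc (Suc n))) < 1" by (simp add: inverse_less_1_iff)
    then have "\<rho> * inverse (real (Suc (Suc n))) < \<rho> * 1" using \<rho> by (intro mult_strict_left_mono)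
    then show "0 < a n" "a n < \<rho>" using \<rho> by (auto simp: a_def)
  qed
  have a_lim: "a \<longlonglongrightarrow> \<rho>"
  proof -
    have "(\<lambda>n. \<rho> - \<rho> * inverse (real (Suc (Suc n)))) \<longlonglongrightarrow> \<rho> - \<rho> * 0"
      by (intro tendsto_intros LIMSEQ_Suc[OF LIMSEQ_inverse_real_of_nat])
    then show ?thesis by (simp add: a_def[abs_def])
  qed
  \<comment> \<open>The pointwise limit is the indicator of the open ball: inside, the cutoffs are
    eventually 1, and on and outside the sphere all of them vanish.\<close>
  have "(\<lambda>n. LINT x|lborel. bump (a n) \<rho> (x - c) * divergence \<phi> x)
     \<longlonglongrightarrow> (LINT x|lborel. indicator (ball c \<rho>) x * divergence \<phi> x)"
  proof (rule integral_dominated_convergence[where w="\<lambda>x. indicator (cball c \<rho>) x *\<^sub>R \<bar>divergence \<phi> x\<bar>"])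
    show "integrable lborel (\<lambda>x. indicator (cball c \<rho>) x *\<^sub>R \<bar>divergence \<phi> x\<bar>)"
      using continuous_on_subset[OF cont(2)] by (intro borel_integrable_compact continuous_intros) auto
    show "AE x in lborel. (\<lambda>n. bump (a n) \<rho> (x - c) * divergence \<phi> x) \<longlonglongrightarrow> indicator (ball c \<rho>) x * divergence \<phi> x"
    proof (rule AE_I2)
      fix x :: 'a
      have "\<forall>\<^sub>F n in sequentially. bump (a n) \<rho> (x - c) = indicator (ball c \<rho>) x"
      proof (cases "norm (x - c) < \<rho>")
        case True
        from order_tendstoD(1)[OF a_lim True] show ?thesis
        proof eventually_elim
          fix n assume "norm (x - c) < a n"
          then show "bump (a n) \<rho> (x - c) = indicator (ball c \<rho>) x"
            using True a[of n] by (simp add: bump_eq_1 dist_norm norm_minus_commute)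
        qed
      next
        case False
        then show ?thesis using a
          by (intro always_eventually allI) (simp add: bump_eq_0 less_imp_le dist_norm norm_minus_commute)
      qed
      then show "(\<lambda>n. bump (a n) \<rho> (x - c) * divergence \<phi> x) \<longlonglongrightarrow> indicator (ball c \<rho>) x * divergence \<phi> x"
        by (intro tendsto_eventually) (auto elim: eventually_mono)
    qed
    show "AE x in lborel. norm (bump (a n) \<rho> (x - c) * divergence \<phi> x) \<le> indicator (cball c \<rho>) x *\<^sub>R \<bar>divergence \<phi> x\<bar>" for n
    proof (rule AE_I2)
      fix x :: 'a
      have "\<bar>bump (a n) \<rho> (x - c)\<bar> \<le> indicator (cball c \<rho>) x"
        using a[of n] bump_nonneg[of "a n" \<rho> "x - c"] bump_le_1[of "a n" \<rho> "x - c"] bump_eq_0[of "a n" \<rho> "x - c"]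
        by (auto simp: indicator_def dist_norm norm_minus_commute)
      then show "norm (bump (a n) \<rho> (x - c) * divergence \<phi> x) \<le> indicator (cball c \<rho>) x *\<^sub>R \<bar>divergence \<phi> x\<bar>"
        by (simp add: abs_mult mult_right_mono)
    qed
    show "(\<lambda>x. bump (a n) \<rho> (x - c) * divergence \<phi> x) \<in> borel_measurable lborel" for n
    proof -
      have "continuous_on UNIV (\<lambda>x. bump (a n) \<rho> (x - c))"
        using has_gradient_continuous[OF has_gradient_shift[OF has_gradient_bump]] a[of n] less_imp_le by blast
      then have "continuous_on UNIV (\<lambda>x. bump (a n) \<rho> (x - c) * divergence \<phi> x)"
        using cont by (intro continuous_intros) auto
      then show ?thesis by (simp add: borel_measurable_continuous_onI)
    qed
  qed (use borel_measurable_continuous_onI[OF cont(2)] in \<open>auto intro!: borel_measurable_times borel_measurable_indicator\<close>)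
  moreover have "(\<lambda>n. DIM('a) / a n * V) \<longlonglongrightarrow> DIM('a) / \<rho> * V"
    using \<rho> by (intro tendsto_intros a_lim) auto
  ultimately show ?thesis
    unfolding V_def using step a by (intro LIMSEQ_le) (auto simp: V_def)
qed

lemma perimeter_ball_le:
  fixes c :: "'a::euclidean_space"
  assumes "\<rho> > 0"
  shows "perimeter (ball c \<rho>) \<le> ereal (DIM('a) / \<rho> * measure lborel (ball c \<rho>))"
  unfolding perimeter_def
proof (rule SUP_least)
  fix \<phi> :: "'a \<Rightarrow> 'a" assume "\<phi> \<in> {\<phi>. C1c_vector_field \<phi> \<and> (AE x in lebesgue. norm (\<phi> x) \<le> 1)}"
  then have \<phi>: "C1_vector_field \<phi>" "AE x in lborel. norm (\<phi> x) \<le> 1"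
    by (auto simp: C1c_vector_field_def AE_completion_iff)
  have "(LINT x:ball c \<rho>|lebesgue. divergence \<phi> x) = (LINT x|lborel. indicator (ball c \<rho>) x * divergence \<phi> x)"
    by (rule set_lebesgue_integral_borel)
       (use continuous_on_divergence[OF \<phi>(1)] C1_vector_field_continuous[OF \<phi>(1)] in \<open>auto simp: borel_measurable_continuous_onI\<close>)
  then show "ereal (LINT x:ball c \<rho>|lebesgue. divergence \<phi> x) \<le> ereal (DIM('a) / \<rho> * measure lborel (ball c \<rho>))"
    using integral_divergence_ball_le[OF assms \<phi>] by simp
qed

section \<open>Mollification\<close>

lemma integrable_scale_compact_support:
  fixes f :: "'a::euclidean_space \<Rightarrow> 'b::euclidean_space" and k :: "'a \<Rightarrow> real"
  assumes k: "continuous_on UNIV k" and k0: "\<And>z. norm z \<ge> r \<Longrightarrow> k z = 0" and f: "integrable lborel f"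
  shows "integrable lborel (\<lambda>y. k (x - y) *\<^sub>R f y)"
proof -
  have "compact (k ` cball 0 r)" using k by (intro compact_continuous_image continuous_on_subset[OF k]) auto
  then obtain B where B: "\<And>z. z \<in> cball 0 r \<Longrightarrow> norm (k z) \<le> B"
    using compact_imp_bounded bounded_iff by (metis imageI)
  have kB: "norm (k z) \<le> \<bar>B\<bar>" for z
    using B[of z] k0[of z] by (cases "norm z \<le> r") auto
  have [measurable]: "k \<in> borel_measurable borel" "f \<in> borel_measurable borel"
    using k f borel_measurable_integrable[OF f] by (auto intro: borel_measurable_continuous_onI)
  show ?thesis
  proof (rule Bochner_Integration.integrable_bound[where f="\<lambda>y. \<bar>B\<bar> *\<^sub>R norm (f y)"])
    show "integrable lborel (\<lambda>y. \<bar>B\<bar> *\<^sub>R norm (f y))" using f by auto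
    show "AE y in lborel. norm (k (x - y) *\<^sub>R f y) \<le> norm (\<bar>B\<bar> *\<^sub>R norm (f y))"
      using kB by (auto intro!: mult_right_mono simp: abs_mult)
  qed measurable
qed

lemma continuous_convolution:
  fixes f :: "'a::euclidean_space \<Rightarrow> 'b::euclidean_space" and k :: "'a \<Rightarrow> real"
  assumes k: "continuous_on UNIV k" and k0: "\<And>z. norm z \<ge> r \<Longrightarrow> k z = 0" and f: "integrable lborel f"
  shows "continuous_on UNIV (\<lambda>x. LINT y|lborel. k (x - y) *\<^sub>R f y)"
  unfolding continuous_on_iff
proof (intro ballI allI impI)
  fix x :: 'a and e :: real assume e: "e > 0"
  define N where "N = (LINT y|lborel. norm (f y))"
  have N: "N \<ge> 0" by (simp add: N_def)
  define \<eta> where "\<eta> = e / (N + 1)"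
  have "uniformly_continuous_on UNIV k" by (rule compact_support_uniformly_continuous[OF k k0])
  moreover have "\<eta> > 0" using e N by (simp add: \<eta>_def)
  ultimately obtain d where d: "d > 0" "\<And>z z'. dist z' z < d \<Longrightarrow> dist (k z') (k z) < \<eta>"
    unfolding uniformly_continuous_on_def by (metis UNIV_I)
  have "dist (LINT y|lborel. k (x' - y) *\<^sub>R f y) (LINT y|lborel. k (x - y) *\<^sub>R f y) < e" if x': "dist x' x < d" for x'
  proof -
    have "(LINT y|lborel. k (x' - y) *\<^sub>R f y) - (LINT y|lborel. k (x - y) *\<^sub>R f y)
      = (LINT y|lborel. k (x' - y) *\<^sub>R f y - k (x - y) *\<^sub>R f y)"
      by (intro Bochner_Integration.integral_diff[symmetric] integrable_scale_compact_support k k0 f)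
    also have "norm \<dots> \<le> (LINT y|lborel. \<eta> * norm (f y))"
    proof (rule Bochner_Integration.integral_norm_bound_integral)
      show "integrable lborel (\<lambda>y. k (x' - y) *\<^sub>R f y - k (x - y) *\<^sub>R f y)"
        by (intro Bochner_Integration.integrable_diff integrable_scale_compact_support k k0 f)
      fix y
      have "dist (k (x' - y)) (k (x - y)) < \<eta>" using x' by (intro d) (simp add: dist_norm)
      then show "norm (k (x' - y) *\<^sub>R f y - k (x - y) *\<^sub>R f y) \<le> \<eta> * norm (f y)"
        by (simp flip: scaleR_diff_left add: dist_norm mult_right_mono)
    qed (use f in auto)
    also have "\<dots> = \<eta> * N" by (simp add: N_def)
    also have "\<dots> < e" using e N by (simp add: \<eta>_def field_simps)
    finally show ?thesis by (simp add: dist_norm)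
  qed
  then show "\<exists>d>0. \<forall>x'\<in>UNIV. dist x' x < d \<longrightarrow>
      dist (LINT y|lborel. k (x' - y) *\<^sub>R f y) (LINT y|lborel. k (x - y) *\<^sub>R f y) < e"
    using d(1) by blast
qed

text \<open>The value type is general because both the indicator of a set and a test field are
  mollified. In \<open>conv_deriv\<close> and \<open>conv_grad\<close> the derivative falls on the
  kernel, so integrability of \<open>f\<close> suffices.\<close>

definition conv :: "('a \<Rightarrow> real) \<Rightarrow> ('a \<Rightarrow> 'b::euclidean_space) \<Rightarrow> 'a::euclidean_space \<Rightarrow> 'b" where
  "conv \<rho> f x = (LINT y|lborel. \<rho> (x - y) *\<^sub>R f y)"

definition conv_deriv :: "('a \<Rightarrow> 'a) \<Rightarrow> ('a \<Rightarrow> 'b::euclidean_space) \<Rightarrow> 'a \<Rightarrow> 'a::euclidean_space \<Rightarrow> 'b" where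
  "conv_deriv \<Gamma> f x h = (LINT y|lborel. (\<Gamma> (x - y) \<bullet> h) *\<^sub>R f y)"

definition conv_grad :: "('a \<Rightarrow> 'a) \<Rightarrow> ('a \<Rightarrow> real) \<Rightarrow> 'a::euclidean_space \<Rightarrow> 'a" where
  "conv_grad \<Gamma> f x = (LINT y|lborel. f y *\<^sub>R \<Gamma> (x - y))"

definition kernel :: "('a::euclidean_space \<Rightarrow> real) \<Rightarrow> ('a \<Rightarrow> 'a) \<Rightarrow> real \<Rightarrow> bool" where
  "kernel \<rho> \<Gamma> r \<longleftrightarrow> has_gradient \<rho> \<Gamma> \<and> (\<forall>z. norm z \<ge> r \<longrightarrow> \<rho> z = 0 \<and> \<Gamma> z = 0)"

text \<open>Evenness of \<open>\<rho>\<close> allows a convolution to be moved from one factor of an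
  integral to the other, and oddness of \<open>\<Gamma>\<close> supplies the sign when this is done
  with the gradient.\<close>

definition mollifier :: "('a::euclidean_space \<Rightarrow> real) \<Rightarrow> ('a \<Rightarrow> 'a) \<Rightarrow> real \<Rightarrow> bool" where
  "mollifier \<rho> \<Gamma> r \<longleftrightarrow> kernel \<rho> \<Gamma> r \<and> (\<forall>z. \<rho> (- z) = \<rho> z) \<and> (\<forall>z. \<Gamma> (- z) = - \<Gamma> z) \<and>
     (\<forall>z. \<rho> z \<ge> 0) \<and> (LINT z|lborel. \<rho> z) = 1"

lemma kernel_has_gradient: "kernel \<rho> \<Gamma> r \<Longrightarrow> has_gradient \<rho> \<Gamma>"
  by (simp add: kernel_def)

lemma kernel_eq_0: "kernel \<rho> \<Gamma> r \<Longrightarrow> norm z \<ge> r \<Longrightarrow> \<rho> z = 0"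
  by (simp add: kernel_def)

lemma kernel_grad_eq_0: "kernel \<rho> \<Gamma> r \<Longrightarrow> norm z \<ge> r \<Longrightarrow> \<Gamma> z = 0"
  by (simp add: kernel_def)

lemma kernel_continuous: "kernel \<rho> \<Gamma> r \<Longrightarrow> continuous_on UNIV \<rho>"
  using has_gradient_continuous kernel_has_gradient by blast

lemma kernel_grad_continuous: "kernel \<rho> \<Gamma> r \<Longrightarrow> continuous_on UNIV \<Gamma>"
  by (simp add: kernel_def has_gradient_def)

lemma integrable_conv:
  fixes f :: "'a::euclidean_space \<Rightarrow> 'b::euclidean_space"
  assumes kernel: "kernel \<rho> \<Gamma> r"
  shows "integrable lborel f \<Longrightarrow> integrable lborel (\<lambda>y. \<rho> (x - y) *\<^sub>R f y)"
  by (rule integrable_scale_compact_support[OF kernel_continuous[OF kernel] kernel_eq_0[OF kernel]])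

lemma integrable_conv_deriv:
  fixes f :: "'a::euclidean_space \<Rightarrow> 'b::euclidean_space"
  assumes kernel: "kernel \<rho> \<Gamma> r"
  shows "integrable lborel f \<Longrightarrow> integrable lborel (\<lambda>y. (\<Gamma> (x - y) \<bullet> h) *\<^sub>R f y)"
  by (rule integrable_scale_compact_support[where k="\<lambda>z. \<Gamma> z \<bullet> h" and r=r])
     (auto intro!: continuous_intros kernel_grad_continuous[OF kernel] simp: kernel_grad_eq_0[OF kernel])

lemma continuous_conv_deriv:
  fixes f :: "'a::euclidean_space \<Rightarrow> 'b::euclidean_space"
  assumes kernel: "kernel \<rho> \<Gamma> r"
  shows "integrable lborel f \<Longrightarrow> continuous_on UNIV (\<lambda>x. conv_deriv \<Gamma> f x h)"
  unfolding conv_deriv_def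
  by (rule continuous_convolution[where k="\<lambda>z. \<Gamma> z \<bullet> h" and r=r])
     (auto intro!: continuous_intros kernel_grad_continuous[OF kernel] simp: kernel_grad_eq_0[OF kernel])

text \<open>The uniform linearization error of the kernel, multiplied by the integral of
  \<open>norm (f y)\<close>. It gives the differentiability of the convolution, and later the
  uniform hypothesis of \<open>level_set_inequality\<close>.\<close>

lemma conv_uniform_linearization:
  assumes kernel: "kernel \<rho> \<Gamma> r"
    and f: "integrable lborel f" and e: "e > 0"
  shows "\<exists>\<delta>>0. \<forall>x h. norm h < \<delta> \<longrightarrow> norm (conv \<rho> f (x + h) - conv \<rho> f x - conv_deriv \<Gamma> f x h) \<le> e * norm h"
proof -
  define N where "N = (LINT y|lborel. norm (f y))"
  have N: "N \<ge> 0" by (simp add: N_def)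
  define \<eta> where "\<eta> = e / (N + 1)"
  have "\<eta> > 0" using e N by (simp add: \<eta>_def)
  then obtain \<delta> where \<delta>: "\<delta> > 0" "\<And>z h. norm h < \<delta> \<Longrightarrow> \<bar>\<rho> (z + h) - \<rho> z - \<Gamma> z \<bullet> h\<bar> \<le> \<eta> * norm h"
    using gradient_uniform_linearization[OF kernel_has_gradient[OF kernel] kernel_grad_eq_0[OF kernel]] by blast
  have "norm (conv \<rho> f (x + h) - conv \<rho> f x - conv_deriv \<Gamma> f x h) \<le> e * norm h" if h: "norm h < \<delta>" for x h
  proof -
    have "conv \<rho> f (x + h) - conv \<rho> f x - conv_deriv \<Gamma> f x h =
      (LINT y|lborel. \<rho> (x + h - y) *\<^sub>R f y - \<rho> (x - y) *\<^sub>R f y - (\<Gamma> (x - y) \<bullet> h) *\<^sub>R f y)"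
      unfolding conv_def conv_deriv_def
      by (simp add: integrable_conv[OF kernel f] integrable_conv_deriv[OF kernel f])
    also have "norm \<dots> \<le> (LINT y|lborel. (\<eta> * norm h) * norm (f y))"
    proof (rule Bochner_Integration.integral_norm_bound_integral)
      show "integrable lborel (\<lambda>y. \<rho> (x + h - y) *\<^sub>R f y - \<rho> (x - y) *\<^sub>R f y - (\<Gamma> (x - y) \<bullet> h) *\<^sub>R f y)"
        by (intro Bochner_Integration.integrable_diff integrable_conv[OF kernel f] integrable_conv_deriv[OF kernel f])
      fix y
      have "\<bar>\<rho> (x - y + h) - \<rho> (x - y) - \<Gamma> (x - y) \<bullet> h\<bar> \<le> \<eta> * norm h" by (rule \<delta>(2)[OF h])
      moreover have "x + h - y = x - y + h" by simp
      ultimately show "norm (\<rho> (x + h - y) *\<^sub>R f y - \<rho> (x - y) *\<^sub>R f y - (\<Gamma> (x - y) \<bullet> h) *\<^sub>R f y) \<le> \<eta> * norm h * norm (f y)"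
        by (simp only: scaleR_diff_left[symmetric] norm_scaleR real_norm_def) (simp add: mult_right_mono)
    qed (use f in auto)
    also have "\<dots> = e * norm h * (N / (N + 1))" by (simp add: \<eta>_def N_def)
    also have "\<dots> \<le> e * norm h * 1" using e N by (intro mult_left_mono) auto
    finally show ?thesis by simp
  qed
  then show ?thesis using \<delta>(1) by blast
qed

lemma bounded_linear_conv_deriv:
  assumes kernel: "kernel \<rho> \<Gamma> r"
    and f: "integrable lborel f"
  shows "bounded_linear (conv_deriv \<Gamma> f x)"
proof -
  have "linear (conv_deriv \<Gamma> f x)"
    unfolding conv_deriv_def
    by (rule linearI)
       (simp_all add: inner_add_right scaleR_add_left integrable_conv_deriv[OF kernel f] flip: scaleR_scaleR)
  then show ?thesis by (simp add: linear_conv_bounded_linear)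
qed

lemma conv_has_derivative:
  assumes kernel: "kernel \<rho> \<Gamma> r"
    and f: "integrable lborel f"
  shows "(conv \<rho> f has_derivative conv_deriv \<Gamma> f x) (at x)"
  unfolding has_derivative_at_alt
proof (intro conjI allI impI bounded_linear_conv_deriv[OF kernel f])
  fix e :: real assume "e > 0"
  then obtain \<delta> where \<delta>: "\<delta> > 0" "\<And>x h. norm h < \<delta> \<Longrightarrow> norm (conv \<rho> f (x + h) - conv \<rho> f x - conv_deriv \<Gamma> f x h) \<le> e * norm h"
    using conv_uniform_linearization[OF kernel f] by blast
  show "\<exists>d>0. \<forall>y. norm (y - x) < d \<longrightarrow> norm (conv \<rho> f y - conv \<rho> f x - conv_deriv \<Gamma> f x (y - x)) \<le> e * norm (y - x)"
    using \<delta>(1) \<delta>(2)[of "y - x" x for y] by (intro exI[of _ \<delta>]) simp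
qed

lemma C1_vector_field_conv:
  fixes f :: "'a::euclidean_space \<Rightarrow> 'a"
  assumes kernel: "kernel \<rho> \<Gamma> r"
    and f: "integrable lborel f"
  shows "C1_vector_field (conv \<rho> f)"
  unfolding C1_vector_field_def
proof (intro exI conjI allI)
  show "(conv \<rho> f has_derivative blinfun_apply (Blinfun (conv_deriv \<Gamma> f x))) (at x)" for x
    using conv_has_derivative[OF kernel f] bounded_linear_Blinfun_apply[OF bounded_linear_conv_deriv[OF kernel f]] by simp
  show "continuous_on UNIV (\<lambda>x. Blinfun (conv_deriv \<Gamma> f x))"
    by (rule continuous_on_blinfun_componentwise)
       (simp add: bounded_linear_Blinfun_apply[OF bounded_linear_conv_deriv[OF kernel f]] continuous_conv_deriv[OF kernel f])
qed

lemma divergence_conv: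
  fixes f :: "'a::euclidean_space \<Rightarrow> 'a"
  assumes kernel: "kernel \<rho> \<Gamma> r"
    and f: "integrable lborel f"
  shows "divergence (conv \<rho> f) x = (LINT y|lborel. \<Gamma> (x - y) \<bullet> f y)"
proof -
  have int: "integrable lborel (\<lambda>y. (\<Gamma> (x - y) \<bullet> b) * (f y \<bullet> b))" for b
    using integrable_inner_left[OF integrable_conv_deriv[OF kernel f, of x b], of b] by simp
  have "divergence (conv \<rho> f) x = (\<Sum>b\<in>Basis. conv_deriv \<Gamma> f x b \<bullet> b)"
    by (rule divergence_eq[OF conv_has_derivative[OF kernel f]])
  also have "\<dots> = (\<Sum>b\<in>Basis. LINT y|lborel. (\<Gamma> (x - y) \<bullet> b) * (f y \<bullet> b))"
  proof (rule sum.cong[OF refl])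
    fix b :: 'a
    show "conv_deriv \<Gamma> f x b \<bullet> b = (LINT y|lborel. (\<Gamma> (x - y) \<bullet> b) * (f y \<bullet> b))"
      unfolding conv_deriv_def using integral_inner_left[OF integrable_conv_deriv[OF kernel f, of x b], of b] by simp
  qed
  also have "\<dots> = (LINT y|lborel. (\<Sum>b\<in>Basis. (\<Gamma> (x - y) \<bullet> b) * (f y \<bullet> b)))"
    using int by (intro Bochner_Integration.integral_sum[symmetric]) auto
  also have "\<dots> = (LINT y|lborel. \<Gamma> (x - y) \<bullet> f y)"
    by (subst euclidean_inner) simp
  finally show ?thesis .
qed

lemma integrable_conv_grad:
  assumes kernel: "kernel \<rho> \<Gamma> r"
    and f: "integrable lborel f"
  shows "integrable lborel (\<lambda>y. f y *\<^sub>R \<Gamma> (x - y))"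
proof -
  have "(\<lambda>y. f y *\<^sub>R \<Gamma> (x - y)) = (\<lambda>y. \<Sum>b\<in>Basis. ((\<Gamma> (x - y) \<bullet> b) *\<^sub>R f y) *\<^sub>R b)"
  proof
    fix y
    have "f y *\<^sub>R \<Gamma> (x - y) = (\<Sum>b\<in>Basis. (f y *\<^sub>R \<Gamma> (x - y) \<bullet> b) *\<^sub>R b)"
      by (rule euclidean_representation[symmetric])
    then show "f y *\<^sub>R \<Gamma> (x - y) = (\<Sum>b\<in>Basis. ((\<Gamma> (x - y) \<bullet> b) *\<^sub>R f y) *\<^sub>R b)"
      by (simp add: mult.commute)
  qed
  then show ?thesis using integrable_conv_deriv[OF kernel f] by simp
qed

lemma conv_deriv_eq_grad:
  assumes kernel: "kernel \<rho> \<Gamma> r"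
    and f: "integrable lborel f"
  shows "conv_deriv \<Gamma> f x h = conv_grad \<Gamma> f x \<bullet> h"
  unfolding conv_deriv_def conv_grad_def
  by (subst integral_inner_left[symmetric]) (simp_all add: integrable_conv_grad[OF kernel f] mult.commute)

lemma has_gradient_conv:
  assumes kernel: "kernel \<rho> \<Gamma> r"
    and f: "integrable lborel f"
  shows "has_gradient (conv \<rho> f) (conv_grad \<Gamma> f)"
  unfolding has_gradient_def
proof
  have "conv_grad \<Gamma> f = (\<lambda>x. \<Sum>b\<in>Basis. conv_deriv \<Gamma> f x b *\<^sub>R b)"
    by (simp add: conv_deriv_eq_grad[OF kernel f] euclidean_representation)
  then show "continuous_on UNIV (conv_grad \<Gamma> f)"
    by (auto intro!: continuous_intros continuous_conv_deriv[OF kernel f])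
  show "\<forall>x. (conv \<rho> f has_derivative (\<bullet>) (conv_grad \<Gamma> f x)) (at x)"
  proof
    fix x
    have "conv_deriv \<Gamma> f x = (\<bullet>) (conv_grad \<Gamma> f x)" using conv_deriv_eq_grad[OF kernel f] by auto
    then show "(conv \<rho> f has_derivative (\<bullet>) (conv_grad \<Gamma> f x)) (at x)"
      using conv_has_derivative[OF kernel f, of x] by simp
  qed
qed

section \<open>Normalized even kernels\<close>

lemma mollifier_imp_kernel: "mollifier \<rho> \<Gamma> r \<Longrightarrow> kernel \<rho> \<Gamma> r"
  by (simp add: mollifier_def)

lemma mollifier_minus: "mollifier \<rho> \<Gamma> r \<Longrightarrow> \<rho> (- z) = \<rho> z"
  by (simp add: mollifier_def)

lemma mollifier_grad_minus: "mollifier \<rho> \<Gamma> r \<Longrightarrow> \<Gamma> (- z) = - \<Gamma> z"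
  by (simp add: mollifier_def)

lemma mollifier_nonneg: "mollifier \<rho> \<Gamma> r \<Longrightarrow> \<rho> z \<ge> 0"
  by (simp add: mollifier_def)

lemma mollifier_integral: "mollifier \<rho> \<Gamma> r \<Longrightarrow> (LINT z|lborel. \<rho> z) = 1"
  by (simp add: mollifier_def)

lemma mollifier_integral_shift:
  assumes mollifier: "mollifier \<rho> \<Gamma> r"
  shows "(LINT y|lborel. \<rho> (x - y)) = 1"
proof -
  have "(LINT y|lborel. \<rho> (x - y)) = (LINT y|lborel. \<rho> (- x + y))"
    using mollifier_minus[OF mollifier, of "- x + y" for y] by simp
  also have "\<dots> = (LINT z|lborel. \<rho> z)"
    by (rule lborel_integral_translation) (simp add: borel_measurable_continuous_onI kernel_continuous[OF mollifier_imp_kernel[OF mollifier]])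
  finally show ?thesis using mollifier_integral[OF mollifier] by simp
qed

lemma mollifier_integrable_shift:
  assumes mollifier: "mollifier \<rho> \<Gamma> r"
  shows "integrable lborel (\<lambda>y. \<rho> (x - y))"
  \<comment> \<open>A nonintegrable function has integral 0 by convention, so the value 1 forces
    integrability.\<close>
  using mollifier_integral_shift[OF mollifier, of x] not_integrable_integral_eq by fastforce

text \<open>Convolving the field \<open>-\<nabla>u / |\<nabla>u|\<close>, cut off outside a ball, for the mollification \<open>u\<close>
  of the indicator function of \<open>E\<close>, gives a competitor for the perimeter of \<open>E\<close>.\<close>

lemma integral_norm_conv_grad_le_perimeter:
  assumes mollifier: "mollifier \<rho> \<Gamma> r"
    and E: "E \<in> sets borel" "emeasure lborel E < \<infinity>"
  shows "ereal (LINT x|lborel. indicator (ball 0 R) x * norm (conv_grad \<Gamma> (indicator E) x)) \<le> perimeter E"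
proof -
  note kernel = mollifier_imp_kernel[OF mollifier]
  define U where "U = conv_grad \<Gamma> (indicator E)"
  have intE: "integrable lborel (indicator E :: 'a \<Rightarrow> real)" using E by (simp add: integrable_indicator_iff)
  have Uc: "continuous_on UNIV U" using has_gradient_conv[OF kernel intE] by (simp add: U_def has_gradient_def)
  then have [measurable]: "U \<in> borel_measurable borel" by (rule borel_measurable_continuous_onI)
  have [measurable]: "\<Gamma> \<in> borel_measurable borel" by (rule borel_measurable_continuous_onI[OF kernel_grad_continuous[OF kernel]])
  \<comment> \<open>\<open>sgn\<close> is 0 where the gradient vanishes, so \<open>\<psi>\<close> is
    bounded by 1 everywhere. The cutoff to \<open>ball 0 R\<close> makes it integrable and gives its
    mollification compact support.\<close>
  define \<psi> where "\<psi> y = indicator (ball 0 R) y *\<^sub>R (- sgn (U y))" for y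
  have [measurable]: "\<psi> \<in> borel_measurable borel"
    unfolding \<psi>_def[abs_def] sgn_div_norm
    by (intro borel_measurable_scaleR borel_measurable_uminus borel_measurable_indicator
        borel_measurable_inverse borel_measurable_norm) auto
  have \<psi>1: "norm (\<psi> y) \<le> 1" for y by (simp add: \<psi>_def norm_sgn indicator_def)
  have \<psi>0: "\<psi> y = 0" if "y \<notin> ball 0 R" for y using that by (simp add: \<psi>_def)
  have finB: "emeasure lborel (ball (0::'a) R) < \<infinity>" by (rule emeasure_lborel_ball_finite)
  have int\<psi>: "integrable lborel \<psi>"
    by (rule integrableI_bounded_set[OF _ _ finB, of _ 1]) (use \<psi>1 \<psi>0 in auto)
  define \<phi> where "\<phi> = conv \<rho> \<psi>"
  have C1: "C1_vector_field \<phi>" unfolding \<phi>_def by (rule C1_vector_field_conv[OF kernel int\<psi>])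
  have supp: "\<phi> x = 0" if "norm x > R + r" for x
  proof -
    have "\<rho> (x - y) *\<^sub>R \<psi> y = 0" for y
    proof (cases "y \<in> ball 0 R")
      case True
      then have "norm (x - y) \<ge> r" using that norm_triangle_ineq2[of x y] by auto
      then show ?thesis by (simp add: kernel_eq_0[OF kernel])
    qed (simp add: \<psi>0)
    then have "(\<lambda>y. \<rho> (x - y) *\<^sub>R \<psi> y) = (\<lambda>y. 0)" by (rule ext)
    then show ?thesis unfolding \<phi>_def conv_def by (simp only:) simp
  qed
  have "compact (closure {x. \<phi> x \<noteq> 0})"
  proof -
    have "{x. \<phi> x \<noteq> 0} \<subseteq> cball 0 (R + r)" using supp by (auto simp: not_less[symmetric])
    then show ?thesis using bounded_subset bounded_cball compact_closure by blast
  qed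
  moreover have "norm (\<phi> x) \<le> 1" for x
  proof -
    have "norm (\<phi> x) \<le> (LINT y|lborel. \<rho> (x - y))"
      unfolding \<phi>_def conv_def
    proof (rule Bochner_Integration.integral_norm_bound_integral[OF integrable_conv[OF kernel int\<psi>] mollifier_integrable_shift[OF mollifier]])
      show "norm (\<rho> (x - y) *\<^sub>R \<psi> y) \<le> \<rho> (x - y)" for y
        using \<psi>1[of y] mollifier_nonneg[OF mollifier, of "x - y"] by (simp add: mult_left_le)
    qed
    then show ?thesis by (simp add: mollifier_integral_shift[OF mollifier])
  qed
  ultimately have adm: "\<phi> \<in> {\<phi>. C1c_vector_field \<phi> \<and> (AE x in lebesgue. norm (\<phi> x) \<le> 1)}"
    using C1 by (simp add: C1c_vector_field_def)
  obtain B where B: "\<And>z. norm (\<Gamma> z) \<le> B"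
  proof -
    have "compact (\<Gamma> ` cball 0 r)" using kernel_grad_continuous[OF kernel] by (intro compact_continuous_image continuous_on_subset[OF kernel_grad_continuous[OF kernel]]) auto
    then obtain B where B: "\<And>z. z \<in> cball 0 r \<Longrightarrow> norm (\<Gamma> z) \<le> B"
      using compact_imp_bounded bounded_iff by (metis imageI)
    have "norm (\<Gamma> z) \<le> \<bar>B\<bar>" for z
      using B[of z] kernel_grad_eq_0[OF kernel, of z] by (cases "norm z \<le> r") auto
    then show ?thesis by (rule that)
  qed
  \<comment> \<open>Fubini is justified by boundedness: the integrand is at most \<open>B\<close> on
    a product of sets of finite measure and vanishes outside it.\<close>
  have int2: "integrable (lborel \<Otimes>\<^sub>M lborel) (\<lambda>(x, y). indicator E x * (\<Gamma> (x - y) \<bullet> \<psi> y))"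
  proof (rule integrableI_bounded_set[where A="E \<times> ball 0 R" and B="B"])
    show "E \<times> ball 0 R \<in> sets (lborel \<Otimes>\<^sub>M lborel)" using E by (intro pair_measureI) auto
    show "emeasure (lborel \<Otimes>\<^sub>M lborel) (E \<times> ball (0::'a) R) < \<infinity>"
      using E finB by (subst lborel.emeasure_pair_measure_Times) (auto simp: ennreal_mult_less_top)
    show "(\<lambda>(x, y). indicator E x * (\<Gamma> (x - y) \<bullet> \<psi> y)) \<in> borel_measurable (lborel \<Otimes>\<^sub>M lborel)"
      using E(1) by measurable
    have "\<bar>\<Gamma> (x - y) \<bullet> \<psi> y\<bar> \<le> B" for x y
    proof -
      have "\<bar>\<Gamma> (x - y) \<bullet> \<psi> y\<bar> \<le> norm (\<Gamma> (x - y)) * norm (\<psi> y)" by (rule Cauchy_Schwarz_ineq2)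
      also have "\<dots> \<le> norm (\<Gamma> (x - y))" using \<psi>1 by (simp add: mult_left_le)
      finally show ?thesis using B order_trans by blast
    qed
    then show "AE z in lborel \<Otimes>\<^sub>M lborel. z \<in> E \<times> ball 0 R \<longrightarrow> norm (case z of (x, y) \<Rightarrow> indicator E x * (\<Gamma> (x - y) \<bullet> \<psi> y)) \<le> B"
      by (auto simp: indicator_def)
    show "AE z in lborel \<Otimes>\<^sub>M lborel. z \<notin> E \<times> ball 0 R \<longrightarrow> (case z of (x, y) \<Rightarrow> indicator E x * (\<Gamma> (x - y) \<bullet> \<psi> y)) = 0"
    proof (rule AE_I2, rule impI)
      fix z :: "'a \<times> 'a" assume z: "z \<notin> E \<times> ball 0 R"
      obtain x y where xy: "z = (x, y)" by (cases z)
      then consider "x \<notin> E" | "y \<notin> ball 0 R" using z by auto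
      then show "(case z of (x, y) \<Rightarrow> indicator E x * (\<Gamma> (x - y) \<bullet> \<psi> y)) = 0"
        by cases (simp_all add: xy \<psi>0)
    qed
  qed
  have "(LINT x:E|lebesgue. divergence \<phi> x) = (LINT x|lborel. indicator E x * divergence \<phi> x)"
    by (rule set_lebesgue_integral_borel) (use E C1 continuous_on_divergence C1_vector_field_continuous borel_measurable_continuous_onI in auto)
  also have "\<dots> = (LINT x|lborel. LINT y|lborel. indicator E x * (\<Gamma> (x - y) \<bullet> \<psi> y))"
    unfolding \<phi>_def divergence_conv[OF kernel int\<psi>] by simp
  also have "\<dots> = (LINT y|lborel. LINT x|lborel. indicator E x * (\<Gamma> (x - y) \<bullet> \<psi> y))"
    by (rule lborel_pair.Fubini_integral[OF int2, symmetric])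
  also have "\<dots> = (LINT y|lborel. indicator (ball 0 R) y * norm (U y))"
  proof (rule Bochner_Integration.integral_cong[OF refl])
    fix y
    \<comment> \<open>Since \<open>\<Gamma>\<close> is odd, exchanging \<open>x\<close> and
      \<open>y\<close> in its argument costs a sign, which the minus sign in \<open>\<psi>\<close>
      absorbs; the inner integral becomes the gradient of the mollified indicator at
      \<open>y\<close>.\<close>
    have "(LINT x|lborel. indicator E x * (\<Gamma> (x - y) \<bullet> \<psi> y)) = (LINT x|lborel. (indicator E x *\<^sub>R \<Gamma> (y - x)) \<bullet> (- \<psi> y))"
      using mollifier_grad_minus[OF mollifier, of "y - x" for x] by simp
    also have "\<dots> = U y \<bullet> (- \<psi> y)"
      unfolding U_def conv_grad_def by (rule integral_inner_left) (simp add: integrable_conv_grad[OF kernel intE])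
    also have "\<dots> = indicator (ball 0 R) y * norm (U y)"
      by (simp add: \<psi>_def sgn_div_norm dot_square_norm power2_eq_square field_simps)
    finally show "(LINT x|lborel. indicator E x * (\<Gamma> (x - y) \<bullet> \<psi> y)) = indicator (ball 0 R) y * norm (U y)" .
  qed
  finally have "(LINT x:E|lebesgue. divergence \<phi> x) = (LINT y|lborel. indicator (ball 0 R) y * norm (U y))" .
  then show ?thesis
    unfolding perimeter_def U_def by (metis SUP_upper[OF adm, of "\<lambda>\<phi>. ereal (LINT x:E|lebesgue. divergence \<phi> x)"])
qed

section \<open>The isoperimetric inequality\<close>

definition isoperimetric_const :: "'a::euclidean_space itself \<Rightarrow> real" where
  "isoperimetric_const _ = DIM('a) * measure lborel (ball (0::'a) 1) powr (1 / DIM('a))"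

definition isoperimetric_bound :: "'a::euclidean_space itself \<Rightarrow> real \<Rightarrow> real" where
  "isoperimetric_bound T m = isoperimetric_const T * m powr (1 - 1 / DIM('a))"

text \<open>First-order form of Brunn-Minkowski: Bernoulli's inequality gives \<open>(\<alpha> +
  \<tau>) ^ d \<ge> \<alpha> ^ d + d * \<tau> * \<alpha> ^ (d - 1)\<close>. The rate is expressed by
  a lower bound \<open>m\<close> for the measure, so that one rate serves all superlevel sets at
  once.\<close>

lemma measure_minkowski_sum_ball_ge:
  fixes A :: "'a::euclidean_space set"
  assumes A: "open A" "bounded A" and t: "t > 0" and m: "0 < m" "m \<le> measure lborel A"
  shows "measure lborel A + t * isoperimetric_bound TYPE('a) m \<le> measure lborel (minkowski_sum A (ball 0 t))"
proof -
  define d where "d = DIM('a)"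
  define \<omega> where "\<omega> = measure lborel (ball (0::'a) 1)"
  define \<alpha> where "\<alpha> = measure lborel A powr (1 / d)"
  define \<tau> where "\<tau> = t * \<omega> powr (1 / d)"
  have d: "d > 0" by (simp add: d_def)
  have \<omega>: "\<omega> > 0" by (simp add: \<omega>_def)
  have ne: "A \<noteq> {}" using m by auto
  have Apos: "measure lborel A > 0" using m by linarith
  then have \<alpha>: "\<alpha> > 0" by (simp add: \<alpha>_def)
  have \<tau>: "\<tau> > 0" using t \<omega> by (simp add: \<tau>_def)
  have "measure lborel (ball (0::'a) t) = t ^ d * \<omega>"
    using content_ball_conv_unit_ball[of t "0::'a"] t by (simp add: d_def \<omega>_def)
  then have ball: "measure lborel (ball (0::'a) t) powr (1 / d) = \<tau>"
    using t \<omega> d by (simp add: powr_mult \<tau>_def powr_powr flip: powr_realpow)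
  have "\<alpha> ^ d = measure lborel A"
    using Apos d by (simp add: \<alpha>_def powr_powr flip: powr_realpow)
  have "\<alpha> ^ d + d * \<tau> * \<alpha> ^ (d - 1) = \<alpha> ^ d * (1 + d * (\<tau> / \<alpha>))"
    using \<alpha> d by (simp add: field_simps power_eq_if)
  also have "\<dots> \<le> \<alpha> ^ d * (1 + \<tau> / \<alpha>) ^ d"
  proof (rule mult_left_mono)
    have "0 < \<tau> / \<alpha>" using \<alpha> \<tau> by simp
    then show "1 + d * (\<tau> / \<alpha>) \<le> (1 + \<tau> / \<alpha>) ^ d" by (intro Bernoulli_inequality) linarith
  qed (use \<alpha> in simp)
  also have "\<dots> = (\<alpha> + \<tau>) ^ d"
  proof -
    have "\<alpha> * (1 + \<tau> / \<alpha>) = \<alpha> + \<tau>" using \<alpha> by (simp add: distrib_left)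
    then show ?thesis by (simp flip: power_mult_distrib)
  qed
  also have "\<dots> = (\<alpha> + \<tau>) powr d" using \<alpha> \<tau> by (simp add: powr_realpow)
  also have "\<dots> \<le> measure lborel (minkowski_sum A (ball 0 t))"
    using Brunn_Minkowski_open[OF A ne, of "ball 0 t"] t ball by (simp add: \<alpha>_def d_def)
  finally have 1: "measure lborel A + d * \<tau> * \<alpha> ^ (d - 1) \<le> measure lborel (minkowski_sum A (ball 0 t))"
    by (simp only: \<open>\<alpha> ^ d = measure lborel A\<close>)
  have "\<alpha> ^ (d - 1) = measure lborel A powr ((1 / d) * real (d - 1))"
    using Apos by (simp add: \<alpha>_def powr_powr flip: powr_realpow)
  also have "(1 / d) * real (d - 1) = 1 - 1 / d" using d by (simp add: of_nat_diff field_simps)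
  finally have "\<alpha> ^ (d - 1) \<ge> m powr (1 - 1 / d)"
    using m d by (simp add: powr_mono2)
  then have "d * \<tau> * m powr (1 - 1 / d) \<le> d * \<tau> * \<alpha> ^ (d - 1)"
    using \<tau> by (intro mult_left_mono) auto
  moreover have "t * isoperimetric_bound TYPE('a) m = d * \<tau> * m powr (1 - 1 / d)"
    by (simp add: isoperimetric_bound_def isoperimetric_const_def \<tau>_def d_def \<omega>_def)
  ultimately show ?thesis using 1 by linarith
qed

text \<open>Brunn--Minkowski bounds the growth of the superlevel sets of \<open>u\<close> under
  enlargement by a ball of radius \<open>t\<close>; integrated over the levels this growth is, up to \<open>o(t)\<close>,
  \<open>t\<close> times the integral of the norm of the gradient, which replaces the coarea formula.\<close>

lemma level_set_inequality:
  fixes u :: "'a::euclidean_space \<Rightarrow> real" and U :: "'a \<Rightarrow> 'a"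
  assumes lin: "\<And>e. e > 0 \<Longrightarrow> \<exists>\<delta>>0. \<forall>x h. norm h < \<delta> \<longrightarrow> \<bar>u (x + h) - u x - U x \<bullet> h\<bar> \<le> e * norm h"
    and uc: "continuous_on UNIV u" and Uc: "continuous_on UNIV U"
    and ab: "a < b" and bd: "\<And>x. u x > a \<Longrightarrow> norm x < R"
    and m: "0 < m" "\<And>s. a < s \<Longrightarrow> s < b \<Longrightarrow> m \<le> measure lborel {x. u x > s}"
  shows "(b - a) * isoperimetric_bound TYPE('a) m \<le> (LINT x|lborel. indicator (ball 0 (R + 1)) x * norm (U x))"
proof -
  define \<kappa> where "\<kappa> = isoperimetric_bound TYPE('a) m"
  have \<kappa>: "\<kappa> \<ge> 0" by (simp add: \<kappa>_def isoperimetric_bound_def isoperimetric_const_def)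
  define B where "B = ball (0::'a) (R + 1)"
  have Bfm: "B \<in> fmeasurable lborel" by (simp add: B_def open_bounded_fmeasurable)
  have [measurable]: "B \<in> sets borel" by (simp add: B_def)
  have Um[measurable]: "U \<in> borel_measurable borel" using Uc by (rule borel_measurable_continuous_onI)
  have um[measurable]: "u \<in> borel_measurable borel" using uc by (rule borel_measurable_continuous_onI)
  have intU: "integrable lborel (\<lambda>x. indicator B x * norm (U x))"
  proof -
    have "compact ((\<lambda>x. norm (U x)) ` cball 0 (R + 1))"
      by (intro compact_continuous_image continuous_intros continuous_on_subset[OF Uc]) auto
    then obtain C where C: "\<And>x. x \<in> cball 0 (R + 1) \<Longrightarrow> norm (norm (U x)) \<le> C"
      using compact_imp_bounded bounded_iff by (metis (no_types, lifting) imageI)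
    have "integrable lborel (\<lambda>x. indicator B x *\<^sub>R norm (U x))"
      by (rule integrableI_bounded_set_indicator[where B=C]) (use Bfm C in \<open>auto simp: B_def fmeasurable_def\<close>)
    then show ?thesis by simp
  qed
  have intB: "integrable lborel (indicator B :: 'a \<Rightarrow> real)" using Bfm by (simp add: fmeasurable_def)
  have main: "(b - a) * \<kappa> \<le> (LINT x|lborel. indicator B x * norm (U x)) + e * measure lborel B" if e: "e > 0" for e
  proof -
    obtain \<delta> where \<delta>: "\<delta> > 0" "\<And>x h. norm h < \<delta> \<Longrightarrow> \<bar>u (x + h) - u x - U x \<bullet> h\<bar> \<le> e * norm h"
      using lin[OF e] by blast
    \<comment> \<open>\<open>t \<le> \<delta>\<close> gives access to the linearization, and
      \<open>t \<le> 1\<close> keeps the enlarged level sets in the ball of radius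
      \<open>R + 1\<close>.\<close>
    define t where "t = min \<delta> 1"
    have t: "t > 0" "t \<le> 1" "t \<le> \<delta>" using \<delta> by (auto simp: t_def)
    \<comment> \<open>\<open>D0\<close> is the region under the graph of \<open>u\<close> between
      the levels \<open>a\<close> and \<open>b\<close>, and \<open>D\<close> is the region obtained
      by enlarging each superlevel set by a ball of radius \<open>t\<close>. Horizontal slices are
      estimated from below by Brunn-Minkowski, vertical slices from above by linearization, and
      Fubini compares the two.\<close>
    define D0 where "D0 = {(x, s). a < s \<and> s < b \<and> s < u x}"
    define D where "D = {(x, s). a < s \<and> s < b \<and> (\<exists>y. dist x y < t \<and> s < u y)}"
    have opD0: "open D0"
    proof -
      have "D0 = {z. a < snd z} \<inter> {z. snd z < b} \<inter> {z. snd z < u (fst z)}" by (auto simp: D0_def)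
      then show ?thesis
        by (auto intro!: open_Int open_Collect_less continuous_intros continuous_on_compose2[OF uc])
    qed
    have opD: "open D"
    proof -
      have "D = (\<Union>y. {z. a < snd z} \<inter> {z. snd z < b} \<inter> {z. dist (fst z) y < t} \<inter> {z. snd z < u y})" by (auto simp: D_def)
      then show ?thesis
        by (auto intro!: open_UN open_Int open_Collect_less continuous_intros)
    qed
    have meas: "indicator D0 \<in> borel_measurable (lborel \<Otimes>\<^sub>M lborel)" "indicator D \<in> borel_measurable (lborel \<Otimes>\<^sub>M (lborel :: real measure))"
      using opD0 opD by (auto intro!: borel_measurable_indicator simp: lborel_prod)
    define F0 where "F0 s = (\<integral>\<^sup>+x. indicator D0 (x, s) \<partial>lborel)" for s :: real
    define F where "F s = (\<integral>\<^sup>+x. indicator D (x, s) \<partial>lborel)" for s :: real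
    have levels: "F0 s + ennreal (t * \<kappa>) * indicator {a<..<b} s \<le> F s" for s
    proof (cases "a < s \<and> s < b")
      case True
      define A where "A = {x. u x > s}"
      have opA: "open A" unfolding A_def by (intro open_Collect_less continuous_intros uc)
      have bdA: "bounded A" unfolding A_def bounded_iff using bd True by (intro exI[of _ R]) (auto intro: less_imp_le)
      have A': "minkowski_sum A (ball 0 t) = {x. \<exists>y. dist x y < t \<and> s < u y}"
      proof (intro set_eqI iffI)
        fix z assume "z \<in> minkowski_sum A (ball 0 t)"
        then obtain x h where "z = x + h" "s < u x" "norm h < t" by (auto simp: minkowski_sum_def A_def)
        then show "z \<in> {x. \<exists>y. dist x y < t \<and> s < u y}" by (auto simp: dist_norm intro!: exI[of _ x])
      next
        fix z assume "z \<in> {x. \<exists>y. dist x y < t \<and> s < u y}"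
        then obtain y where "dist z y < t" "s < u y" by auto
        then have "z = y + (z - y)" "y \<in> A" "z - y \<in> ball 0 t" by (auto simp: dist_norm A_def norm_minus_commute)
        then show "z \<in> minkowski_sum A (ball 0 t)" unfolding minkowski_sum_def by blast
      qed
      have "(\<lambda>x. indicator D0 (x, s) :: ennreal) = indicator A"
        "(\<lambda>x. indicator D (x, s) :: ennreal) = indicator (minkowski_sum A (ball 0 t))"
        unfolding A' using True by (auto simp: D0_def D_def A_def indicator_def)
      then have F: "F0 s = emeasure lborel A" "F s = emeasure lborel (minkowski_sum A (ball 0 t))"
        using opA open_minkowski_sum[of A "ball 0 t"] by (simp_all add: F0_def F_def)
      have "A \<in> fmeasurable lborel" "minkowski_sum A (ball 0 t) \<in> fmeasurable lborel"
        using opA bdA by (auto intro!: open_bounded_fmeasurable open_minkowski_sum bounded_minkowski_sum)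
      then have "F0 s = ennreal (measure lborel A)" "F s = ennreal (measure lborel (minkowski_sum A (ball 0 t)))"
        unfolding F by (simp_all add: emeasure_eq_measure2)
      moreover have "measure lborel A + t * \<kappa> \<le> measure lborel (minkowski_sum A (ball 0 t))"
        unfolding \<kappa>_def using m True by (intro measure_minkowski_sum_ball_ge opA bdA t) (auto simp: A_def)
      ultimately show ?thesis
        using True t \<kappa> by (simp flip: ennreal_plus add: ennreal_leI)
    next
      case False
      then have "indicator D0 (x, s) = (0::ennreal)" for x by (auto simp: D0_def)
      then show ?thesis using False by (simp add: F0_def)
    qed
    have slices: "(\<integral>\<^sup>+s. indicator D (x, s) \<partial>lborel) \<le> (\<integral>\<^sup>+s. indicator D0 (x, s) \<partial>lborel) + ennreal (t * (indicator B x * norm (U x) + e * indicator B x))" for x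
    proof -
      \<comment> \<open>By the linearization, \<open>u\<close> exceeds \<open>u x\<close> by at most
        \<open>w\<close> within distance \<open>t\<close> of \<open>x\<close>; so the vertical slice
        of \<open>D\<close> over \<open>x\<close> exceeds that of \<open>D0\<close> by an interval
        of length at most \<open>w\<close>.\<close>
      define w where "w = t * (norm (U x) + e)"
      have w: "w \<ge> 0" using t e by (simp add: w_def)
      have "indicator D (x, s) \<le> (indicator D0 (x, s) :: ennreal) + indicator B x * indicator {u x..u x + w} s" for s
      proof (cases "(x, s) \<in> D")
        case True
        then obtain y where y: "a < s" "s < b" "dist x y < t" "s < u y" by (auto simp: D_def)
        have "norm y < R" using bd y by auto
        then have "x \<in> B" using y t norm_triangle_sub[of x y] by (simp add: B_def dist_norm)
        have n: "norm (y - x) < t" using y by (simp add: dist_norm norm_minus_commute)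
        then have "\<bar>u y - u x - U x \<bullet> (y - x)\<bar> \<le> e * norm (y - x)"
          using \<delta>(2)[of "y - x" x] t by simp
        moreover have "e * norm (y - x) \<le> e * t" using n e by simp
        moreover have "U x \<bullet> (y - x) \<le> norm (U x) * t"
        proof -
          have "U x \<bullet> (y - x) \<le> norm (U x) * norm (y - x)" by (rule norm_cauchy_schwarz)
          also have "\<dots> \<le> norm (U x) * t" using n by (intro mult_left_mono) auto
          finally show ?thesis .
        qed
        ultimately have "u y \<le> u x + w" by (simp add: w_def algebra_simps)
        then have "s < u x \<or> s \<in> {u x..u x + w}" using y by auto
        then show ?thesis using y \<open>x \<in> B\<close> True by (auto simp: D0_def indicator_def)
      qed simp
      then have "(\<integral>\<^sup>+s. indicator D (x, s) \<partial>lborel) \<le> (\<integral>\<^sup>+s. indicator D0 (x, s) + indicator B x * indicator {u x..u x + w} s \<partial>lborel)"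
        by (intro nn_integral_mono)
      also have "\<dots> = (\<integral>\<^sup>+s. indicator D0 (x, s) \<partial>lborel) + (\<integral>\<^sup>+s. indicator B x * indicator {u x..u x + w} s \<partial>lborel)"
        using measurable_compose[OF measurable_Pair1'[of x lborel lborel] meas(1)] by (intro nn_integral_add) auto
      also have "(\<integral>\<^sup>+s. indicator B x * indicator {u x..u x + w} s \<partial>lborel) = indicator B x * ennreal w"
        using w by (subst nn_integral_cmult_indicator) auto
      also have "indicator B x * ennreal w = ennreal (t * (indicator B x * norm (U x) + e * indicator B x))"
        by (simp add: indicator_def w_def)
      finally show ?thesis .
    qed
    \<comment> \<open>Finiteness is what permits cancelling the integral of \<open>F0\<close> from
      both sides in the extended nonnegative reals.\<close>
    have F0_fin: "(\<integral>\<^sup>+s. F0 s \<partial>lborel) < \<infinity>"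
    proof -
      have "F0 s \<le> emeasure lborel B * indicator {a..b} s" for s
      proof -
        have "indicator D0 (x, s) \<le> (indicator B x * indicator {a..b} s :: ennreal)" for x
          using bd[of x] by (auto simp: D0_def B_def indicator_def)
        then have "F0 s \<le> (\<integral>\<^sup>+x. indicator B x * indicator {a..b} s \<partial>lborel)"
          unfolding F0_def by (intro nn_integral_mono)
        also have "\<dots> = emeasure lborel B * indicator {a..b} s"
          using Bfm by (simp add: nn_integral_multc fmeasurableD)
        finally show ?thesis .
      qed
      then have "(\<integral>\<^sup>+s. F0 s \<partial>lborel) \<le> (\<integral>\<^sup>+s. emeasure lborel B * indicator {a..b} s \<partial>lborel)"
        by (intro nn_integral_mono)
      also have "\<dots> = emeasure lborel B * emeasure lborel {a..b}"
        by (rule nn_integral_cmult_indicator) simp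
      also have "\<dots> < \<infinity>" using Bfm ab by (simp add: ennreal_mult_less_top fmeasurable_def)
      finally show ?thesis .
    qed
    have F0m: "F0 \<in> borel_measurable lborel"
    proof -
      have "(\<lambda>(s, x). indicator D0 (x, s) :: ennreal) \<in> borel_measurable (lborel \<Otimes>\<^sub>M lborel)"
        using measurable_compose[OF measurable_pair_swap' meas(1)] by (simp add: case_prod_beta')
      from lborel.borel_measurable_nn_integral[OF this] show ?thesis
        by (simp add: F0_def[abs_def])
    qed
    have "(\<integral>\<^sup>+s. F0 s \<partial>lborel) + ennreal (t * \<kappa>) * ennreal (b - a)
       = (\<integral>\<^sup>+s. F0 s + ennreal (t * \<kappa>) * indicator {a<..<b} s \<partial>lborel)"
      using F0m ab by (simp add: nn_integral_add nn_integral_cmult_indicator)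
    also have "\<dots> \<le> (\<integral>\<^sup>+s. F s \<partial>lborel)" by (intro nn_integral_mono levels)
    also have "\<dots> = (\<integral>\<^sup>+x. (\<integral>\<^sup>+s. indicator D (x, s) \<partial>lborel) \<partial>lborel)"
      unfolding F_def by (rule lborel_pair.Fubini[OF meas(2)])
    also have "\<dots> \<le> (\<integral>\<^sup>+x. (\<integral>\<^sup>+s. indicator D0 (x, s) \<partial>lborel) + ennreal (t * (indicator B x * norm (U x) + e * indicator B x)) \<partial>lborel)"
      by (intro nn_integral_mono slices)
    also have "\<dots> = (\<integral>\<^sup>+x. (\<integral>\<^sup>+s. indicator D0 (x, s) \<partial>lborel) \<partial>lborel) + (\<integral>\<^sup>+x. ennreal (t * (indicator B x * norm (U x) + e * indicator B x)) \<partial>lborel)"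
      by (rule nn_integral_add[OF lborel.borel_measurable_nn_integral_fst[OF meas(1)]]) measurable
    also have "(\<integral>\<^sup>+x. (\<integral>\<^sup>+s. indicator D0 (x, s) \<partial>lborel) \<partial>lborel) = (\<integral>\<^sup>+s. F0 s \<partial>lborel)"
      unfolding F0_def by (rule lborel_pair.Fubini[OF meas(1), symmetric])
    also have "(\<integral>\<^sup>+x. ennreal (t * (indicator B x * norm (U x) + e * indicator B x)) \<partial>lborel)
       = ennreal (LINT x|lborel. t * (indicator B x * norm (U x) + e * indicator B x))"
      using t e intU intB by (intro nn_integral_eq_integral) auto
    finally have "ennreal (t * \<kappa>) * ennreal (b - a) \<le> ennreal (LINT x|lborel. t * (indicator B x * norm (U x) + e * indicator B x))"
      using F0_fin by (auto simp: ennreal_add_left_cancel_le)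
    moreover have "(LINT x|lborel. t * (indicator B x * norm (U x) + e * indicator B x)) = t * ((LINT x|lborel. indicator B x * norm (U x)) + e * measure lborel B)"
      using intU intB by simp
    moreover have "ennreal (t * \<kappa>) * ennreal (b - a) = ennreal (t * ((b - a) * \<kappa>))"
      using t \<kappa> ab by (simp flip: ennreal_mult add: mult_ac)
    moreover have "0 \<le> (LINT x|lborel. indicator B x * norm (U x)) + e * measure lborel B"
      using e by (intro add_nonneg_nonneg integral_nonneg_AE) auto
    ultimately have "t * ((b - a) * \<kappa>) \<le> t * ((LINT x|lborel. indicator B x * norm (U x)) + e * measure lborel B)"
      using t by simp
    then show ?thesis using t by simp
  qed
  have "(b - a) * \<kappa> \<le> (LINT x|lborel. indicator B x * norm (U x))"
  proof (rule field_le_epsilon)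
    fix e :: real assume e: "e > 0"
    have M: "measure lborel B + 1 > 0" using measure_nonneg[of lborel B] by linarith
    have "e / (measure lborel B + 1) * measure lborel B \<le> e"
      using pos_divide_le_eq[OF M, of "e * measure lborel B" e] e by (simp add: distrib_left)
    moreover have "e / (measure lborel B + 1) > 0" using e M by (rule divide_pos_pos)
    ultimately show "(b - a) * \<kappa> \<le> (LINT x|lborel. indicator B x * norm (U x)) + e"
      using main[of "e / (measure lborel B + 1)"] by linarith
  qed
  then show ?thesis unfolding \<kappa>_def B_def .
qed

section \<open>Construction of mollifiers and approximation of indicator functions\<close>

lemma has_gradient_scale:
  assumes "has_gradient f G"
  shows "has_gradient (\<lambda>x. k * f x) (\<lambda>x. k *\<^sub>R G x)"
  unfolding has_gradient_def
proof
  show "continuous_on UNIV (\<lambda>x. k *\<^sub>R G x)"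
    using assms unfolding has_gradient_def by (auto intro!: continuous_intros)
  show "\<forall>x. ((\<lambda>x. k * f x) has_derivative (\<bullet>) (k *\<^sub>R G x)) (at x)"
  proof
    fix x
    have "(\<bullet>) (k *\<^sub>R G x) = (\<lambda>h. k * (G x \<bullet> h))" by auto
    then show "((\<lambda>x. k * f x) has_derivative (\<bullet>) (k *\<^sub>R G x)) (at x)"
      using has_derivative_mult_right[of f "(\<bullet>) (G x)" "at x" k] assms by (simp add: has_gradient_def)
  qed
qed

lemma exists_mollifier:
  assumes "r > 0"
  shows "\<exists>\<rho> \<Gamma>. mollifier \<rho> (\<Gamma> :: 'a::euclidean_space \<Rightarrow> 'a) r"
proof -
  have r: "0 \<le> r / 2" "r / 2 < r" using assms by auto
  define g where "g = (bump (r/2) r :: 'a \<Rightarrow> real)"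
  define G where "G = (bump_grad (r/2) r :: 'a \<Rightarrow> 'a)"
  have g: "has_gradient g G" unfolding g_def G_def by (rule has_gradient_bump[OF r])
  have g0: "\<And>z. norm z \<ge> r \<Longrightarrow> g z = 0" and G0: "\<And>z. norm z \<ge> r \<Longrightarrow> G z = 0"
    unfolding g_def G_def by (auto intro!: bump_eq_0[OF r] bump_grad_eq_0[OF r])
  define I where "I = (LINT z|lborel. g z)"
  have intg: "integrable lborel g"
    by (rule integrable_compact_support[OF has_gradient_continuous[OF g] g0])
  \<comment> \<open>The cutoff is 1 on the ball of radius \<open>r/2\<close>, so the normalizing
    constant \<open>I\<close> is positive.\<close>
  have "measure lborel (ball (0::'a) (r/2)) = (LINT z|lborel. indicator (ball (0::'a) (r/2)) z)" by simp
  also have "\<dots> \<le> I"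
    unfolding I_def
  proof (rule integral_mono[OF _ intg])
    show "integrable lborel (indicator (ball (0::'a) (r/2)) :: 'a \<Rightarrow> real)"
      using emeasure_lborel_ball_finite[of "0::'a" "r/2"] by (simp add: integrable_indicator_iff)
    show "indicator (ball 0 (r/2)) z \<le> g z" for z
      using bump_nonneg[of _ _ z] bump_le_1[of _ _ z] bump_eq_1[OF r, of z] by (auto simp: indicator_def g_def)
  qed
  finally have I: "I > 0" using assms content_ball_gt_0_iff[of "0::'a" "r/2"] by linarith
  have "mollifier (\<lambda>z. inverse I * g z) (\<lambda>z. inverse I *\<^sub>R G z) r"
    unfolding mollifier_def kernel_def
  proof (intro conjI allI impI)
    show "has_gradient (\<lambda>z. inverse I * g z) (\<lambda>z. inverse I *\<^sub>R G z)"
      by (rule has_gradient_scale[OF g])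
    show "(LINT z|lborel. inverse I * g z) = 1" using I by (simp add: I_def)
    show "inverse I * g z \<ge> 0" for z using I bump_nonneg[of _ _ z] bump_le_1[of _ _ z] by (simp add: g_def)
    show "inverse I * g z = 0" "inverse I *\<^sub>R G z = 0" if "r \<le> norm z" for z
      using that by (simp_all add: g0 G0)
    show "inverse I * g (- z) = inverse I * g z" for z by (simp add: g_def bump_minus)
    show "inverse I *\<^sub>R G (- z) = - (inverse I *\<^sub>R G z)" for z by (simp add: G_def bump_grad_minus)
  qed
  then show ?thesis by blast
qed

text \<open>Two losses make up \<open>\<delta>\<^sup>2 + \<delta>\<close>. Choose an open
  \<open>W\<close> containing \<open>E\<close> with little excess, and let \<open>K n\<close>
  consist of the points of \<open>E\<close> at distance at least \<open>1 / (n + 1)\<close> from the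
  complement of \<open>W\<close>; these sets exhaust \<open>E\<close>, and one of them misses less
  than \<open>\<delta>\<^sup>2\<close> of its measure. With a kernel of that radius,
  \<open>1 - u x\<close> at a point of \<open>K n\<close> is the kernel mass of \<open>W - E\<close>
  around \<open>x\<close>, so by Chebyshev's inequality \<open>u\<close> exceeds
  \<open>1 - \<delta>\<close> on \<open>K n\<close> outside a set of measure less than
  \<open>\<delta>\<close>.\<close>

lemma mollified_indicator:
  fixes E :: "'a::euclidean_space set"
  assumes E[measurable]: "E \<in> sets borel" and fin: "emeasure lborel E < \<infinity>" and \<delta>: "0 < \<delta>" "\<delta> < 1/2"
  shows "\<exists>\<rho> \<Gamma> r R. mollifier \<rho> (\<Gamma> :: 'a \<Rightarrow> 'a) r \<and>
     (\<forall>x. conv \<rho> (indicator E) x > \<delta> \<longrightarrow> norm x < R) \<and>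
     (\<forall>s. \<delta> < s \<longrightarrow> s < 1 - \<delta> \<longrightarrow> measure lborel E - \<delta>\<^sup>2 - \<delta> \<le> measure lborel {x. conv \<rho> (indicator E) x > (s::real)})"
proof -
  have Efm: "E \<in> fmeasurable lborel" using E fin by (intro fmeasurableI) auto
  have "\<delta>\<^sup>2 > 0" using \<delta> by simp
  \<comment> \<open>The excess is \<open>\<delta>\<^sup>2\<close> because Chebyshev's inequality at
    height \<open>\<delta>\<close> divides it by \<open>\<delta>\<close>.\<close>
  then obtain W where W: "open W" "E \<subseteq> W" "emeasure lborel (W - E) < ennreal (\<delta>\<^sup>2)"
    using outer_regular_lborel[OF E] by blast
  define K where "K n = E \<inter> {x. \<forall>y\<in>-W. inverse (real (Suc n)) \<le> dist x y}" for n
  have Kb: "K n \<in> sets borel" for n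
  proof -
    have "{x. \<forall>y\<in>-W. inverse (real (Suc n)) \<le> dist x y} = (\<Inter>y\<in>-W. {x. inverse (real (Suc n)) \<le> dist x y})" by auto
    also have "closed \<dots>" by (intro closed_INT ballI closed_Collect_le continuous_intros)
    finally show ?thesis unfolding K_def using E by (intro sets.Int) auto
  qed
  have "(\<Union>n. K n) = E"
  proof (intro subset_antisym subsetI)
    fix x assume x: "x \<in> E"
    then obtain e where e: "e > 0" "ball x e \<subseteq> W" using W openE by blast
    obtain n where n: "inverse (real (Suc n)) < e" using reals_Archimedean[OF e(1)] by auto
    have "e \<le> dist x y" if "y \<in> -W" for y using e that by (force simp: subset_iff not_less[symmetric])
    then have "x \<in> K n" using x n unfolding K_def by force
    then show "x \<in> (\<Union>n. K n)" by blast
  qed (auto simp: K_def)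
  moreover have "(\<lambda>n. measure lborel (K n)) \<longlonglongrightarrow> measure lborel (\<Union>n. K n)"
  proof (rule Lim_measure_incseq)
    show "range K \<subseteq> sets lborel" using Kb by auto
    show "incseq K"
    proof (rule incseq_SucI)
      fix n
      have le: "inverse (real (Suc (Suc n))) \<le> inverse (real (Suc n))" by (intro le_imp_inverse_le) auto
      show "K n \<le> K (Suc n)" unfolding K_def using order_trans[OF le] by blast
    qed
    show "emeasure lborel (\<Union>n. K n) \<noteq> \<infinity>" unfolding calculation using fin by simp
  qed
  ultimately have "(\<lambda>n. measure lborel (K n)) \<longlonglongrightarrow> measure lborel E" by simp
  from order_tendstoD(1)[OF this, of "measure lborel E - \<delta>\<^sup>2"] \<delta>
  obtain n where n: "measure lborel E - \<delta>\<^sup>2 < measure lborel (K n)"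
    by (auto simp: eventually_sequentially)
  define r where "r = inverse (real (Suc n))"
  have r: "r > 0" by (simp add: r_def)
  have Kr: "ball x r \<subseteq> W" if "x \<in> K n" for x using that unfolding K_def r_def by (force simp: not_le)
  obtain \<rho> and \<Gamma> :: "'a \<Rightarrow> 'a" where moll: "mollifier \<rho> \<Gamma> r" using exists_mollifier[OF r] by blast
  note kern = mollifier_imp_kernel[OF moll]
  have intE: "integrable lborel (indicator E :: 'a \<Rightarrow> real)" using fin by (simp add: integrable_indicator_iff)
  define u where "u = conv \<rho> (indicator E :: 'a \<Rightarrow> real)"
  have u: "u x = (LINT y|lborel. \<rho> (x - y) * indicator E y)" for x by (simp add: u_def conv_def)
  have uc: "continuous_on UNIV u" unfolding u_def by (rule has_gradient_continuous[OF has_gradient_conv[OF kern intE]])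
  then have [measurable]: "u \<in> borel_measurable borel" by (rule borel_measurable_continuous_onI)
  have [measurable]: "\<rho> \<in> borel_measurable borel" using kernel_continuous[OF kern] by (rule borel_measurable_continuous_onI)
  have intu: "integrable lborel (\<lambda>y. \<rho> (x - y) * indicator E y)" for x
    using integrable_conv[OF kern intE, of x] by simp
  \<comment> \<open>\<open>E\<close> may be unbounded, but the part of it outside a large ball has
    small measure, and the kernel is bounded; so \<open>u\<close> is at most \<open>\<delta>\<close>
    far from the origin.\<close>
  obtain R where R: "\<And>x. u x > \<delta> \<Longrightarrow> norm x < R"
  proof -
    have "compact (\<rho> ` cball 0 r)" using kernel_continuous[OF kern] by (intro compact_continuous_image continuous_on_subset[OF kernel_continuous[OF kern]]) auto
    then obtain C where C: "\<And>z. z \<in> cball 0 r \<Longrightarrow> norm (\<rho> z) \<le> C"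
      using compact_imp_bounded bounded_iff by (metis imageI)
    have C': "\<rho> z \<le> \<bar>C\<bar> + 1" for z
      using C[of z] kernel_eq_0[OF kern, of z] by (cases "norm z \<le> r") auto
    define A where "A k = E - ball 0 (real k)" for k :: nat
    have "(\<lambda>k. measure lborel (A k)) \<longlonglongrightarrow> measure lborel (\<Inter>k. A k)"
    proof (rule Lim_measure_decseq)
      show "decseq A" unfolding A_def decseq_def by auto
      show "emeasure lborel (A k) \<noteq> \<infinity>" for k
        using emeasure_mono[of "A k" E lborel] fin by (auto simp: A_def top_unique)
    qed (auto simp: A_def)
    moreover have "(\<Inter>k. A k) = {}"
    proof -
      have "\<exists>k. x \<notin> A k" for x using reals_Archimedean2[of "norm x"] by (auto simp: A_def)
      then show ?thesis by blast
    qed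
    ultimately have "(\<lambda>k. measure lborel (A k)) \<longlonglongrightarrow> 0" by simp
    moreover have "\<delta> / (\<bar>C\<bar> + 1) > 0" using \<delta> by simp
    ultimately obtain k where k: "measure lborel (A k) < \<delta> / (\<bar>C\<bar> + 1)"
      using order_tendstoD(2) by (fastforce simp: eventually_sequentially)
    have [measurable]: "A k \<in> sets borel" unfolding A_def by measurable
    have "norm x < real k + r" if x: "u x > \<delta>" for x
    proof (rule ccontr)
      assume far: "\<not> norm x < real k + r"
      have "emeasure lborel (A k) < \<infinity>"
        using emeasure_mono[of "A k" E lborel] fin by (auto simp: A_def top_unique less_top)
      then have "integrable lborel (indicator (A k) :: 'a \<Rightarrow> real)" by (simp add: integrable_indicator_iff)
      then have "u x \<le> (LINT y|lborel. (\<bar>C\<bar> + 1) * indicator (A k) y)"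
        unfolding u
      proof (intro integral_mono intu integrable_mult_right)
        fix y
        show "\<rho> (x - y) * indicator E y \<le> (\<bar>C\<bar> + 1) * indicator (A k) y"
        proof (cases "norm y < real k")
          case True
          then have "norm (x - y) \<ge> r" using far norm_triangle_ineq2[of x y] by linarith
          then show ?thesis by (simp add: kernel_eq_0[OF kern])
        next
          case False
          then show ?thesis using C' by (auto simp: A_def indicator_def)
        qed
      qed
      also have "\<dots> = (\<bar>C\<bar> + 1) * measure lborel (A k)" by simp
      also have "\<dots> < \<delta>" using k by (simp add: field_simps)
      finally show False using x by simp
    qed
    then show ?thesis by (rule that)
  qed
  \<comment> \<open>The exceptional set in Chebyshev's inequality. Exchanging the integrals below
    uses that the kernel has total mass 1 in \<open>x\<close> as well, by evenness.\<close>
  define S where "S = {x \<in> K n. u x \<le> 1 - \<delta>}"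
  have Sb[measurable]: "S \<in> sets borel" using Kb[of n] unfolding S_def by measurable
  have [measurable]: "W \<in> sets borel" using W by simp
  have "ennreal \<delta> * emeasure lborel S = (\<integral>\<^sup>+x. ennreal \<delta> * indicator S x \<partial>lborel)"
    by (simp add: nn_integral_cmult_indicator)
  also have "\<dots> \<le> (\<integral>\<^sup>+x. (\<integral>\<^sup>+y. ennreal (\<rho> (x - y)) * indicator (W - E) y \<partial>lborel) \<partial>lborel)"
  proof (rule nn_integral_mono)
    fix x
    show "ennreal \<delta> * indicator S x \<le> (\<integral>\<^sup>+y. ennreal (\<rho> (x - y)) * indicator (W - E) y \<partial>lborel)"
    proof (cases "x \<in> S")
      case True
      then have x: "x \<in> K n" "\<delta> \<le> 1 - u x" by (auto simp: S_def)
      have int1E: "integrable lborel (\<lambda>y. \<rho> (x - y) - \<rho> (x - y) * indicator E y)"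
        by (intro Bochner_Integration.integrable_diff mollifier_integrable_shift[OF moll] intu)
      have "1 - u x = (LINT y|lborel. \<rho> (x - y) - \<rho> (x - y) * indicator E y)"
        unfolding u by (subst Bochner_Integration.integral_diff) (simp_all add: mollifier_integrable_shift[OF moll] intu mollifier_integral_shift[OF moll])
      then have "ennreal (1 - u x) = (\<integral>\<^sup>+y. ennreal (\<rho> (x - y) - \<rho> (x - y) * indicator E y) \<partial>lborel)"
        using nn_integral_eq_integral[OF int1E] mollifier_nonneg[OF moll] by (simp add: indicator_def)
      also have "\<dots> \<le> (\<integral>\<^sup>+y. ennreal (\<rho> (x - y)) * indicator (W - E) y \<partial>lborel)"
      proof (rule nn_integral_mono)
        fix y
        show "ennreal (\<rho> (x - y) - \<rho> (x - y) * indicator E y) \<le> ennreal (\<rho> (x - y)) * indicator (W - E) y"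
        proof (cases "y \<in> E \<or> norm (x - y) \<ge> r")
          case True then show ?thesis by (auto simp: kernel_eq_0[OF kern])
        next
          case False
          then have "y \<in> ball x r" by (simp add: dist_norm)
          then have "y \<in> W" using Kr[OF x(1)] by auto
          then show ?thesis using False by simp
        qed
      qed
      finally have "ennreal (1 - u x) \<le> (\<integral>\<^sup>+y. ennreal (\<rho> (x - y)) * indicator (W - E) y \<partial>lborel)" .
      then show ?thesis using True order_trans[OF ennreal_leI[OF x(2)]] by simp
    qed simp
  qed
  also have "\<dots> = (\<integral>\<^sup>+y. (\<integral>\<^sup>+x. ennreal (\<rho> (x - y)) * indicator (W - E) y \<partial>lborel) \<partial>lborel)"
    by (rule lborel_pair.Fubini') measurable
  also have "\<dots> = (\<integral>\<^sup>+y. indicator (W - E) y \<partial>lborel)"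
  proof (rule nn_integral_cong)
    fix y
    have "\<rho> (x - y) = \<rho> (y - x)" for x using mollifier_minus[OF moll, of "y - x"] by simp
    then have "(\<integral>\<^sup>+x. ennreal (\<rho> (x - y)) \<partial>lborel) = (\<integral>\<^sup>+x. ennreal (\<rho> (y - x)) \<partial>lborel)"
      by (simp only:)
    also have "\<dots> = 1" using nn_integral_eq_integral[OF mollifier_integrable_shift[OF moll]] mollifier_nonneg[OF moll] by (simp add: mollifier_integral_shift[OF moll])
    finally show "(\<integral>\<^sup>+x. ennreal (\<rho> (x - y)) * indicator (W - E) y \<partial>lborel) = indicator (W - E) y"
      by (simp add: nn_integral_multc)
  qed
  also have "\<dots> = emeasure lborel (W - E)" by simp
  also have "\<dots> < ennreal (\<delta>\<^sup>2)" by (rule W)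
  finally have small: "ennreal \<delta> * emeasure lborel S < ennreal (\<delta>\<^sup>2)" .
  have Kfm: "K n \<in> fmeasurable lborel"
    by (rule fmeasurableI2[OF Efm]) (use Kb in \<open>auto simp: K_def\<close>)
  have Sfm: "S \<in> fmeasurable lborel"
    by (rule fmeasurableI2[OF Kfm]) (use Sb in \<open>auto simp: S_def\<close>)
  have "measure lborel S < \<delta>"
  proof -
    have "ennreal (\<delta> * measure lborel S) < ennreal (\<delta>\<^sup>2)"
      using small \<delta> Sfm by (simp add: ennreal_mult emeasure_eq_measure2)
    then have "\<delta> * measure lborel S < \<delta> * \<delta>" using \<delta> by (simp add: ennreal_less_iff power2_eq_square)
    then show ?thesis using \<delta> by simp
  qed
  moreover have "measure lborel (K n - S) = measure lborel (K n) - measure lborel S"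
    using Kfm Sfm by (intro measure_Diff) (auto simp: S_def fmeasurableD2)
  moreover have "measure lborel (K n - S) \<le> measure lborel {x. u x > s}" if s: "\<delta> < s" "s < 1 - \<delta>" for s
  proof (rule measure_mono_fmeasurable)
    show "K n - S \<subseteq> {x. u x > s}" using s by (auto simp: S_def)
    show "K n - S \<in> sets lborel" using Kb Sb by auto
    have "bounded {x. u x > s}" using R s unfolding bounded_iff by (intro exI[of _ R]) (force intro: less_imp_le)
    then show "{x. u x > s} \<in> fmeasurable lborel"
      by (intro open_bounded_fmeasurable open_Collect_less continuous_intros uc)
  qed
  ultimately have lev: "measure lborel E - \<delta>\<^sup>2 - \<delta> \<le> measure lborel {x. u x > s}" if "\<delta> < s" "s < 1 - \<delta>" for s
    using n that by fastforce
  show ?thesis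
    using moll R lev unfolding u_def by (intro exI[of _ \<rho>] exI[of _ \<Gamma>] exI[of _ r] exI[of _ R] conjI allI impI) auto
qed

lemma isoperimetric_inequality_borel:
  fixes E :: "'a::euclidean_space set"
  assumes E: "E \<in> sets borel" "emeasure lborel E < \<infinity>" and pos: "measure lborel E > 0"
  shows "ereal (isoperimetric_bound TYPE('a) (measure lborel E)) \<le> perimeter E"
proof -
  define M where "M = measure lborel E"
  have intE: "integrable lborel (indicator E :: 'a \<Rightarrow> real)" using E by (simp add: integrable_indicator_iff)
  \<comment> \<open>The factor \<open>1 - 2 * \<delta>\<close> is the length of the range of levels
    from \<open>\<delta>\<close> to \<open>1 - \<delta>\<close>, and
    \<open>M - \<delta>\<^sup>2 - \<delta>\<close> is the measure that every one of those superlevel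
    sets is known to have.\<close>
  have approx: "ereal ((1 - 2 * \<delta>) * isoperimetric_bound TYPE('a) (M - \<delta>\<^sup>2 - \<delta>)) \<le> perimeter E"
    if \<delta>: "0 < \<delta>" "\<delta> < 1/2" "M - \<delta>\<^sup>2 - \<delta> > 0" for \<delta>
  proof -
    obtain \<rho> and \<Gamma> :: "'a \<Rightarrow> 'a" and r R where moll: "mollifier \<rho> \<Gamma> r"
      and R: "\<And>x. conv \<rho> (indicator E) x > \<delta> \<Longrightarrow> norm x < R"
      and lev: "\<And>s. \<delta> < s \<Longrightarrow> s < 1 - \<delta> \<Longrightarrow> M - \<delta>\<^sup>2 - \<delta> \<le> measure lborel {x. conv \<rho> (indicator E) x > (s::real)}"
      using mollified_indicator[OF E \<delta>(1,2)] unfolding M_def by blast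
    note kern = mollifier_imp_kernel[OF moll]
    have "(1 - \<delta> - \<delta>) * isoperimetric_bound TYPE('a) (M - \<delta>\<^sup>2 - \<delta>)
      \<le> (LINT x|lborel. indicator (ball 0 (R + 1)) x * norm (conv_grad \<Gamma> (indicator E) x))"
    proof (rule level_set_inequality[where u="conv \<rho> (indicator E)"])
      show "\<exists>\<delta>>0. \<forall>x h. norm h < \<delta> \<longrightarrow> \<bar>conv \<rho> (indicator E) (x + h) - conv \<rho> (indicator E) x - conv_grad \<Gamma> (indicator E) x \<bullet> h\<bar> \<le> e * norm h"
        if "e > 0" for e
        using conv_uniform_linearization[OF kern intE that] by (simp add: conv_deriv_eq_grad[OF kern intE])
      show "continuous_on UNIV (conv \<rho> (indicator E :: 'a \<Rightarrow> real))" "continuous_on UNIV (conv_grad \<Gamma> (indicator E))"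
        using has_gradient_conv[OF kern intE] has_gradient_continuous by (auto simp: has_gradient_def)
    qed (use \<delta> R lev in auto)
    then have "ereal ((1 - 2 * \<delta>) * isoperimetric_bound TYPE('a) (M - \<delta>\<^sup>2 - \<delta>))
      \<le> ereal (LINT x|lborel. indicator (ball 0 (R + 1)) x * norm (conv_grad \<Gamma> (indicator E) x))"
      by simp
    also have "\<dots> \<le> perimeter E" by (rule integral_norm_conv_grad_le_perimeter[OF moll E])
    finally show ?thesis .
  qed
  have "((\<lambda>\<delta>. ereal ((1 - 2 * \<delta>) * isoperimetric_bound TYPE('a) (M - \<delta>\<^sup>2 - \<delta>))) \<longlongrightarrow>
      ereal ((1 - 2 * 0) * isoperimetric_bound TYPE('a) (M - 0\<^sup>2 - 0))) (at_right 0)"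
    unfolding isoperimetric_bound_def using pos
    by (intro tendsto_ereal tendsto_intros) (auto simp: M_def)
  moreover have "\<forall>\<^sub>F \<delta> in at_right 0. ereal ((1 - 2 * \<delta>) * isoperimetric_bound TYPE('a) (M - \<delta>\<^sup>2 - \<delta>)) \<le> perimeter E"
  proof -
    have "((\<lambda>\<delta>. M - \<delta>\<^sup>2 - \<delta>) \<longlongrightarrow> M - 0\<^sup>2 - 0) (at_right 0)" by (intro tendsto_intros)
    then have "\<forall>\<^sub>F \<delta> in at_right 0. M - \<delta>\<^sup>2 - \<delta> > 0"
      using pos by (intro order_tendstoD(1)) (auto simp: M_def)
    moreover have "\<forall>\<^sub>F \<delta> in at_right (0::real). 0 < \<delta> \<and> \<delta> < 1/2"
      by (auto simp: eventually_at_right_field intro!: exI[of _ "1/2"])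
    ultimately show ?thesis by eventually_elim (use approx in auto)
  qed
  ultimately have "ereal ((1 - 2 * 0) * isoperimetric_bound TYPE('a) (M - 0\<^sup>2 - 0)) \<le> perimeter E"
    by (intro tendsto_upperbound[OF _ _ trivial_limit_at_right_real])
  then show ?thesis by (simp add: M_def)
qed

lemma perimeter_Un_null_set:
  fixes S N :: "'a::euclidean_space set"
  assumes "S \<in> sets lebesgue" "N \<in> null_sets lebesgue"
  shows "perimeter (S \<union> N) = perimeter S"
proof -
  have "(LINT x:S \<union> N|lebesgue. divergence \<phi> x) = (LINT x:S|lebesgue. divergence \<phi> x)"
    if "C1c_vector_field \<phi>" for \<phi> :: "'a \<Rightarrow> 'a"
    unfolding set_lebesgue_integral_def
  proof (rule integral_cong_AE)
    have "C1_vector_field \<phi>" using that by (simp add: C1c_vector_field_def)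
    then have "divergence \<phi> \<in> borel_measurable borel"
      by (intro borel_measurable_continuous_onI continuous_on_divergence)
    then have [measurable]: "divergence \<phi> \<in> borel_measurable lebesgue"
      by (simp add: measurable_completion)
    show "(\<lambda>x. indicat_real (S \<union> N) x *\<^sub>R divergence \<phi> x) \<in> borel_measurable lebesgue"
      "(\<lambda>x. indicat_real S x *\<^sub>R divergence \<phi> x) \<in> borel_measurable lebesgue"
      using assms by (auto intro!: borel_measurable_times borel_measurable_indicator)
    show "AE x in lebesgue. indicat_real (S \<union> N) x *\<^sub>R divergence \<phi> x = indicat_real S x *\<^sub>R divergence \<phi> x"
      using AE_not_in[OF assms(2)] by eventually_elim (simp add: indicator_def)
  qed
  then show ?thesis unfolding perimeter_def by (intro SUP_cong) auto
qed

text \<open>A Lebesgue measurable set is a Borel set together with a null set, and the perimeter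
  does not see null sets.\<close>

theorem isoperimetric_inequality:
  fixes E :: "'a::euclidean_space set"
  assumes E: "E \<in> sets lebesgue" "emeasure lebesgue E < \<infinity>" and pos: "emeasure lebesgue E > 0"
  shows "ereal (isoperimetric_bound TYPE('a) (measure lebesgue E)) \<le> perimeter E"
proof -
  obtain S N N' where SN: "E = S \<union> N" "N \<subseteq> N'" "N' \<in> null_sets lborel" "S \<in> sets lborel"
    using sets_completionE[OF E(1)] by blast
  have N: "N \<in> null_sets lebesgue"
    using SN null_sets_completionI[OF SN(3)] null_sets_completion_subset by blast
  have eq: "emeasure lebesgue E = emeasure lborel S"
    using SN N by (simp add: emeasure_Un_null_set)
  then have meq: "measure lebesgue E = measure lborel S" by (simp add: measure_def)
  have "measure lborel S > 0"
    using E pos eq by (simp add: measure_def enn2real_positive_iff less_top)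
  with isoperimetric_inequality_borel[of S] SN E eq
  have "ereal (isoperimetric_bound TYPE('a) (measure lborel S)) \<le> perimeter S" by simp
  also have "perimeter S = perimeter E"
    unfolding SN(1) by (rule perimeter_Un_null_set[symmetric]) (use SN N in auto)
  finally show ?thesis unfolding meq .
qed

section \<open>Cheeger constants\<close>

lemma isoperimetric_const_pos: "isoperimetric_const TYPE('a::euclidean_space) > 0"
  by (simp add: isoperimetric_const_def)

lemma admissible_measure_pos: "\<Omega> \<in> admissible \<Longrightarrow> 0 < measure lebesgue \<Omega>"
  by (auto simp: admissible_def measure_def enn2real_positive_iff less_top)

lemma admissible_finite: "\<Omega> \<in> admissible \<Longrightarrow> emeasure lebesgue \<Omega> < \<infinity>"
  unfolding admissible_def by blast

lemma admissible_sets: "\<Omega> \<in> admissible \<Longrightarrow> \<Omega> \<in> sets lebesgue"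
  by (auto simp: admissible_def)

lemma cheeger_geI:
  fixes \<Omega> :: "'a::euclidean_space set"
  assumes fin: "emeasure lebesgue \<Omega> < \<infinity>" "\<Omega> \<in> sets lebesgue"
    and per: "\<And>E. E \<in> sets lebesgue \<Longrightarrow> E \<subseteq> \<Omega> \<Longrightarrow> 0 < measure lebesgue E \<Longrightarrow> emeasure lebesgue E < \<infinity> \<Longrightarrow>
      ereal (k * measure lebesgue E) \<le> perimeter E"
  shows "ereal k \<le> cheeger \<Omega>"
  unfolding cheeger_def
proof (rule INF_greatest)
  fix E assume "E \<in> {E. E \<in> sets lebesgue \<and> emeasure lebesgue E > 0 \<and> closure E \<subseteq> \<Omega>}"
  then have E: "E \<in> sets lebesgue" "emeasure lebesgue E > 0" "E \<subseteq> \<Omega>" using closure_subset by auto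
  have finE: "emeasure lebesgue E < \<infinity>" using emeasure_mono[OF E(3) fin(2)] fin(1) by (rule le_less_trans)
  have pos: "measure lebesgue E > 0" using E finE by (simp add: measure_def enn2real_positive_iff less_top)
  have em: "enn2ereal (emeasure lebesgue E) = ereal (measure lebesgue E)"
    using finE by (simp add: emeasure_eq_ennreal_measure less_top)
  have "ereal k = ereal (k * measure lebesgue E) / ereal (measure lebesgue E)" using pos by simp
  also have "\<dots> \<le> perimeter E / ereal (measure lebesgue E)"
    using pos by (intro ereal_divide_right_mono per E(1,3) finE) auto
  finally show "ereal k \<le> perimeter E / enn2ereal (emeasure lebesgue E)" unfolding em .
qed

text \<open>The isoperimetric bound for \<open>P(E) / |E|\<close> is a constant times
  \<open>|E| powr (- 1 / d)\<close>. It decreases in the measure, so over subsets of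
  \<open>\<Omega>\<close> it is least at the full measure of \<open>\<Omega>\<close>, whatever the
  subset is.\<close>

lemma cheeger_admissible_ge:
  fixes \<Omega> :: "'a::euclidean_space set"
  assumes \<Omega>: "\<Omega> \<in> admissible"
  shows "ereal (isoperimetric_const TYPE('a)) \<le> cheeger \<Omega> * ereal (measure lebesgue \<Omega> powr (1 / DIM('a)))"
proof -
  define M where "M = measure lebesgue \<Omega>"
  define C where "C = isoperimetric_const TYPE('a)"
  define p where "p = 1 / real DIM('a)"
  have M: "M > 0" using admissible_measure_pos[OF \<Omega>] by (simp add: M_def)
  have "ereal (C * M powr (- p)) \<le> cheeger \<Omega>"
  proof (rule cheeger_geI[OF admissible_finite[OF \<Omega>] admissible_sets[OF \<Omega>]])
    fix E assume E: "E \<in> sets lebesgue" "E \<subseteq> \<Omega>" "0 < measure lebesgue E" "emeasure lebesgue E < \<infinity>"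
    define m where "m = measure lebesgue E"
    have "m \<le> M" unfolding m_def M_def using admissible_measure_pos[OF \<Omega>] admissible_finite[OF \<Omega>] admissible_sets[OF \<Omega>] E
      by (intro measure_mono_fmeasurable fmeasurableI) auto
    then have "C * M powr (- p) * m \<le> C * m powr (- p) * m"
      using E(3) isoperimetric_const_pos[where 'a='a]
      by (intro mult_right_mono mult_left_mono powr_mono2') (auto simp: m_def C_def p_def)
    also have "\<dots> = isoperimetric_bound TYPE('a) m"
      using E(3) powr_add[of m "- p" 1] by (simp add: isoperimetric_bound_def C_def p_def m_def)
    finally have "ereal (C * M powr (- p) * m) \<le> ereal (isoperimetric_bound TYPE('a) m)" by simp
    also have "\<dots> \<le> perimeter E"
      unfolding m_def using E by (intro isoperimetric_inequality) (auto simp: measure_def enn2real_positive_iff)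
    finally show "ereal (C * M powr (- p) * measure lebesgue E) \<le> perimeter E" by (simp add: m_def)
  qed
  then have "ereal (C * M powr (- p)) * ereal (M powr p) \<le> cheeger \<Omega> * ereal (M powr p)"
    by (intro ereal_mult_right_mono) auto
  moreover have "C * M powr (- p) * M powr p = C" using M by (simp add: powr_minus)
  ultimately show ?thesis unfolding C_def M_def p_def by simp
qed

lemma ball_admissible: "r > 0 \<Longrightarrow> ball c r \<in> admissible"
  unfolding admissible_def
  using emeasure_lborel_ball_finite[of c r] content_ball_gt_0_iff[of c r]
  by (auto simp: emeasure_eq_ennreal_measure less_top)

text \<open>The ball is not a competitor for its own Cheeger constant, since its closure is not
  contained in it; hence the limit over concentric balls of smaller radius.\<close>

lemma cheeger_ball_le:
  fixes c :: "'a::euclidean_space"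
  assumes r: "r > 0"
  shows "cheeger (ball c r) \<le> ereal (DIM('a) / r)"
proof -
  have le: "cheeger (ball c r) \<le> ereal (DIM('a) / \<rho>)" if \<rho>: "0 < \<rho>" "\<rho> < r" for \<rho>
  proof -
    have m: "measure lborel (ball c \<rho>) > 0" using \<rho> by simp
    have em: "emeasure lebesgue (ball c \<rho>) = ennreal (measure lborel (ball c \<rho>))"
      using emeasure_lborel_ball_finite[of c \<rho>] by (simp add: emeasure_eq_ennreal_measure less_top)
    have "cheeger (ball c r) \<le> perimeter (ball c \<rho>) / enn2ereal (emeasure lebesgue (ball c \<rho>))"
      unfolding cheeger_def
    proof (rule INF_lower)
      show "ball c \<rho> \<in> {E. E \<in> sets lebesgue \<and> 0 < emeasure lebesgue E \<and> closure E \<subseteq> ball c r}"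
        using \<rho> m em by (auto simp: ennreal_less_zero_iff)
    qed
    also have "\<dots> = perimeter (ball c \<rho>) / ereal (measure lborel (ball c \<rho>))"
      unfolding em using m by (simp add: enn2ereal_ennreal)
    also have "\<dots> \<le> ereal (DIM('a) / \<rho> * measure lborel (ball c \<rho>)) / ereal (measure lborel (ball c \<rho>))"
      using m by (intro ereal_divide_right_mono perimeter_ball_le \<rho>) auto
    also have "\<dots> = ereal (DIM('a) / \<rho>)" using m by simp
    finally show ?thesis .
  qed
  have "((\<lambda>\<rho>. ereal (DIM('a) / \<rho>)) \<longlongrightarrow> ereal (DIM('a) / r)) (at_left r)"
    using r by (intro tendsto_ereal tendsto_intros) auto
  moreover have "\<forall>\<^sub>F \<rho> in at_left r. cheeger (ball c r) \<le> ereal (DIM('a) / \<rho>)"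
    using r le by (auto simp: eventually_at_left_field intro!: exI[of _ 0])
  ultimately show ?thesis
    by (intro tendsto_lowerbound[OF _ _ trivial_limit_at_left_real])
qed

lemma cheeger_ball:
  fixes c :: "'a::euclidean_space"
  assumes r: "r > 0"
  shows "cheeger (ball c r) * ereal (measure lebesgue (ball c r) powr (1 / DIM('a))) = ereal (isoperimetric_const TYPE('a))"
proof (rule antisym)
  define \<omega> where "\<omega> = measure lborel (ball (0::'a) 1)"
  have \<omega>: "\<omega> > 0" by (simp add: \<omega>_def)
  have "measure lebesgue (ball c r) = r ^ DIM('a) * \<omega>"
    using content_ball_conv_unit_ball[of r c] r by (simp add: \<omega>_def)
  then have m: "measure lebesgue (ball c r) powr (1 / DIM('a)) = r * \<omega> powr (1 / DIM('a))"
    using r \<omega> by (simp add: powr_mult powr_powr flip: powr_realpow)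
  have "cheeger (ball c r) * ereal (r * \<omega> powr (1 / DIM('a))) \<le> ereal (DIM('a) / r) * ereal (r * \<omega> powr (1 / DIM('a)))"
    using r by (intro ereal_mult_right_mono cheeger_ball_le) auto
  also have "\<dots> = ereal (isoperimetric_const TYPE('a))" using r by (simp add: isoperimetric_const_def \<omega>_def)
  finally show "cheeger (ball c r) * ereal (measure lebesgue (ball c r) powr (1 / DIM('a))) \<le> ereal (isoperimetric_const TYPE('a))"
    unfolding m .
qed (rule cheeger_admissible_ge[OF ball_admissible[OF r]])

section \<open>Thin slabs and flat boxes\<close>

lemma has_gradient_mult:
  assumes f: "has_gradient f F" and g: "has_gradient g G"
  shows "has_gradient (\<lambda>x. f x * g x) (\<lambda>x. f x *\<^sub>R G x + g x *\<^sub>R F x)"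
  unfolding has_gradient_def
proof
  show "continuous_on UNIV (\<lambda>x. f x *\<^sub>R G x + g x *\<^sub>R F x)"
    using f g has_gradient_continuous[OF f] has_gradient_continuous[OF g]
    unfolding has_gradient_def by (auto intro!: continuous_intros)
  show "\<forall>x. ((\<lambda>x. f x * g x) has_derivative (\<bullet>) (f x *\<^sub>R G x + g x *\<^sub>R F x)) (at x)"
  proof
    fix x
    have "(\<bullet>) (f x *\<^sub>R G x + g x *\<^sub>R F x) = (\<lambda>h. f x * (G x \<bullet> h) + (F x \<bullet> h) * g x)"
      by (auto simp: inner_add_left mult.commute)
    then show "((\<lambda>x. f x * g x) has_derivative (\<bullet>) (f x *\<^sub>R G x + g x *\<^sub>R F x)) (at x)"
      using has_derivative_mult[of f "(\<bullet>) (F x)" x UNIV g "(\<bullet>) (G x)"] f g by (simp add: has_gradient_def)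
  qed
qed

lemma has_gradient_arctan_inner:
  fixes b :: "'a::euclidean_space"
  shows "has_gradient (\<lambda>x. arctan (x \<bullet> b / w)) (\<lambda>x. (1 / (1 + (x \<bullet> b / w)\<^sup>2) / w) *\<^sub>R b)"
  unfolding has_gradient_def
proof
  have "1 + (x \<bullet> b / w)\<^sup>2 \<noteq> 0" for x by (metis add_pos_nonneg less_irrefl zero_le_power2 zero_less_one)
  then show "continuous_on UNIV (\<lambda>x. (1 / (1 + (x \<bullet> b / w)\<^sup>2) / w) *\<^sub>R b)"
    by (cases "w = 0") (auto intro!: continuous_intros)
  show "\<forall>x. ((\<lambda>x. arctan (x \<bullet> b / w)) has_derivative (\<bullet>) ((1 / (1 + (x \<bullet> b / w)\<^sup>2) / w) *\<^sub>R b)) (at x)"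
  proof
    fix x
    have i: "((\<lambda>x. x \<bullet> b / w) has_derivative (\<lambda>h. h \<bullet> b / w)) (at x)"
      by (cases "w = 0") (auto intro!: derivative_eq_intros)
    have "((\<lambda>x. arctan (x \<bullet> b / w)) has_derivative (\<lambda>h. inverse (1 + (x \<bullet> b / w)\<^sup>2) * (h \<bullet> b / w))) (at x)"
      using has_derivative_compose[OF i] DERIV_arctan unfolding has_field_derivative_def by blast
    moreover have "(\<bullet>) ((1 / (1 + (x \<bullet> b / w)\<^sup>2) / w) *\<^sub>R b) = (\<lambda>h. inverse (1 + (x \<bullet> b / w)\<^sup>2) * (h \<bullet> b / w))"
      by (auto simp: divide_inverse inner_commute)
    ultimately show "((\<lambda>x. arctan (x \<bullet> b / w)) has_derivative (\<bullet>) ((1 / (1 + (x \<bullet> b / w)\<^sup>2) / w) *\<^sub>R b)) (at x)"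
      by simp
  qed
qed

lemma has_derivative_gradient_scaleR:
  assumes f: "has_gradient f F"
  shows "((\<lambda>x. f x *\<^sub>R v) has_derivative (\<lambda>h. (F x \<bullet> h) *\<^sub>R v)) (at x)"
  using f has_derivative_scaleR_left[of f "(\<bullet>) (F x)" "at x" v] by (simp add: has_gradient_def)

lemma C1_vector_field_gradient_scaleR:
  fixes v :: "'a::euclidean_space"
  assumes f: "has_gradient f F"
  shows "C1_vector_field (\<lambda>x. f x *\<^sub>R v)"
  unfolding C1_vector_field_def
proof (intro exI conjI allI)
  have bl: "blinfun_apply (Blinfun (\<lambda>h. (F x \<bullet> h) *\<^sub>R v)) = (\<lambda>h. (F x \<bullet> h) *\<^sub>R v)" for x
    by (rule bounded_linear_Blinfun_apply[OF has_derivative_bounded_linear[OF has_derivative_gradient_scaleR[OF f]]])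
  show "((\<lambda>x. f x *\<^sub>R v) has_derivative blinfun_apply (Blinfun (\<lambda>h. (F x \<bullet> h) *\<^sub>R v))) (at x)" for x
    using has_derivative_gradient_scaleR[OF f] bl by simp
  show "continuous_on UNIV (\<lambda>x. Blinfun (\<lambda>h. (F x \<bullet> h) *\<^sub>R v))"
    by (rule continuous_on_blinfun_componentwise)
       (use f in \<open>auto simp: bl has_gradient_def intro!: continuous_intros\<close>)
qed

lemma divergence_gradient_scaleR:
  fixes v :: "'a::euclidean_space"
  assumes f: "has_gradient f F"
  shows "divergence (\<lambda>x. f x *\<^sub>R v) x = F x \<bullet> v"
  unfolding divergence_eq[OF has_derivative_gradient_scaleR[OF f]] by (subst (2) euclidean_inner) simp

text \<open>The test field is a multiple of \<open>b\<close> by \<open>1/2 * arctan (x \<bullet> b / w)\<close>, cut off outside \<open>E\<close>: it is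
  bounded by \<open>pi / 4 < 1\<close>, and its divergence on the slab is at least \<open>1 / (4 * w)\<close>.\<close>

lemma perimeter_slab_ge:
  fixes E :: "'a::euclidean_space set"
  assumes E: "E \<in> sets lebesgue" "bounded E" "emeasure lebesgue E < \<infinity>"
    and b: "b \<in> Basis" and w: "w > 0" and thin: "\<And>x. x \<in> E \<Longrightarrow> \<bar>x \<bullet> b\<bar> \<le> w"
  shows "ereal (1 / (4 * w) * measure lebesgue E) \<le> perimeter E"
proof -
  obtain R0 where R0: "\<And>x. x \<in> E \<Longrightarrow> norm x \<le> R0" using E(2) bounded_iff by blast
  \<comment> \<open>The inner radius of \<open>bump\<close> must be nonnegative, whereas
    \<open>R0\<close> could be negative for empty \<open>E\<close>.\<close>
  define R where "R = \<bar>R0\<bar>"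
  have R: "0 \<le> R" "R < R + 1" and ER: "\<And>x. x \<in> E \<Longrightarrow> norm x \<le> R" using order_trans[OF R0 abs_ge_self] by (auto simp: R_def)
  define f where "f x = 1/2 * arctan (x \<bullet> b / w) * bump R (R + 1) x" for x
  define F where "F x = (1/2 * arctan (x \<bullet> b / w)) *\<^sub>R bump_grad R (R + 1) x
      + bump R (R + 1) x *\<^sub>R ((1/2) *\<^sub>R (1 / (1 + (x \<bullet> b / w)\<^sup>2) / w) *\<^sub>R b)" for x
  have f: "has_gradient f F" unfolding f_def[abs_def] F_def[abs_def]
    by (intro has_gradient_mult has_gradient_scale has_gradient_arctan_inner has_gradient_bump R)
  define \<phi> where "\<phi> x = f x *\<^sub>R b" for x
  have C1: "C1_vector_field \<phi>" and div: "\<And>x. divergence \<phi> x = F x \<bullet> b"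
    unfolding \<phi>_def[abs_def] using C1_vector_field_gradient_scaleR[OF f] divergence_gradient_scaleR[OF f] by auto
  have "compact (closure {x. \<phi> x \<noteq> 0})"
  proof -
    have "{x. \<phi> x \<noteq> 0} \<subseteq> cball 0 (R + 1)"
      using bump_eq_0[OF R] by (force simp: \<phi>_def f_def not_le)
    then show ?thesis using bounded_subset bounded_cball compact_closure by blast
  qed
  moreover have "norm (\<phi> x) \<le> 1" for x
  proof -
    have "\<bar>1/2 * arctan (x \<bullet> b / w)\<bar> \<le> 1"
      using arctan_lbound[of "x \<bullet> b / w"] arctan_ubound[of "x \<bullet> b / w"] pi_less_4 by (simp add: abs_le_iff)
    moreover have "\<bar>bump R (R + 1) x\<bar> \<le> 1" using bump_nonneg[of _ _ x] bump_le_1[of _ _ x] by simp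
    ultimately have "\<bar>1/2 * arctan (x \<bullet> b / w)\<bar> * \<bar>bump R (R + 1) x\<bar> \<le> 1 * 1" by (intro mult_mono) auto
    then show ?thesis using b by (simp add: \<phi>_def f_def abs_mult)
  qed
  ultimately have adm: "\<phi> \<in> {\<phi>. C1c_vector_field \<phi> \<and> (AE x in lebesgue. norm (\<phi> x) \<le> 1)}"
    using C1 by (simp add: C1c_vector_field_def)
  have divE: "divergence \<phi> x = 1 / (2 * w * (1 + (x \<bullet> b / w)\<^sup>2))" if "x \<in> E" for x
    using b ER[OF that] by (simp add: div F_def bump_eq_1[OF R] bump_grad_eq_0[OF R])
  \<comment> \<open>On the slab \<open>(x \<bullet> b / w)\<^sup>2\<close> lies between 0 and 1, and
    the cutoff is locally inactive in the divergence. The lower bound is the estimate itself; the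
    upper one serves integrability.\<close>
  have bounds: "1 / (4 * w) \<le> divergence \<phi> x \<and> \<bar>divergence \<phi> x\<bar> \<le> 1 / (2 * w)" if "x \<in> E" for x
  proof -
    have "\<bar>x \<bullet> b / w\<bar> \<le> 1" using thin[OF that] w by simp
    then have s: "(x \<bullet> b / w)\<^sup>2 \<le> 1" by (simp add: abs_square_le_1)
    have "2 * w * (1 + (x \<bullet> b / w)\<^sup>2) \<le> 2 * w * 2" "2 * w * 1 \<le> 2 * w * (1 + (x \<bullet> b / w)\<^sup>2)"
      using w s by (intro mult_left_mono; simp)+
    then have "1 / (2 * w * 2) \<le> 1 / (2 * w * (1 + (x \<bullet> b / w)\<^sup>2))" "1 / (2 * w * (1 + (x \<bullet> b / w)\<^sup>2)) \<le> 1 / (2 * w * 1)"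
      "0 \<le> 1 / (2 * w * (1 + (x \<bullet> b / w)\<^sup>2))"
      using w by (intro divide_left_mono mult_pos_pos add_pos_nonneg divide_nonneg_nonneg; simp add: add_pos_nonneg)+
    then show ?thesis unfolding divE[OF that] by simp
  qed
  have meas: "divergence \<phi> \<in> borel_measurable lebesgue"
    using borel_measurable_continuous_onI[OF continuous_on_divergence[OF C1]] by (simp add: measurable_completion)
  have "1 / (4 * w) * measure lebesgue E = (LINT x|lebesgue. indicator E x *\<^sub>R (1 / (4 * w)))"
    using E by simp
  also have "\<dots> \<le> (LINT x:E|lebesgue. divergence \<phi> x)"
    unfolding set_lebesgue_integral_def
  proof (rule integral_mono)
    show "integrable lebesgue (\<lambda>x. indicat_real E x *\<^sub>R (1 / (4 * w)))"
      by (rule integrableI_bounded_set_indicator[where B="1 / (4 * w)"]) (use E w in auto)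
    show "integrable lebesgue (\<lambda>x. indicat_real E x *\<^sub>R divergence \<phi> x)"
      by (rule integrableI_bounded_set_indicator[where B="1 / (2 * w)"]) (use E meas bounds in auto)
    show "indicat_real E x *\<^sub>R (1 / (4 * w)) \<le> indicat_real E x *\<^sub>R divergence \<phi> x" for x
      using bounds[of x] by (simp add: indicator_def)
  qed
  finally have "ereal (1 / (4 * w) * measure lebesgue E) \<le> ereal (LINT x:E|lebesgue. divergence \<phi> x)" by simp
  also have "\<dots> \<le> perimeter E"
    unfolding perimeter_def by (rule SUP_upper[OF adm])
  finally show ?thesis .
qed

text \<open>The box with half-width \<open>w\<close> in one direction and 1 in all others has
  measure \<open>2 ^ d * w\<close>. Its Cheeger constant is at least \<open>1 / (4 * w)\<close> by
  the slab estimate, while the factor \<open>2 * w powr (1 / d)\<close> is at least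
  \<open>2 * w powr (1/2)\<close> for \<open>d \<ge> 2\<close> and \<open>w \<le> 1\<close>. The
  product is therefore at least \<open>1 / (2 * sqrt w)\<close>.\<close>

lemma exists_convex_admissible_large:
  assumes d: "DIM('a::euclidean_space) \<ge> 2" and N: "N > 0"
  shows "\<exists>\<Omega>\<in>(convex_admissible :: 'a set set). ereal N \<le> cheeger \<Omega> * ereal (measure lebesgue \<Omega> powr (1 / DIM('a)))"
proof -
  obtain b :: 'a where b: "b \<in> Basis" using nonempty_Basis by blast
  \<comment> \<open>Chosen so that \<open>1 / (2 * sqrt w)\<close> is \<open>N + 1/2\<close>; the
    summand 1 in the base ensures \<open>w \<le> 1\<close>.\<close>
  define w where "w = 1 / (2 * N + 1)\<^sup>2"
  have w: "w > 0" "w \<le> 1" using N by (auto simp: w_def divide_le_eq_1 one_le_power)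
  define a where "a = (\<Sum>i\<in>Basis. (if i = b then w else 1) *\<^sub>R i)"
  have ai: "a \<bullet> i = (if i = b then w else 1)" if "i \<in> Basis" for i using that by (simp add: a_def)
  define \<Omega> where "\<Omega> = box (- a) a"
  have "measure lborel \<Omega> = (\<Prod>i\<in>Basis. (a - (- a)) \<bullet> i)"
    unfolding \<Omega>_def by (rule measure_lborel_box) (use w in \<open>simp add: ai\<close>)
  also have "\<dots> = (\<Prod>i\<in>Basis. 2 * (if i = b then w else 1))"
    by (intro prod.cong refl) (simp add: ai inner_add_left)
  also have "\<dots> = 2 ^ DIM('a) * w" using b by (simp add: prod.distrib)
  finally have m: "measure lebesgue \<Omega> = 2 ^ DIM('a) * w" by (simp add: \<Omega>_def)
  have em: "emeasure lebesgue \<Omega> = ennreal (2 ^ DIM('a) * w)"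
    unfolding m[symmetric] \<Omega>_def using emeasure_lborel_box_finite[of "-a" a] by (simp add: emeasure_eq_ennreal_measure less_top)
  have adm: "\<Omega> \<in> convex_admissible"
    using w em by (auto simp: convex_admissible_def admissible_def \<Omega>_def convex_box)
  have "ereal (1 / (4 * w)) \<le> cheeger \<Omega>"
  proof (rule cheeger_geI)
    fix E assume E: "E \<in> sets lebesgue" "E \<subseteq> \<Omega>" "0 < measure lebesgue E" "emeasure lebesgue E < \<infinity>"
    show "ereal (1 / (4 * w) * measure lebesgue E) \<le> perimeter E"
    proof (rule perimeter_slab_ge[OF E(1) _ E(4) b w(1)])
      show "bounded E" using E(2) bounded_box bounded_subset unfolding \<Omega>_def by blast
      show "\<bar>x \<bullet> b\<bar> \<le> w" if "x \<in> E" for x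
      proof -
        have "x \<in> box (- a) a" using E(2) that by (auto simp: \<Omega>_def)
        then have "- a \<bullet> b < x \<bullet> b" "x \<bullet> b < a \<bullet> b" using b by (auto simp: mem_box)
        then show ?thesis using ai[OF b] by (simp add: abs_le_iff)
      qed
    qed
  qed (use em in \<open>auto simp: \<Omega>_def\<close>)
  then have "ereal (1 / (4 * w)) * ereal (measure lebesgue \<Omega> powr (1 / DIM('a))) \<le> cheeger \<Omega> * ereal (measure lebesgue \<Omega> powr (1 / DIM('a)))"
    by (intro ereal_mult_right_mono) auto
  moreover have "N \<le> 1 / (4 * w) * measure lebesgue \<Omega> powr (1 / DIM('a))"
  proof -
    have "measure lebesgue \<Omega> powr (1 / DIM('a)) = 2 * w powr (1 / DIM('a))"
      using w unfolding m by (simp add: powr_mult powr_powr flip: powr_realpow)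
    moreover have "w powr (1 / DIM('a)) \<ge> w powr (1/2)"
    proof -
      have "1 / real DIM('a) \<le> 1 / 2" using d by (intro divide_left_mono) auto
      then show ?thesis using w by (intro powr_mono') auto
    qed
    ultimately have "1 / (4 * w) * (2 * w powr (1/2)) \<le> 1 / (4 * w) * measure lebesgue \<Omega> powr (1 / DIM('a))"
      using w by (simp add: mult_left_mono divide_right_mono)
    moreover have "1 / (4 * w) * (2 * w powr (1/2)) = N + 1/2"
    proof -
      define k where "k = 2 * N + 1"
      have k: "k > 0" "w = 1 / k\<^sup>2" using N by (auto simp: k_def w_def)
      then have "w powr (1/2) = 1 / k" by (simp add: powr_half_sqrt real_sqrt_divide)
      then have "1 / (4 * w) * (2 * w powr (1/2)) = k / 2" using k by (simp add: power2_eq_square)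
      then show ?thesis by (simp add: k_def)
    qed
    ultimately show ?thesis by linarith
  qed
  ultimately have "ereal N \<le> cheeger \<Omega> * ereal (measure lebesgue \<Omega> powr (1 / DIM('a)))"
    by (metis ereal_less_eq(3) order_trans times_ereal.simps(1))
  then show ?thesis using adm by blast
qed

section \<open>Powers of extended reals and the extremal values\<close>

lemma ereal_powr_nonneg: "0 \<le> ereal_powr x p"
  by (auto simp: ereal_powr_def)

lemma ereal_powr_ereal: "C > 0 \<Longrightarrow> p \<noteq> 0 \<Longrightarrow> ereal_powr (ereal C) p = ereal (C powr p)"
  by (simp add: ereal_powr_def)

lemma ereal_powr_mono: "C > 0 \<Longrightarrow> ereal C \<le> x \<Longrightarrow> p > 0 \<Longrightarrow> ereal (C powr p) \<le> ereal_powr x p"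
  by (cases x) (auto simp: ereal_powr_def powr_mono2)

lemma ereal_powr_antimono: "C > 0 \<Longrightarrow> ereal C \<le> x \<Longrightarrow> p < 0 \<Longrightarrow> ereal_powr x p \<le> ereal (C powr p)"
  by (cases x) (auto simp: ereal_powr_def powr_mono2')

text \<open>In dimension one every open convex set of positive finite measure is an interval, hence
  a ball, and by \<open>cheeger_ball\<close> the functional has one positive real value on all
  balls. So the two clauses on convex sets, which claim the values infinity and 0, carry the
  assumption that the dimension is at least 2. The lower bound of
  \<open>cheeger_admissible_ge\<close> yields a minimum for \<open>q < 1\<close> and a maximum for
  \<open>q > 1\<close>, because \<open>1 - q\<close> changes sign.\<close>

theorem proposition5p3:
  fixes c :: "'a::euclidean_space" and r q :: real
  assumes "r > 0"
  shows "(0 < q \<and> q < 1 \<longrightarrow>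
            (DIM('a) \<ge> 2 \<longrightarrow> (SUP \<Omega>\<in>(convex_admissible :: 'a set set). F1 q \<Omega>) = \<infinity>) \<and>
            is_minimum_of (F1 q (ball c r)) (F1 q ` (admissible :: 'a set set))) \<and>
         (q > 1 \<longrightarrow>
            (DIM('a) \<ge> 2 \<longrightarrow> (INF \<Omega>\<in>(convex_admissible :: 'a set set). F1 q \<Omega>) = 0) \<and>
            is_maximum_of (F1 q (ball c r)) (F1 q ` (admissible :: 'a set set)))"
proof -
  have ball: "F1 q (ball c r) = ereal (isoperimetric_const TYPE('a) powr (1 - q))" if "q \<noteq> 1"
    unfolding F1_def cheeger_ball[OF assms] using that isoperimetric_const_pos by (intro ereal_powr_ereal) auto
  have ball_mem: "F1 q (ball c r) \<in> F1 q ` (admissible :: 'a set set)"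
    using ball_admissible[OF assms] by (rule imageI)
  show ?thesis
  proof (intro conjI impI)
    assume q: "0 < q \<and> q < 1" and d: "DIM('a) \<ge> 2"
    show "(SUP \<Omega>\<in>(convex_admissible :: 'a set set). F1 q \<Omega>) = \<infinity>"
    proof (rule SUP_PInfty)
      fix n :: nat
      \<comment> \<open>The inverse power gives \<open>N powr (1 - q) = real n + 1\<close>; adding 1
        keeps \<open>N\<close> positive for \<open>n = 0\<close>.\<close>
      define N where "N = (real n + 1) powr (1 / (1 - q))"
      obtain \<Omega> :: "'a set" where \<Omega>: "\<Omega> \<in> convex_admissible" "ereal N \<le> cheeger \<Omega> * ereal (measure lebesgue \<Omega> powr (1 / DIM('a)))"
        using exists_convex_admissible_large[OF d, of N] by (auto simp: N_def)
      have "ereal (N powr (1 - q)) \<le> F1 q \<Omega>"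
        unfolding F1_def using \<Omega>(2) q by (intro ereal_powr_mono) (auto simp: N_def)
      moreover have "N powr (1 - q) = real n + 1" using q by (simp add: N_def powr_powr)
      ultimately have "ereal (real n) \<le> F1 q \<Omega>" using order_trans[of "ereal (real n)" "ereal (real n + 1)"] by simp
      with \<Omega>(1) show "\<exists>\<Omega>\<in>(convex_admissible :: 'a set set). ereal (real n) \<le> F1 q \<Omega>" by blast
    qed
  next
    assume q: "0 < q \<and> q < 1"
    show "is_minimum_of (F1 q (ball c r)) (F1 q ` (admissible :: 'a set set))"
      unfolding is_minimum_of_def
    proof (intro conjI ballI ball_mem)
      fix y assume "y \<in> F1 q ` (admissible :: 'a set set)"
      then obtain \<Omega> :: "'a set" where \<Omega>: "\<Omega> \<in> admissible" "y = F1 q \<Omega>" by blast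
      have "ereal (isoperimetric_const TYPE('a) powr (1 - q)) \<le> F1 q \<Omega>"
        unfolding F1_def using q
        by (intro ereal_powr_mono isoperimetric_const_pos cheeger_admissible_ge \<Omega>(1)) auto
      then show "F1 q (ball c r) \<le> y" using q by (simp add: ball \<Omega>(2))
    qed
  next
    assume q: "1 < q" and d: "DIM('a) \<ge> 2"
    show "(INF \<Omega>\<in>(convex_admissible :: 'a set set). F1 q \<Omega>) = 0"
    proof (rule antisym)
      show "(INF \<Omega>\<in>(convex_admissible :: 'a set set). F1 q \<Omega>) \<le> 0"
      proof (rule ereal_le_epsilon2)
        fix e :: real assume e: "0 < e"
        \<comment> \<open>Since \<open>1 - q\<close> is negative, a small \<open>e\<close>
          corresponds to a large \<open>N\<close>, and \<open>N powr (1 - q) = e\<close>.\<close>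
        define N where "N = e powr (1 / (1 - q))"
        obtain \<Omega> :: "'a set" where \<Omega>: "\<Omega> \<in> convex_admissible" "ereal N \<le> cheeger \<Omega> * ereal (measure lebesgue \<Omega> powr (1 / DIM('a)))"
          using exists_convex_admissible_large[OF d, of N] e by (auto simp: N_def)
        have "F1 q \<Omega> \<le> ereal (N powr (1 - q))"
          unfolding F1_def using \<Omega>(2) q e by (intro ereal_powr_antimono) (auto simp: N_def)
        moreover have "N powr (1 - q) = e" using q e by (simp add: N_def powr_powr)
        ultimately show "(INF \<Omega>\<in>(convex_admissible :: 'a set set). F1 q \<Omega>) \<le> 0 + ereal e"
          using INF_lower2[OF \<Omega>(1)] by simp
      qed
      show "0 \<le> (INF \<Omega>\<in>(convex_admissible :: 'a set set). F1 q \<Omega>)"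
        by (rule INF_greatest) (simp add: F1_def ereal_powr_nonneg)
    qed
  next
    assume q: "1 < q"
    show "is_maximum_of (F1 q (ball c r)) (F1 q ` (admissible :: 'a set set))"
      unfolding is_maximum_of_def
    proof (intro conjI ballI ball_mem)
      fix y assume "y \<in> F1 q ` (admissible :: 'a set set)"
      then obtain \<Omega> :: "'a set" where \<Omega>: "\<Omega> \<in> admissible" "y = F1 q \<Omega>" by blast
      have "F1 q \<Omega> \<le> ereal (isoperimetric_const TYPE('a) powr (1 - q))"
        unfolding F1_def using q
        by (intro ereal_powr_antimono isoperimetric_const_pos cheeger_admissible_ge \<Omega>(1)) auto
      then show "y \<le> F1 q (ball c r)" using q by (simp add: ball \<Omega>(2))
    qed
  qed
qed

end
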